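(* Assume that $\sigma:\mathbb{R}^d\to\mathcal{M}_{d\times n}$ and $b:\mathbb{R}^d\to\mathbb{R}^d$ are locally Lipschitzian and that there are constants $A,B$ such that for all $x,y\in\mathbb{R}^d$, $$\sup_{x\in\mathbb{R}^d}\|\sigma(x)\|_{\mathrm{HS}}\le A,\qquad\langle y-x,b(y)-b(x)\rangle\le B(1+|y-x|^2).$$ Then for each $T>0$ there exists some constant $C=C(T,A,B)$, independent of the initial point $x$, such that for every $x\in\mathbb{R}^d$, $\mathbb{P}_x$ satisfies $T_1(C)$ on the space $C([0,T],\mathbb{R}^d)$ of $\mathbb{R}^d$-valued continuous functions on $[0,T]$ equipped with the metric $$d_T(\gamma_1,\gamma_2):=\sup_{t\in[0,T]}|\gamma_1(t)-\gamma_2(t)|.$$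
   Context: $\mathcal{M}_{d\times n}$ is the space of real $d\times n$ matrices, $\|\sigma\|_{\mathrm{HS}}:=\sqrt{\operatorname{tr}\sigma\sigma^t}$ is the Hilbert–Schmidt norm, $\langle\cdot,\cdot\rangle$ and $|\cdot|$ are the Euclidean inner product and norm. Consider the SDE in $\mathbb{R}^d$ $$dX_t=\sigma(X_t)\,dB_t+b(X_t)\,dt,\qquad X_0=x\in\mathbb{R}^d,$$ with $(B_t)$ a standard Brownian motion in $\mathbb{R}^n$. $(X_t(x))$ is its unique nonexplosive solution and $\mathbb{P}_x$ is the law of $X_\cdot(x)$ on path space (here considered on $C([0,T],\mathbb{R}^d)$). For a metric $\rho$ on $S$ and probability measures $\mu,\nu$ on $S$, $W_1^{\rho}(\mu,\nu)=\inf_\pi\iint\rho(x,y)\,d\pi$ over couplings $\pi$ of $(\mu,\nu)$; $H(\nu/\mu)=\int\log\frac{d\nu}{d\mu}\,d\nu$ if $\nu\ll\mu$, $+\infty$ otherwise. $\mu$ satisfies $T_1(C)$ on $(S,\rho)$ if $W_1^{\rho}(\mu,\nu)\le\sqrt{2C\,H(\nu/\mu)}$ for every probability measure $\nu$ on $S$. *)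

theory Defs
  imports "HOL-Probability.Probability"
begin

section \<open>Transportation inequality on a metric space\<close>

definition metric_borel :: "'a metric \<Rightarrow> 'a measure" where
  "metric_borel m = sigma (mspace m) {U. openin (mtopology_of m) U}"

definition couplings :: "'a measure \<Rightarrow> 'a measure \<Rightarrow> ('a \<times> 'a) measure set" where
  "couplings \<mu> \<nu> = {\<pi>. prob_space \<pi> \<and> sets \<pi> = sets (\<mu> \<Otimes>\<^sub>M \<nu>) \<and>
     distr \<pi> \<mu> fst = \<mu> \<and> distr \<pi> \<nu> snd = \<nu>}"

definition wasserstein1 :: "'a metric \<Rightarrow> 'a measure \<Rightarrow> 'a measure \<Rightarrow> ennreal" where
  "wasserstein1 m \<mu> \<nu> =
     (INF \<pi>\<in>couplings \<mu> \<nu>. \<integral>\<^sup>+ z. ennreal (mdist m (fst z) (snd z)) \<partial>\<pi>)"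

text \<open>
  The entropy \<open>H(\<nu>/\<mu>)\<close>, with the arguments in the order of \<^const>\<open>KL_divergence\<close>. For
  probability measures with \<open>\<nu> \<lless> \<mu>\<close> the negative part of \<open>log (d\<nu>/d\<mu>)\<close> is always
  \<open>\<nu>\<close>-integrable and the integral is nonnegative. So the integral is \<open>\<infinity>\<close> whenever the logarithm is
  not integrable (where the Bochner integral would be \<open>0\<close>), and \<^const>\<open>ennreal\<close> truncates nothing.
\<close>

definition relative_entropy :: "'a measure \<Rightarrow> 'a measure \<Rightarrow> ennreal" where
  "relative_entropy \<mu> \<nu> =
     (if absolutely_continuous \<mu> \<nu> \<and> integrable \<nu> (entropy_density (exp 1) \<mu> \<nu>)
      then ennreal (KL_divergence (exp 1) \<mu> \<nu>) else \<infinity>)"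

definition ennreal_sqrt :: "ennreal \<Rightarrow> ennreal" where
  "ennreal_sqrt x = (if x = \<infinity> then \<infinity> else ennreal (sqrt (enn2real x)))"

definition T1_inequality :: "real \<Rightarrow> 'a metric \<Rightarrow> 'a measure \<Rightarrow> bool" where
  "T1_inequality C m \<mu> \<longleftrightarrow>
     prob_space \<mu> \<and> sets \<mu> = sets (metric_borel m) \<and>
     (\<forall>\<nu>. prob_space \<nu> \<and> sets \<nu> = sets (metric_borel m) \<longrightarrow>
        wasserstein1 m \<mu> \<nu> \<le> ennreal_sqrt (2 * ennreal C * relative_entropy \<mu> \<nu>))"

section \<open>Brownian motion and the Ito integral\<close>

definition hs_norm :: "real^'n^'d \<Rightarrow> real" where
  "hs_norm a = sqrt (trace (a ** transpose a))"

text \<open>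
  Only the \<open>\<sigma>\<close>-algebras \<^term>\<open>sets (F t)\<close> matter, and only for \<open>t \<ge> 0\<close>: any filtration
  indexed by \<open>t \<ge> 0\<close> extends to negative times by \<^term>\<open>F 0\<close>. The usual conditions on the filtration are not
  required.
\<close>

definition brownian_motion ::
  "'w measure \<Rightarrow> (real \<Rightarrow> 'w measure) \<Rightarrow> (real \<Rightarrow> 'w \<Rightarrow> real^'n) \<Rightarrow> bool" where
  "brownian_motion M F W \<longleftrightarrow>
     prob_space M \<and> filtration (space M) F \<and> (\<forall>t. subalgebra M (F t)) \<and>
     (\<forall>t\<ge>0. W t \<in> borel_measurable (F t)) \<and>
     (AE \<omega> in M. W 0 \<omega> = 0) \<and>
     (\<forall>\<omega>\<in>space M. continuous_on {0..} (\<lambda>t. W t \<omega>)) \<and>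
     (\<forall>s t. 0 \<le> s \<and> s < t \<longrightarrow>
        distributed M lborel (\<lambda>\<omega>. W t \<omega> - W s \<omega>)
          (\<lambda>x. ennreal (\<Prod>i\<in>UNIV. normal_density 0 (sqrt (t - s)) (x $ i))) \<and>
        prob_space.indep_set M (sets (F s))
          (sets (vimage_algebra (space M) (\<lambda>\<omega>. W t \<omega> - W s \<omega>) borel)))"

definition progressively_measurable ::
  "(real \<Rightarrow> 'w measure) \<Rightarrow> (real \<Rightarrow> 'w \<Rightarrow> 'a::topological_space) \<Rightarrow> bool" where
  "progressively_measurable F H \<longleftrightarrow>
     (\<forall>t\<ge>0. (\<lambda>(s, \<omega>). H s \<omega>) \<in> borel_measurable (restrict_space borel {0..t} \<Otimes>\<^sub>M F t))"

text \<open>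
  The triple \<open>(m, \<tau>, \<xi>)\<close> stands for the process
  \<open>\<Sum>k<m. \<xi> k\<close> on \<open>(\<tau> k, \<tau> (k + 1)]\<close>.
\<close>

definition elementary ::
  "(real \<Rightarrow> 'w measure) \<Rightarrow> nat \<Rightarrow> (nat \<Rightarrow> real) \<Rightarrow> (nat \<Rightarrow> 'w \<Rightarrow> real^'n^'d) \<Rightarrow> bool" where
  "elementary F m \<tau> \<xi> \<longleftrightarrow>
     0 \<le> \<tau> 0 \<and> (\<forall>k<m. \<tau> k \<le> \<tau> (Suc k)) \<and>
     (\<forall>k<m. \<xi> k \<in> borel_measurable (F (\<tau> k)) \<and>
            (\<exists>K. \<forall>\<omega>\<in>space (F (\<tau> k)). hs_norm (\<xi> k \<omega>) \<le> K))"

definition elementary_process ::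
  "nat \<Rightarrow> (nat \<Rightarrow> real) \<Rightarrow> (nat \<Rightarrow> 'w \<Rightarrow> real^'n^'d) \<Rightarrow> real \<Rightarrow> 'w \<Rightarrow> real^'n^'d" where
  "elementary_process m \<tau> \<xi> s \<omega> = (\<Sum>k<m. indicator {\<tau> k<..\<tau> (Suc k)} s *\<^sub>R \<xi> k \<omega>)"

definition elementary_integral ::
  "(real \<Rightarrow> 'w \<Rightarrow> real^'n) \<Rightarrow> nat \<Rightarrow> (nat \<Rightarrow> real) \<Rightarrow> (nat \<Rightarrow> 'w \<Rightarrow> real^'n^'d)
     \<Rightarrow> real \<Rightarrow> 'w \<Rightarrow> real^'d" where
  "elementary_integral W m \<tau> \<xi> t \<omega> =
     (\<Sum>k<m. \<xi> k \<omega> *v (W (min t (\<tau> (Suc k))) \<omega> - W (min t (\<tau> k)) \<omega>))"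

definition null_in_probability :: "'w measure \<Rightarrow> (nat \<Rightarrow> 'w \<Rightarrow> ennreal) \<Rightarrow> bool" where
  "null_in_probability M Z \<longleftrightarrow>
     (\<forall>k. Z k \<in> borel_measurable M) \<and>
     (\<forall>\<epsilon>>0. (\<lambda>k. measure M {\<omega> \<in> space M. ennreal \<epsilon> < Z k \<omega>}) \<longlonglongrightarrow> 0)"

text \<open>
  \<open>J\<close> is a version of \<open>\<integral>\<^sub>0\<^sup>t H dW\<close>, for progressively measurable
  \<open>H\<close> with \<open>\<integral>\<^sub>0\<^sup>t \<parallel>H\<parallel>\<^sup>2 ds < \<infinity>\<close> almost surely: the limit in probability of the integrals of
  elementary processes that approximate \<open>H\<close>. For a Brownian motion \<open>W\<close> the limit exists and does
  not depend on the approximating sequence, up to a null set.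
\<close>

definition has_ito_integral ::
  "'w measure \<Rightarrow> (real \<Rightarrow> 'w measure) \<Rightarrow> (real \<Rightarrow> 'w \<Rightarrow> real^'n) \<Rightarrow>
     (real \<Rightarrow> 'w \<Rightarrow> real^'n^'d) \<Rightarrow> real \<Rightarrow> ('w \<Rightarrow> real^'d) \<Rightarrow> bool" where
  "has_ito_integral M F W H t J \<longleftrightarrow>
     progressively_measurable F H \<and>
     (AE \<omega> in M. (\<integral>\<^sup>+ s\<in>{0..t}. ennreal ((hs_norm (H s \<omega>))\<^sup>2) \<partial>lborel) < \<infinity>) \<and>
     J \<in> borel_measurable M \<and>
     (\<exists>m \<tau> \<xi>. (\<forall>k. elementary F (m k) (\<tau> k) (\<xi> k)) \<and>
        null_in_probability M (\<lambda>k \<omega>. \<integral>\<^sup>+ s\<in>{0..t}.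
          ennreal ((hs_norm (elementary_process (m k) (\<tau> k) (\<xi> k) s \<omega> - H s \<omega>))\<^sup>2) \<partial>lborel) \<and>
        null_in_probability M (\<lambda>k \<omega>.
          ennreal (norm (elementary_integral W (m k) (\<tau> k) (\<xi> k) t \<omega> - J \<omega>))))"

section \<open>The stochastic differential equation\<close>

text \<open>
  \<open>X\<close> is a global (nonexplosive) solution of \<open>dX = \<sigma>(X) dW + b(X) dt\<close>, \<open>X\<^sub>0 = x\<close>, driven by \<open>W\<close>.
  Since both sides have continuous versions, asking for the integral equation almost surely
  at each time is the same as asking for it almost surely at all times.
\<close>

definition sde_solution ::
  "'w measure \<Rightarrow> (real \<Rightarrow> 'w measure) \<Rightarrow> (real \<Rightarrow> 'w \<Rightarrow> real^'n) \<Rightarrow>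
     (real^'d \<Rightarrow> real^'n^'d) \<Rightarrow> (real^'d \<Rightarrow> real^'d) \<Rightarrow> real^'d \<Rightarrow> (real \<Rightarrow> 'w \<Rightarrow> real^'d) \<Rightarrow> bool" where
  "sde_solution M F W \<sigma> b x X \<longleftrightarrow>
     brownian_motion M F W \<and>
     (\<forall>t\<ge>0. X t \<in> borel_measurable (F t)) \<and>
     (\<forall>\<omega>\<in>space M. continuous_on {0..} (\<lambda>t. X t \<omega>)) \<and>
     (AE \<omega> in M. X 0 \<omega> = x) \<and>
     (\<forall>t\<ge>0. \<exists>J. has_ito_integral M F W (\<lambda>s \<omega>. \<sigma> (X s \<omega>)) t J \<and>
        (AE \<omega> in M. X t \<omega> = x + J \<omega> + (LBINT s:{0..t}. b (X s \<omega>))))"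

text \<open>
  \<^const>\<open>cfunspace\<close> consists of the continuous functions on \<open>[0,T]\<close>, extended by
  \<^const>\<open>undefined\<close> outside, with the metric \<open>sup {dist (f t) (g t) | t \<in> [0,T]}\<close>.
\<close>

definition path_space :: "real \<Rightarrow> (real \<Rightarrow> real^'d) metric" where
  "path_space T = cfunspace (top_of_set {0..T}) euclidean_metric"

definition path_law :: "'w measure \<Rightarrow> real \<Rightarrow> (real \<Rightarrow> 'w \<Rightarrow> real^'d) \<Rightarrow> (real \<Rightarrow> real^'d) measure" where
  "path_law M T X = distr M (metric_borel (path_space T)) (\<lambda>\<omega>. restrict (\<lambda>t. X t \<omega>) {0..T})"

end

theory Submission
  imports Defs
begin

text \<open>
  By the Gaussian moment criterion, \<open>T\<^sub>1\<close> follows from \<open>\<integral> exp (\<delta> d(y, \<gamma>)\<^sup>2) dP\<^sub>x (\<gamma>) \<le> K\<close> for one path \<open>y\<close>: the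
  coupling that keeps the common mass of \<open>\<mu>\<close> and \<open>\<nu> = f \<mu>\<close> on the diagonal gives
  \<open>W\<^sub>1 \<le> \<integral> d(y, \<cdot>) \<bar>f - 1\<bar> d\<mu>\<close>, and a weighted Pinsker inequality bounds this by a multiple of the root of the
  entropy. For \<open>y\<close> take an approximate solution of the noiseless equation \<open>y' = b(y)\<close>, \<open>y(0) = x\<close>.
  By the one-sided condition on \<open>b\<close>, \<open>exp (\<delta> e\<^bsup>-\<lambda>t\<^esup> \<bar>X\<^sub>t - y\<^sub>t\<bar>\<^sup>2 - c t)\<close> is then a supermartingale for large
  \<open>\<lambda>\<close> and \<open>c\<close> and small \<open>\<delta>\<close>, and a maximal inequality bounds the supremum. Instead of Ito's formula, this
  uses a time discretisation, in which the only probabilistic input is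
  \<open>E[exp (\<theta> \<cdot> (J\<^sub>t - J\<^sub>s)) | F\<^sub>s] \<le> exp (\<bar>\<theta>\<bar>\<^sup>2 A\<^sup>2 (t - s))\<close> for the Ito integral \<open>J\<close> of \<open>\<sigma>(X)\<close>. It is inherited from
  elementary integrands by Fatou's lemma.
\<close>

text \<open>The obstacle: the Ito integral is given only as a limit in probability at each fixed
  time, while the moment concerns the supremum of a path. Two devices meet it. The exponential bound
  for a noise increment is tested against nonnegative weights \<open>Y\<close> known at the earlier
  time, so that a conditional inequality becomes one between integrals. And the energy estimate is
  purely pathwise: it holds on all equidistant grids finer than a mesh that depends on the path, and
  Fatou's lemma over the grids needs no uniform rate. The reference path starts at x itself and b
  enters only through differences along it, so x drops out of every constant; the size of b affects
  only y and the mesh. An approximate y is enough, because an error of at most 1 in its derivative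
  merely turns B into B + 1. The additive 1 in the one-sided condition merely adds to c. A
  nonnegative supermartingale need not have an integrable supremum, but its square root has; this
  costs half of the rate, and the factor exp (- \<lambda> T) is the weight at the final
  time.\<close>

section \<open>Transport cost and entropy\<close>

text \<open>Off the diagonal the defect \<open>p\<close> of f is sent to its excess \<open>q\<close>
  by their product divided by the common mass \<open>m\<close>. The additive bound on the cost lets
  one of the two variables integrate out, and \<open>p + q\<close> is |f - 1|.\<close>

lemma coupling_of_density:
  fixes f :: "'a \<Rightarrow> real" and d \<phi> :: "'a \<Rightarrow> _"
  assumes \<mu>: "prob_space \<mu>" and f[measurable]: "f \<in> borel_measurable \<mu>" and f0: "\<And>x. 0 \<le> f x"
    and f1: "(\<integral>\<^sup>+x. ennreal (f x) \<partial>\<mu>) = 1"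
    and d[measurable]: "(\<lambda>z. d (fst z) (snd z)) \<in> borel_measurable (\<mu> \<Otimes>\<^sub>M \<mu>)"
    and \<phi>[measurable]: "\<phi> \<in> borel_measurable \<mu>"
    and d0: "\<And>x. x \<in> space \<mu> \<Longrightarrow> d x x = 0"
    and tri: "\<And>x y. x \<in> space \<mu> \<Longrightarrow> y \<in> space \<mu> \<Longrightarrow> d x y \<le> \<phi> x + (\<phi> y :: ennreal)"
  shows "\<exists>\<pi>\<in>couplings \<mu> (density \<mu> f).
           (\<integral>\<^sup>+z. d (fst z) (snd z) \<partial>\<pi>) \<le> (\<integral>\<^sup>+x. \<phi> x * ennreal \<bar>f x - 1\<bar> \<partial>\<mu>)"
proof -
  interpret \<mu>: prob_space \<mu> by fact
  interpret PP: pair_sigma_finite \<mu> \<mu> ..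
  define p where "p = (\<lambda>x. ennreal (max 0 (1 - f x)))"
  define q where "q = (\<lambda>x. ennreal (max 0 (f x - 1)))"
  define r where "r = (\<lambda>x. ennreal (min 1 (f x)))"
  have [measurable]: "p \<in> borel_measurable \<mu>" "q \<in> borel_measurable \<mu>" "r \<in> borel_measurable \<mu>"
    unfolding p_def q_def r_def by measurable
  have rp: "r x + p x = 1" for x
    using f0[of x] by (simp add: r_def p_def max_def min_def flip: ennreal_plus)
  have rq: "r x + q x = ennreal (f x)" for x
    using f0[of x] by (simp add: r_def q_def max_def min_def flip: ennreal_plus)
  have pq: "p x + q x = ennreal \<bar>f x - 1\<bar>" for x
    by (simp add: q_def p_def max_def flip: ennreal_plus)
  define m where "m = (\<integral>\<^sup>+x. p x \<partial>\<mu>)"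
  have irp: "(\<integral>\<^sup>+x. r x \<partial>\<mu>) + m = 1"
    unfolding m_def by (subst nn_integral_add[symmetric]) (auto simp: rp \<mu>.emeasure_space_1)
  have irq: "(\<integral>\<^sup>+x. r x \<partial>\<mu>) + (\<integral>\<^sup>+x. q x \<partial>\<mu>) = 1"
    by (subst nn_integral_add[symmetric]) (auto simp: rq f1)
  have mfin: "m \<noteq> \<infinity>" "(\<integral>\<^sup>+x. r x \<partial>\<mu>) \<noteq> \<infinity>" using irp by auto
  have mq: "(\<integral>\<^sup>+x. q x \<partial>\<mu>) = m"
    using irp irq mfin by (metis ennreal_add_left_cancel infinity_ennreal_def)
  \<comment> \<open>If \<open>m = 0\<close>, then \<open>inverse m\<close> is infinite, but
    \<open>p\<close> and \<open>q\<close> vanish almost everywhere and 0 times infinity is 0, so one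
    formula for the coupling covers this case too.\<close>
  have p0: "AE x in \<mu>. p x = 0" if "m = 0"
    using that unfolding m_def by (subst (asm) nn_integral_0_iff_AE) auto
  have q0: "AE x in \<mu>. q x = 0" if "m = 0"
    using that unfolding mq[symmetric] by (subst (asm) nn_integral_0_iff_AE) auto
  have mm: "m * inverse m = 1" if "m \<noteq> 0"
    using that mfin by (metis divide_ennreal_def ennreal_divide_self infinity_ennreal_def less_top)
  \<comment> \<open>A boolean tag selects the part: the image of a single density under
    \<open>h\<close> is then the sum of the diagonal measure and the product measure.\<close>
  define B where "B = count_space (UNIV::bool set) \<Otimes>\<^sub>M (\<mu> \<Otimes>\<^sub>M \<mu>)"
  define g where "g = (\<lambda>(i, x, y). if i then r x else p x * q y * inverse m)"
  define h where "h = (\<lambda>(i::bool, x::'a, y). if i then (x, x) else (x, y))"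
  have [measurable]: "g \<in> borel_measurable B" unfolding g_def B_def by measurable
  have [measurable]: "h \<in> B \<rightarrow>\<^sub>M \<mu> \<Otimes>\<^sub>M \<mu>" unfolding h_def B_def by measurable
  define \<pi> where "\<pi> = distr (density B g) (\<mu> \<Otimes>\<^sub>M \<mu>) h"
  interpret sb: sigma_finite_measure "count_space (UNIV::bool set)"
    by (rule sigma_finite_measure_count_space_finite) simp
  have I: "(\<integral>\<^sup>+z. F z \<partial>\<pi>) = (\<integral>\<^sup>+x. r x * F (x,x) \<partial>\<mu>)
      + (\<integral>\<^sup>+x. (\<integral>\<^sup>+y. p x * q y * inverse m * F (x,y) \<partial>\<mu>) \<partial>\<mu>)"
    if F[measurable]: "F \<in> borel_measurable (\<mu> \<Otimes>\<^sub>M \<mu>)" for F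
  proof -
    have "(\<integral>\<^sup>+z. F z \<partial>\<pi>) = (\<integral>\<^sup>+z. g z * F (h z) \<partial>B)"
      unfolding \<pi>_def by (subst nn_integral_distr) (simp_all add: nn_integral_density)
    also have "\<dots> = (\<integral>\<^sup>+i. \<integral>\<^sup>+z. g (i, z) * F (h (i, z)) \<partial>(\<mu> \<Otimes>\<^sub>M \<mu>) \<partial>count_space UNIV)"
      unfolding B_def
      by (subst PP.P.nn_integral_fst[symmetric]) (simp_all flip: B_def)
    also have "\<dots> = (\<integral>\<^sup>+z. g (True, z) * F (h (True, z)) \<partial>(\<mu> \<Otimes>\<^sub>M \<mu>))
         + (\<integral>\<^sup>+z. g (False, z) * F (h (False, z)) \<partial>(\<mu> \<Otimes>\<^sub>M \<mu>))"
      by (subst nn_integral_count_space_finite) (auto simp: UNIV_bool add.commute)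
    also have "(\<integral>\<^sup>+z. g (True, z) * F (h (True, z)) \<partial>(\<mu> \<Otimes>\<^sub>M \<mu>)) = (\<integral>\<^sup>+x. r x * F (x,x) \<partial>\<mu>)"
      unfolding g_def h_def
      by (subst \<mu>.nn_integral_fst[symmetric]) (auto simp: \<mu>.emeasure_space_1 split_beta)
    also have "(\<integral>\<^sup>+z. g (False, z) * F (h (False, z)) \<partial>(\<mu> \<Otimes>\<^sub>M \<mu>))
       = (\<integral>\<^sup>+x. (\<integral>\<^sup>+y. p x * q y * inverse m * F (x,y) \<partial>\<mu>) \<partial>\<mu>)"
      unfolding g_def h_def
      by (subst \<mu>.nn_integral_fst[symmetric]) (auto simp: split_beta)
    finally show ?thesis .
  qed
  have P1: "(\<integral>\<^sup>+x. (\<integral>\<^sup>+y. p x * q y * inverse m * G x \<partial>\<mu>) \<partial>\<mu>) = (\<integral>\<^sup>+x. p x * G x \<partial>\<mu>)"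
    if [measurable]: "G \<in> borel_measurable \<mu>" for G
  proof -
    have e: "(\<integral>\<^sup>+y. p x * q y * inverse m * G x \<partial>\<mu>) = p x * G x * (m * inverse m)" for x
    proof -
      have "(\<integral>\<^sup>+y. p x * q y * inverse m * G x \<partial>\<mu>) = (\<integral>\<^sup>+y. (p x * inverse m * G x) * q y \<partial>\<mu>)"
        by (intro nn_integral_cong) (simp add: ac_simps)
      also have "\<dots> = (p x * inverse m * G x) * m" by (subst nn_integral_cmult) (auto simp: mq)
      finally show ?thesis by (simp add: ac_simps)
    qed
    have "AE x in \<mu>. p x * G x * (m * inverse m) = p x * G x"
      using p0 mm by (cases "m = 0") auto
    then show ?thesis unfolding e by (rule nn_integral_cong_AE)
  qed
  have P2: "(\<integral>\<^sup>+x. (\<integral>\<^sup>+y. p x * q y * inverse m * G y \<partial>\<mu>) \<partial>\<mu>) = (\<integral>\<^sup>+x. q x * G x \<partial>\<mu>)"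
    if [measurable]: "G \<in> borel_measurable \<mu>" for G
  proof -
    have e: "(\<integral>\<^sup>+x. p x * q y * inverse m * G y \<partial>\<mu>) = q y * G y * (m * inverse m)" for y
    proof -
      have "(\<integral>\<^sup>+x. p x * q y * inverse m * G y \<partial>\<mu>) = (\<integral>\<^sup>+x. (q y * inverse m * G y) * p x \<partial>\<mu>)"
        by (intro nn_integral_cong) (simp add: ac_simps)
      also have "\<dots> = (q y * inverse m * G y) * m" by (subst nn_integral_cmult) (auto simp: m_def)
      finally show ?thesis by (simp add: ac_simps)
    qed
    have "(\<integral>\<^sup>+x. (\<integral>\<^sup>+y. p x * q y * inverse m * G y \<partial>\<mu>) \<partial>\<mu>)
        = (\<integral>\<^sup>+y. (\<integral>\<^sup>+x. p x * q y * inverse m * G y \<partial>\<mu>) \<partial>\<mu>)"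
      by (rule PP.Fubini'[symmetric]) measurable
    moreover have "AE y in \<mu>. q y * G y * (m * inverse m) = q y * G y"
      using q0 mm by (cases "m = 0") auto
    ultimately show ?thesis unfolding e using nn_integral_cong_AE by metis
  qed
  have sp: "sets \<pi> = sets (\<mu> \<Otimes>\<^sub>M \<mu>)" unfolding \<pi>_def by simp
  have spp: "space \<pi> = space \<mu> \<times> space \<mu>" unfolding \<pi>_def by (simp add: space_pair_measure)
  have [measurable]: "fst \<in> \<pi> \<rightarrow>\<^sub>M \<mu>" "snd \<in> \<pi> \<rightarrow>\<^sub>M \<mu>"
    using measurable_cong_sets[OF sp refl] by auto
  have m1: "distr \<pi> \<mu> fst = \<mu>"
  proof (rule measure_eqI)
    fix A assume "A \<in> sets (distr \<pi> \<mu> fst)"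
    then have [measurable]: "A \<in> sets \<mu>" by simp
    have "emeasure (distr \<pi> \<mu> fst) A = (\<integral>\<^sup>+z. indicator A (fst z) \<partial>\<pi>)"
      by (subst nn_integral_indicator[symmetric], simp, subst nn_integral_distr) auto
    also have "\<dots> = (\<integral>\<^sup>+x. r x * indicator A x \<partial>\<mu>) + (\<integral>\<^sup>+x. p x * indicator A x \<partial>\<mu>)"
      using P1[of "indicator A"] by (subst I) auto
    also have "\<dots> = (\<integral>\<^sup>+x. (r x + p x) * indicator A x \<partial>\<mu>)"
      by (subst nn_integral_add[symmetric]) (auto simp: distrib_right)
    finally show "emeasure (distr \<pi> \<mu> fst) A = emeasure \<mu> A" by (simp add: rp)
  qed simp
  have m2: "distr \<pi> \<mu> snd = density \<mu> f"
  proof (rule measure_eqI)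
    fix A assume "A \<in> sets (distr \<pi> \<mu> snd)"
    then have [measurable]: "A \<in> sets \<mu>" by simp
    have "emeasure (distr \<pi> \<mu> snd) A = (\<integral>\<^sup>+z. indicator A (snd z) \<partial>\<pi>)"
      by (subst nn_integral_indicator[symmetric], simp, subst nn_integral_distr) auto
    also have "\<dots> = (\<integral>\<^sup>+x. r x * indicator A x \<partial>\<mu>) + (\<integral>\<^sup>+x. q x * indicator A x \<partial>\<mu>)"
      using P2[of "indicator A"] by (subst I) auto
    also have "\<dots> = (\<integral>\<^sup>+x. (r x + q x) * indicator A x \<partial>\<mu>)"
      by (subst nn_integral_add[symmetric]) (auto simp: distrib_right)
    finally show "emeasure (distr \<pi> \<mu> snd) A = emeasure (density \<mu> f) A"
      by (simp add: rq emeasure_density)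
  qed simp
  have "prob_space \<pi>"
  proof (rule prob_space_distrD[of fst \<pi> \<mu>])
    show "fst \<in> \<pi> \<rightarrow>\<^sub>M \<mu>" by measurable
    show "prob_space (distr \<pi> \<mu> fst)" by (simp add: m1 \<mu>)
  qed
  moreover have "distr \<pi> (density \<mu> f) snd = density \<mu> f"
    using m2 by (metis distr_cong sets_density)
  moreover have "sets (\<mu> \<Otimes>\<^sub>M density \<mu> f) = sets (\<mu> \<Otimes>\<^sub>M \<mu>)"
    by (rule sets_pair_measure_cong) auto
  ultimately have "\<pi> \<in> couplings \<mu> (density \<mu> f)"
    unfolding couplings_def using sp m1 by auto
  moreover have "(\<integral>\<^sup>+z. d (fst z) (snd z) \<partial>\<pi>) \<le> (\<integral>\<^sup>+x. \<phi> x * ennreal \<bar>f x - 1\<bar> \<partial>\<mu>)"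
  proof -
    have "(\<integral>\<^sup>+z. d (fst z) (snd z) \<partial>\<pi>)
       = (\<integral>\<^sup>+x. (\<integral>\<^sup>+y. p x * q y * inverse m * d x y \<partial>\<mu>) \<partial>\<mu>)"
      by (subst I) (auto simp: d0 cong: nn_integral_cong_simp)
    also have "\<dots> \<le> (\<integral>\<^sup>+x. (\<integral>\<^sup>+y. p x * q y * inverse m * \<phi> x + p x * q y * inverse m * \<phi> y \<partial>\<mu>) \<partial>\<mu>)"
      unfolding distrib_left[symmetric] by (intro nn_integral_mono mult_left_mono tri) auto
    also have "\<dots> = (\<integral>\<^sup>+x. (\<integral>\<^sup>+y. p x * q y * inverse m * \<phi> x \<partial>\<mu>) \<partial>\<mu>)
       + (\<integral>\<^sup>+x. (\<integral>\<^sup>+y. p x * q y * inverse m * \<phi> y \<partial>\<mu>) \<partial>\<mu>)"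
      by (subst nn_integral_add[symmetric]) (auto intro!: nn_integral_cong nn_integral_add)
    also have "\<dots> = (\<integral>\<^sup>+x. p x * \<phi> x + q x * \<phi> x \<partial>\<mu>)"
      by (subst P1, simp, subst P2, simp, subst nn_integral_add) auto
    also have "\<dots> = (\<integral>\<^sup>+x. \<phi> x * ennreal \<bar>f x - 1\<bar> \<partial>\<mu>)"
      by (intro nn_integral_cong) (simp add: pq[symmetric] distrib_left mult.commute)
    finally show ?thesis .
  qed
  ultimately show ?thesis by blast
qed

text \<open>The link is the Hellinger quantity (sqrt u - 1)^2. It lies below u ln u - u + 1 by ln v
  \<le> v - 1 at v = 1 / sqrt u, and (u - 1)^2 is its product with (sqrt u + 1)^2 \<le> 2 (u +
  1).\<close>

lemma entropy_ge_square:
  fixes u :: real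
  assumes "0 \<le> u"
  shows "(u - 1)\<^sup>2 \<le> 2 * (u + 1) * (u * ln u - u + 1)" and "0 \<le> u * ln u - u + 1"
proof -
  have "(sqrt u - 1)\<^sup>2 \<le> u * ln u - u + 1"
  proof (cases "u = 0")
    case False
    with assms have u: "u > 0" by simp
    have "ln (1 / sqrt u) \<le> 1 / sqrt u - 1" using u by (intro ln_le_minus_one) simp
    then have "- (ln u / 2) \<le> 1 / sqrt u - 1" using u by (simp add: ln_div ln_sqrt)
    then have "u * (- (ln u / 2)) \<le> u * (1 / sqrt u - 1)" using u by (intro mult_left_mono) auto
    also have "u * (1 / sqrt u - 1) = sqrt u - u" using u by (simp add: field_simps)
    finally show ?thesis using u by (simp add: power2_eq_square algebra_simps)
  qed simp
  then show "0 \<le> u * ln u - u + 1" by (smt (verit) zero_le_power2)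
  have "(u - 1)\<^sup>2 = (sqrt u - 1)\<^sup>2 * (sqrt u + 1)\<^sup>2"
    using assms by (simp flip: power_mult_distrib add: algebra_simps)
  also have "\<dots> \<le> (u * ln u - u + 1) * (2 * (u + 1))"
  proof (rule mult_mono)
    have "0 \<le> (sqrt u - 1)\<^sup>2" by simp
    then show "(sqrt u + 1)\<^sup>2 \<le> 2 * (u + 1)" using assms by (simp add: power2_eq_square algebra_simps)
  qed (use \<open>(sqrt u - 1)\<^sup>2 \<le> _\<close> \<open>0 \<le> u * ln u - u + 1\<close> in auto)
  finally show "(u - 1)\<^sup>2 \<le> 2 * (u + 1) * (u * ln u - u + 1)" by (simp add: mult.commute)
qed

text \<open>Fenchel duality between u ln u - u and exp, from 1 + v \<le> exp v at v = x - ln u. It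
  trades a density for an exponential moment.\<close>

lemma entropy_young:
  fixes u x :: real
  assumes "0 \<le> u"
  shows "u * x \<le> u * ln u - u + exp x"
proof (cases "u = 0")
  case False
  with assms have u: "u > 0" by simp
  have "1 + (x - ln u) \<le> exp (x - ln u)" by (rule exp_ge_add_one_self)
  then have "u * (1 + (x - ln u)) \<le> u * exp (x - ln u)" using u by (intro mult_left_mono) auto
  also have "\<dots> = exp x" using u by (simp add: exp_diff)
  finally show ?thesis by (simp add: algebra_simps)
qed simp

text \<open>The entropy is spread out as \<open>h\<close>, which is pointwise nonnegative and still
  has integral H because f has mean 1. Young's inequality trades (f + 1) \<phi>^2 for
  \<open>h\<close> and the Gaussian weight \<open>e\<close>; |f - 1| is handled by
  \<open>entropy_ge_square\<close> if H is small and by f + 1 if H is large. The free parameter of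
  the arithmetic-geometric mean is set so that every term is of order sqrt H.\<close>

lemma weighted_pinsker:
  fixes f \<phi> :: "'a \<Rightarrow> real"
  assumes \<mu>: "prob_space \<mu>" and f[measurable]: "f \<in> borel_measurable \<mu>" and f0: "\<And>x. 0 \<le> f x"
    and f1: "(\<integral>\<^sup>+x. ennreal (f x) \<partial>\<mu>) = 1"
    and fl: "integrable \<mu> (\<lambda>x. f x * ln (f x))"
    and \<phi>[measurable]: "\<phi> \<in> borel_measurable \<mu>" and \<phi>0: "\<And>x. 0 \<le> \<phi> x"
    and \<delta>: "\<delta> > 0" and K: "K \<ge> 0" and mom: "(\<integral>\<^sup>+x. ennreal (exp (\<delta> * (\<phi> x)\<^sup>2)) \<partial>\<mu>) \<le> ennreal K"
  shows "(\<integral>\<^sup>+x. ennreal (\<phi> x * \<bar>f x - 1\<bar>) \<partial>\<mu>)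
           \<le> ennreal (((1 + 2 * K) / \<delta> + 1) * sqrt (\<integral>x. f x * ln (f x) \<partial>\<mu>))"
proof -
  let ?I = "\<integral>\<^sup>+x. ennreal (\<phi> x * \<bar>f x - 1\<bar>) \<partial>\<mu>"
  interpret prob_space \<mu> by fact
  define H where "H = (\<integral>x. f x * ln (f x) \<partial>\<mu>)"
  define h where "h = (\<lambda>x. f x * ln (f x) - f x + 1)"
  define e where "e = (\<lambda>x. exp (\<delta> * (\<phi> x)\<^sup>2))"
  have if1: "integrable \<mu> f" "(\<integral>x. f x \<partial>\<mu>) = 1"
    using f1 f0 by (auto intro!: integrableI_nn_integral_finite[where x=1] integral_eq_nn_integral[THEN trans])
  have ih: "integrable \<mu> h" "(\<integral>x. h x \<partial>\<mu>) = H"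
    unfolding h_def H_def using if1 fl by (auto simp: prob_space)
  have h0: "0 \<le> h x" for x unfolding h_def by (rule entropy_ge_square(2)[OF f0])
  have ie: "integrable \<mu> e"
    using mom by (intro integrableI_nonneg) (auto simp: e_def less_top[symmetric] top_unique)
  have eK: "(\<integral>x. e x \<partial>\<mu>) \<le> K"
    using mom ie K by (subst (asm) nn_integral_eq_integral) (auto simp: e_def)
  have H0: "H \<ge> 0" unfolding ih(2)[symmetric] using h0 by (intro integral_nonneg_AE) auto
  \<comment> \<open>Both nontrivial regimes use this shape of pointwise bound, since
    \<open>h\<close>, \<open>e\<close> and f + 1 have integrals H, at most K, and 2.\<close>
  have bound: "?I \<le> ennreal (a * H + b * K + 2 * c)"
    if abc: "a \<ge> 0" "b \<ge> 0" "c \<ge> 0"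
    and le: "\<And>x. \<phi> x * \<bar>f x - 1\<bar> \<le> a * h x + b * e x + c * (f x + 1)" for a b c
  proof -
    have "?I \<le> (\<integral>\<^sup>+x. ennreal (a * h x + b * e x + c * (f x + 1)) \<partial>\<mu>)"
      by (intro nn_integral_mono ennreal_leI le)
    also have "\<dots> = ennreal (\<integral>x. a * h x + b * e x + c * (f x + 1) \<partial>\<mu>)"
      using ih ie if1 abc h0 f0 by (intro nn_integral_eq_integral) (auto simp: e_def)
    also have "(\<integral>x. a * h x + b * e x + c * (f x + 1) \<partial>\<mu>) = a * H + b * (\<integral>x. e x \<partial>\<mu>) + c * 2"
      using ih ie if1 by (simp add: prob_space)
    also have "ennreal \<dots> \<le> ennreal (a * H + b * K + 2 * c)"
      using mult_left_mono[OF eK abc(2)] by (intro ennreal_leI) simp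
    finally show ?thesis .
  qed
  \<comment> \<open>Young at \<delta> \<phi>^2 treats the part with f; the part without f costs a
    second \<open>e\<close> through v \<le> exp v.\<close>
  have sq: "(f x + 1) * (\<phi> x)\<^sup>2 \<le> (h x + 2 * e x) / \<delta>" for x
  proof -
    have "f x * (\<delta> * (\<phi> x)\<^sup>2) \<le> h x + e x"
      using entropy_young[OF f0, of x "\<delta> * (\<phi> x)\<^sup>2"] by (simp add: h_def e_def)
    moreover have "\<delta> * (\<phi> x)\<^sup>2 \<le> e x"
      using exp_ge_add_one_self[of "\<delta> * (\<phi> x)\<^sup>2"] unfolding e_def by linarith
    ultimately have "\<delta> * ((f x + 1) * (\<phi> x)\<^sup>2) \<le> h x + 2 * e x" by (simp add: algebra_simps)
    then show ?thesis using \<delta> by (simp add: field_simps)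
  qed
  consider "H = 0" | "0 < H" "H \<le> 1" | "H > 1" using H0 by linarith
  then have "?I \<le> ennreal (((1 + 2 * K) / \<delta> + 1) * sqrt H)"
  proof cases
    \<comment> \<open>The parameter sqrt H of the next case would be 0 here. Instead
      \<open>h\<close> vanishes almost everywhere, which forces f = 1.\<close>
    case 1
    then have "AE x in \<mu>. h x = 0"
      using ih h0 by (subst integral_nonneg_eq_0_iff_AE[symmetric]) auto
    then have "AE x in \<mu>. ennreal (\<phi> x * \<bar>f x - 1\<bar>) = 0"
    proof eventually_elim
      case (elim x)
      with entropy_ge_square(1)[OF f0, of x] have "(f x - 1)\<^sup>2 \<le> 0" unfolding h_def by simp
      then show ?case by simp
    qed
    then have "?I = (\<integral>\<^sup>+x. 0 \<partial>\<mu>)" by (rule nn_integral_cong_AE)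
    then show ?thesis by simp
  next
    case 2
    \<comment> \<open>With this choice H / s and s K are both of order sqrt H.\<close>
    define s where "s = sqrt H"
    have s: "s > 0" "s \<le> 1" "s * s = H" using 2 by (auto simp: s_def)
    have "?I \<le> ennreal ((s / \<delta> + 1 / (2 * s)) * H + (2 * s / \<delta>) * K + 2 * 0)"
    proof (rule bound)
      fix x
      have "(\<phi> x * \<bar>f x - 1\<bar>)\<^sup>2 \<le> (\<phi> x)\<^sup>2 * (2 * (f x + 1) * h x)"
        using mult_left_mono[OF entropy_ge_square(1)[OF f0, of x], of "(\<phi> x)\<^sup>2"]
        by (simp add: h_def power_mult_distrib)
      \<comment> \<open>The squares of s a + v / (2 s) and s a - v / (2 s) differ by 2 a v, here
        with a = (f + 1) \<phi>^2 and v = h.\<close>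
      also have "\<dots> \<le> (s * ((f x + 1) * (\<phi> x)\<^sup>2) + h x / (2 * s))\<^sup>2"
      proof -
        have "0 \<le> (s * ((f x + 1) * (\<phi> x)\<^sup>2) - h x / (2 * s))\<^sup>2" by simp
        then show ?thesis using s by (simp add: power2_eq_square field_simps)
      qed
      finally have "(\<phi> x * \<bar>f x - 1\<bar>)\<^sup>2 \<le> (s * ((f x + 1) * (\<phi> x)\<^sup>2) + h x / (2 * s))\<^sup>2" .
      moreover have "0 \<le> s * ((f x + 1) * (\<phi> x)\<^sup>2) + h x / (2 * s)"
        using s h0[of x] f0[of x] by (intro add_nonneg_nonneg mult_nonneg_nonneg divide_nonneg_nonneg) auto
      ultimately have "\<phi> x * \<bar>f x - 1\<bar> \<le> s * ((f x + 1) * (\<phi> x)\<^sup>2) + h x / (2 * s)"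
        by (rule power2_le_imp_le)
      also have "\<dots> \<le> s * ((h x + 2 * e x) / \<delta>) + h x / (2 * s)"
        using mult_left_mono[OF sq[of x], of s] s by simp
      finally show "\<phi> x * \<bar>f x - 1\<bar> \<le> (s / \<delta> + 1 / (2 * s)) * h x + (2 * s / \<delta>) * e x + 0 * (f x + 1)"
        by (simp add: algebra_simps add_divide_distrib)
    qed (use s \<delta> in auto)
    also have "\<dots> \<le> ennreal (((1 + 2 * K) / \<delta> + 1) * s)"
    proof (rule ennreal_leI)
      have "s * H \<le> s * 1" using s 2 by (intro mult_left_mono) auto
      then have "s * H / \<delta> \<le> s / \<delta>" using \<delta> by (simp add: divide_right_mono)
      moreover have "H / (2 * s) \<le> s" unfolding s(3)[symmetric] using s(1) by simp
      ultimately show "(s / \<delta> + 1 / (2 * s)) * H + (2 * s / \<delta>) * K + 2 * 0 \<le> ((1 + 2 * K) / \<delta> + 1) * s"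
        by (simp add: algebra_simps add_divide_distrib)
    qed
    finally show ?thesis by (simp add: s_def)
  next
    case 3
    \<comment> \<open>Now s H and 1 / s both equal sqrt H, and s K is harmless because s \<le> 1 <
      sqrt H.\<close>
    define s where "s = 1 / sqrt H"
    have s: "s > 0" "s \<le> 1" "s * sqrt H = 1" using 3 by (auto simp: s_def)
    have sH: "s * H = sqrt H" using 3 by (simp add: s_def field_simps)
    have "?I \<le> ennreal ((s / (2 * \<delta>)) * H + (s / \<delta>) * K + 2 * (1 / (2 * s)))"
    proof (rule bound)
      fix x
      have "\<phi> x * \<bar>f x - 1\<bar> \<le> \<phi> x * (f x + 1)" using \<phi>0[of x] f0[of x] by (intro mult_left_mono) auto
      also have "\<phi> x \<le> s * (\<phi> x)\<^sup>2 / 2 + 1 / (2 * s)"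
      proof -
        have "0 \<le> (s * \<phi> x - 1)\<^sup>2" by simp
        then show ?thesis using s by (simp add: power2_eq_square field_simps)
      qed
      then have "\<phi> x * (f x + 1) \<le> (s * (\<phi> x)\<^sup>2 / 2 + 1 / (2 * s)) * (f x + 1)"
        using f0[of x] by (intro mult_right_mono) auto
      also have "\<dots> = s / 2 * ((f x + 1) * (\<phi> x)\<^sup>2) + 1 / (2 * s) * (f x + 1)" by (simp add: algebra_simps)
      also have "\<dots> \<le> s / 2 * ((h x + 2 * e x) / \<delta>) + 1 / (2 * s) * (f x + 1)"
        using mult_left_mono[OF sq[of x], of "s / 2"] s by simp
      finally show "\<phi> x * \<bar>f x - 1\<bar> \<le> (s / (2 * \<delta>)) * h x + (s / \<delta>) * e x + 1 / (2 * s) * (f x + 1)"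
        by (simp add: algebra_simps add_divide_distrib)
    qed (use s \<delta> in auto)
    also have "\<dots> \<le> ennreal (((1 + 2 * K) / \<delta> + 1) * sqrt H)"
    proof (rule ennreal_leI)
      have "s \<le> sqrt H" using s 3 real_sqrt_ge_1_iff[of H] by linarith
      then have "s * K \<le> sqrt H * K" using K by (rule mult_right_mono)
      moreover have "0 \<le> sqrt H * K" using K 3 by simp
      moreover have "2 * K * sqrt H = sqrt H * K + sqrt H * K" by simp
      ultimately have "s * K \<le> 2 * K * sqrt H" by linarith
      then have "s * K / \<delta> \<le> 2 * K * sqrt H / \<delta>" using \<delta> by (simp add: divide_right_mono)
      moreover have "s * H / (2 * \<delta>) \<le> sqrt H / \<delta>" unfolding sH using \<delta> 3 by (simp add: field_simps)
      moreover have "2 * (1 / (2 * s)) = sqrt H" using s by (simp add: field_simps)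
      moreover have "((1 + 2 * K) / \<delta> + 1) * sqrt H = sqrt H / \<delta> + 2 * K * sqrt H / \<delta> + sqrt H"
        by (simp add: distrib_right add_divide_distrib)
      moreover have "(s / (2 * \<delta>)) * H = s * H / (2 * \<delta>)" "(s / \<delta>) * K = s * K / \<delta>" by simp_all
      ultimately show "(s / (2 * \<delta>)) * H + (s / \<delta>) * K + 2 * (1 / (2 * s)) \<le> ((1 + 2 * K) / \<delta> + 1) * sqrt H"
        by linarith
    qed
    finally show ?thesis .
  qed
  then show ?thesis by (simp add: H_def)
qed

lemma space_metric_borel: "space (metric_borel m) = mspace m"
proof -
  have "{U. openin (mtopology_of m) U} \<subseteq> Pow (mspace m)"
    using openin_subset[of "mtopology_of m"] by auto
  then show ?thesis unfolding metric_borel_def by (simp add: space_measure_of)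
qed

text \<open>The weighted Pinsker inequality bounds the cost by c sqrt H with c = (1 + 2 K) /
  \<delta> + 1, and solving c sqrt H = sqrt (2 C H) gives C = c^2 / 2. The triangle inequality
  through \<open>x0\<close> supplies the additive cost bound that the coupling asks for.\<close>

theorem T1_inequality_of_gaussian_moment:
  fixes m :: "'a metric"
  assumes \<mu>: "prob_space \<mu>" and s\<mu>: "sets \<mu> = sets (metric_borel m)"
    and d[measurable]: "(\<lambda>z. mdist m (fst z) (snd z)) \<in> borel_measurable (metric_borel m \<Otimes>\<^sub>M metric_borel m)"
    and x0: "x0 \<in> mspace m"
    and \<delta>: "\<delta> > 0" and K: "K \<ge> 0"
    and mom: "(\<integral>\<^sup>+x. ennreal (exp (\<delta> * (mdist m x0 x)\<^sup>2)) \<partial>\<mu>) \<le> ennreal K"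
  shows "T1_inequality (((1 + 2 * K) / \<delta> + 1)\<^sup>2 / 2) m \<mu>"
proof -
  interpret \<mu>: prob_space \<mu> by fact
  interpret m: Metric_space "mspace m" "mdist m" by simp
  define c where "c = (1 + 2 * K) / \<delta> + 1"
  have c: "c > 0" using \<delta> K by (simp add: c_def add_nonneg_pos)
  note s\<mu>[measurable_cong]
  have sp: "space \<mu> = mspace m" using sets_eq_imp_space_eq[OF s\<mu>] by (simp add: space_metric_borel)
  have dm[measurable]: "(\<lambda>z. mdist m (fst z) (snd z)) \<in> borel_measurable (\<mu> \<Otimes>\<^sub>M \<mu>)"
    using d measurable_cong_sets[OF sets_pair_measure_cong[OF s\<mu> s\<mu>] refl, of borel] by blast
  have [measurable]: "(\<lambda>x. mdist m x0 x) \<in> borel_measurable \<mu>"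
    using measurable_compose[OF measurable_Pair1'[of x0 \<mu> \<mu>] dm] x0 sp by simp
  have "wasserstein1 m \<mu> \<nu> \<le> ennreal_sqrt (2 * ennreal (c\<^sup>2 / 2) * relative_entropy \<mu> \<nu>)"
    if \<nu>: "prob_space \<nu>" and s\<nu>: "sets \<nu> = sets (metric_borel m)" for \<nu>
  proof (cases "absolutely_continuous \<mu> \<nu> \<and> integrable \<nu> (entropy_density (exp 1) \<mu> \<nu>)")
    case False
    then have "relative_entropy \<mu> \<nu> = \<infinity>" by (simp add: relative_entropy_def)
    \<comment> \<open>The factor in front of the infinite entropy must not be 0, since 0 times
      infinity is 0 in \<open>ennreal\<close>.\<close>
    moreover have "2 * ennreal (c\<^sup>2 / 2) \<noteq> 0" using c by simp
    ultimately have "2 * ennreal (c\<^sup>2 / 2) * relative_entropy \<mu> \<nu> = \<infinity>" by (simp add: ennreal_mult_eq_top_iff)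
    then show ?thesis unfolding ennreal_sqrt_def by simp
  next
    case True
    then have ac: "absolutely_continuous \<mu> \<nu>" and int: "integrable \<nu> (entropy_density (exp 1) \<mu> \<nu>)" by auto
    interpret \<nu>: prob_space \<nu> by fact
    have seq: "sets \<nu> = sets \<mu>" using s\<mu> s\<nu> by simp
    obtain f where f[measurable]: "f \<in> borel_measurable \<mu>"
      and fR: "AE x in \<mu>. RN_deriv \<mu> \<nu> x = ennreal (f x)" and f0: "\<And>x. 0 \<le> f x"
      using \<mu>.real_RN_deriv[OF _ ac seq] \<nu>.finite_measure_axioms by metis
    have "\<nu> = density \<mu> (RN_deriv \<mu> \<nu>)" using ac seq by (rule \<mu>.density_RN_deriv[symmetric])
    also have "\<dots> = density \<mu> f" using fR by (auto intro!: density_cong)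
    finally have \<nu>f: "\<nu> = density \<mu> f" .
    have "emeasure \<nu> (space \<nu>) = 1" by (rule \<nu>.emeasure_space_1)
    then have f1: "(\<integral>\<^sup>+x. ennreal (f x) \<partial>\<mu>) = 1" unfolding \<nu>f by (simp add: emeasure_density cong: nn_integral_cong)
    have ed: "AE x in \<nu>. entropy_density (exp 1) \<mu> \<nu> x = ln (f x)"
      using absolutely_continuous_AE[OF seq ac fR] f0 by (auto simp: entropy_density_def log_def)
    have [measurable]: "entropy_density (exp 1) \<mu> \<nu> \<in> borel_measurable \<nu>"
      using int by (rule borel_measurable_integrable)
    have [measurable]: "(\<lambda>x. ln (f x)) \<in> borel_measurable \<nu>" using seq by (simp cong: measurable_cong_sets)
    have "integrable \<nu> (\<lambda>x. ln (f x))"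
      using int ed by (subst (asm) integrable_cong_AE[OF _ _ ed]) auto
    then have fl: "integrable \<mu> (\<lambda>x. f x * ln (f x))"
      unfolding \<nu>f using f0 by (subst (asm) integrable_real_density) auto
    have "KL_divergence (exp 1) \<mu> \<nu> = (\<integral>x. ln (f x) \<partial>\<nu>)"
      unfolding KL_divergence_def using ed by (intro integral_cong_AE) auto
    also have "\<dots> = (\<integral>x. f x * ln (f x) \<partial>\<mu>)" unfolding \<nu>f using f0 by (subst integral_real_density) auto
    finally have KL: "relative_entropy \<mu> \<nu> = ennreal (\<integral>x. f x * ln (f x) \<partial>\<mu>)"
      using True by (simp add: relative_entropy_def)
    define H where "H = (\<integral>x. f x * ln (f x) \<partial>\<mu>)"
    have "\<exists>\<pi>\<in>couplings \<mu> (density \<mu> f). (\<integral>\<^sup>+z. ennreal (mdist m (fst z) (snd z)) \<partial>\<pi>)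
        \<le> (\<integral>\<^sup>+x. ennreal (mdist m x0 x) * ennreal \<bar>f x - 1\<bar> \<partial>\<mu>)"
    proof (rule coupling_of_density[OF \<mu> f f0 f1])
      fix x y assume "x \<in> space \<mu>" "y \<in> space \<mu>"
      then have "mdist m x y \<le> mdist m x0 x + mdist m x0 y"
        using m.triangle''[of x x0 y] x0 sp m.commute by auto
      then show "ennreal (mdist m x y) \<le> ennreal (mdist m x0 x) + ennreal (mdist m x0 y)"
        by (simp flip: ennreal_plus)
    qed (use sp in auto)
    then have "wasserstein1 m \<mu> \<nu> \<le> (\<integral>\<^sup>+x. ennreal (mdist m x0 x) * ennreal \<bar>f x - 1\<bar> \<partial>\<mu>)"
      unfolding wasserstein1_def \<nu>f by (auto intro: INF_lower2)
    also have "\<dots> = (\<integral>\<^sup>+x. ennreal (mdist m x0 x * \<bar>f x - 1\<bar>) \<partial>\<mu>)"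
      by (simp add: ennreal_mult)
    also have "\<dots> \<le> ennreal (c * sqrt H)"
      unfolding c_def H_def using \<delta> K mom by (intro weighted_pinsker[OF \<mu> f f0 f1 fl]) auto
    also have "\<dots> = ennreal_sqrt (2 * ennreal (c\<^sup>2 / 2) * relative_entropy \<mu> \<nu>)"
    proof -
      have "2 * ennreal (c\<^sup>2 / 2) * ennreal H = ennreal (c\<^sup>2 * H)"
        using ennreal_mult'[of "c\<^sup>2" H] ennreal_mult'[of 2 "c\<^sup>2 / 2"] by simp
      then have *: "2 * ennreal (c\<^sup>2 / 2) * relative_entropy \<mu> \<nu> = ennreal (c\<^sup>2 * H)"
        unfolding KL H_def .
      show ?thesis
      proof (cases "H \<ge> 0")
        case True
        then show ?thesis unfolding * ennreal_sqrt_def using c by (simp add: real_sqrt_mult)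
      next
        \<comment> \<open>For negative H the real square root is negative as well, and
          \<open>ennreal\<close> sends both sides to 0.\<close>
        case False
        then have "c * sqrt H \<le> 0" "c\<^sup>2 * H \<le> 0" using c by (simp_all add: mult_le_0_iff)
        then show ?thesis unfolding * ennreal_sqrt_def by (simp add: ennreal_neg)
      qed
    qed
    finally show ?thesis .
  qed
  then show ?thesis unfolding T1_inequality_def c_def[symmetric] using \<mu> s\<mu> by auto
qed

section \<open>Measurability on the path space\<close>

lemma sets_metric_borel: "sets (metric_borel m) = sigma_sets (mspace m) {U. openin (mtopology_of m) U}"
proof -
  have "{U. openin (mtopology_of m) U} \<subseteq> Pow (mspace m)"
    using openin_subset[of "mtopology_of m"] by auto
  then show ?thesis unfolding metric_borel_def by (simp add: sets_measure_of)
qed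

lemma openin_sets_metric_borel: "openin (mtopology_of m) U \<Longrightarrow> U \<in> sets (metric_borel m)"
  by (auto simp: sets_metric_borel)

lemma mdist_measurable_metric_borel:
  assumes "c \<in> mspace m"
  shows "(\<lambda>x. mdist m c x) \<in> borel_measurable (metric_borel m)"
proof (rule borel_measurableI_less)
  fix r
  interpret m: Metric_space "mspace m" "mdist m" by simp
  have "{x \<in> space (metric_borel m). mdist m c x < r} = m.mball c r"
    using assms by (auto simp: space_metric_borel m.in_mball)
  also have "\<dots> \<in> sets (metric_borel m)"
    by (rule openin_sets_metric_borel) (simp add: mtopology_of_def)
  finally show "{x \<in> space (metric_borel m). mdist m c x < r} \<in> sets (metric_borel m)" .
qed

text \<open>By separability an open set is a countable union of balls with centres in
  \<open>D\<close> and rational radii, and the preimage of a ball is a sublevel set of one distance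
  function. Measurability of a path-valued map thus reduces to real-valued functions.\<close>

lemma measurable_metric_borel_separable:
  assumes D: "countable D" "D \<subseteq> mspace m"
    and dense: "\<And>x e. x \<in> mspace m \<Longrightarrow> 0 < e \<Longrightarrow> \<exists>c\<in>D. mdist m c x < e"
    and f: "\<And>w. w \<in> space M \<Longrightarrow> f w \<in> mspace m"
    and dist: "\<And>c. c \<in> D \<Longrightarrow> (\<lambda>w. mdist m c (f w)) \<in> borel_measurable M"
  shows "f \<in> M \<rightarrow>\<^sub>M metric_borel m"
  unfolding metric_borel_def
proof (rule measurable_sigma_sets[where A="{U. openin (mtopology_of m) U}" and \<Omega>="mspace m"])
  interpret m: Metric_space "mspace m" "mdist m" by simp
  show "sets (sigma (mspace m) {U. openin (mtopology_of m) U}) = sigma_sets (mspace m) {U. openin (mtopology_of m) U}"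
    using sets_metric_borel unfolding metric_borel_def .
  show "{U. openin (mtopology_of m) U} \<subseteq> Pow (mspace m)"
    using openin_subset[of "mtopology_of m"] by auto
  show "f \<in> space M \<rightarrow> mspace m" using f by auto
  fix U assume "U \<in> {U. openin (mtopology_of m) U}"
  then have U: "openin m.mtopology U" by (simp add: mtopology_of_def)
  define R where "R = {(c, q). c \<in> D \<and> q \<in> \<rat> \<and> m.mball c q \<subseteq> U}"
  have "R \<subseteq> D \<times> \<rat>" by (auto simp: R_def)
  then have cR: "countable R" using D countable_rat by (meson countable_SIGMA countable_subset)
  have "f -` U \<inter> space M = (\<Union>(c, q)\<in>R. {w \<in> space M. mdist m c (f w) < q})"
  proof (intro set_eqI iffI)
    fix w assume "w \<in> f -` U \<inter> space M"
    then have w: "w \<in> space M" "f w \<in> U" by auto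
    obtain r where r: "r > 0" "m.mball (f w) r \<subseteq> U"
      using U w(2) unfolding m.openin_mtopology by blast
    obtain q where q: "0 < q" "q < r / 2" "q \<in> \<rat>" using Rats_dense_in_real[of 0 "r / 2"] r by auto
    obtain c where c: "c \<in> D" "mdist m c (f w) < q" using dense[OF f[OF w(1)] q(1)] by auto
    have "m.mball c q \<subseteq> U"
    proof
      fix y assume "y \<in> m.mball c q"
      then have y: "y \<in> mspace m" "c \<in> mspace m" "mdist m c y < q" by auto
      then have "mdist m (f w) y \<le> mdist m c (f w) + mdist m c y"
        using m.triangle''[of "f w" c y] f[OF w(1)] m.commute by auto
      also have "\<dots> < r" using y c q by linarith
      finally show "y \<in> U" using r y f[OF w(1)] by auto
    qed
    then show "w \<in> (\<Union>(c, q)\<in>R. {w \<in> space M. mdist m c (f w) < q})"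
      using c q w by (auto simp: R_def)
  next
    fix w assume "w \<in> (\<Union>(c, q)\<in>R. {w \<in> space M. mdist m c (f w) < q})"
    then show "w \<in> f -` U \<inter> space M" using f D by (force simp: R_def)
  qed
  also have "\<dots> \<in> sets M"
  proof (rule sets.countable_UN''[OF cR])
    fix z assume "z \<in> R"
    then have "fst z \<in> D" by (auto simp: R_def)
    from dist[OF this] have [measurable]: "(\<lambda>w. mdist m (fst z) (f w)) \<in> borel_measurable M" .
    show "(case z of (c, q) \<Rightarrow> {w \<in> space M. mdist m c (f w) < q}) \<in> sets M"
      unfolding case_prod_beta by measurable
  qed
  finally show "f -` U \<inter> space M \<in> sets M" .
qed

text \<open>The product of the Borel \<sigma>-algebras may be smaller than the Borel
  \<sigma>-algebra of the product, so continuity of the metric does not suffice. With a dense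
  \<open>D\<close>, the distance of x and y is below r iff d(c, x) + d(c, y) < r for some c in
  \<open>D\<close>.\<close>

lemma mdist_jointly_measurable:
  assumes D: "countable D" "D \<subseteq> mspace m"
    and dense: "\<And>x e. x \<in> mspace m \<Longrightarrow> 0 < e \<Longrightarrow> \<exists>c\<in>D. mdist m c x < e"
  shows "(\<lambda>z. mdist m (fst z) (snd z)) \<in> borel_measurable (metric_borel m \<Otimes>\<^sub>M metric_borel m)"
proof (rule borel_measurableI_less)
  fix r
  interpret m: Metric_space "mspace m" "mdist m" by simp
  let ?P = "metric_borel m \<Otimes>\<^sub>M metric_borel m"
  have "{z \<in> space ?P. mdist m (fst z) (snd z) < r}
     = (\<Union>c\<in>D. {z \<in> space ?P. mdist m c (fst z) + mdist m c (snd z) < r})"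
  proof (intro set_eqI iffI)
    fix z assume z: "z \<in> {z \<in> space ?P. mdist m (fst z) (snd z) < r}"
    then have s: "fst z \<in> mspace m" "snd z \<in> mspace m" by (auto simp: space_pair_measure space_metric_borel)
    define e where "e = (r - mdist m (fst z) (snd z)) / 2"
    have "e > 0" using z by (simp add: e_def)
    then obtain c where c: "c \<in> D" "mdist m c (fst z) < e" using dense[OF s(1)] by auto
    have "mdist m c (snd z) \<le> mdist m c (fst z) + mdist m (fst z) (snd z)"
      using m.triangle[of c "fst z" "snd z"] c D s by auto
    then have "mdist m c (fst z) + mdist m c (snd z) < r" using c(2) unfolding e_def by (simp add: field_simps)
    then show "z \<in> (\<Union>c\<in>D. {z \<in> space ?P. mdist m c (fst z) + mdist m c (snd z) < r})" using z c by auto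
  next
    fix z assume "z \<in> (\<Union>c\<in>D. {z \<in> space ?P. mdist m c (fst z) + mdist m c (snd z) < r})"
    then obtain c where c: "c \<in> D" "mdist m c (fst z) + mdist m c (snd z) < r" and z: "z \<in> space ?P" by auto
    then have s: "fst z \<in> mspace m" "snd z \<in> mspace m" by (auto simp: space_pair_measure space_metric_borel)
    have "mdist m (fst z) (snd z) \<le> mdist m c (fst z) + mdist m c (snd z)"
      using m.triangle''[of "fst z" c "snd z"] c D s m.commute by auto
    then show "z \<in> {z \<in> space ?P. mdist m (fst z) (snd z) < r}" using c z by auto
  qed
  also have "\<dots> \<in> sets ?P"
  proof (rule sets.countable_UN''[OF D(1)])
    fix c assume "c \<in> D"
    then have [measurable]: "(\<lambda>x. mdist m c x) \<in> borel_measurable (metric_borel m)"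
      using D by (intro mdist_measurable_metric_borel) auto
    show "{z \<in> space ?P. mdist m c (fst z) + mdist m c (snd z) < r} \<in> sets ?P" by measurable
  qed
  finally show "{z \<in> space ?P. mdist m (fst z) (snd z) < r} \<in> sets ?P" .
qed

text \<open>Boundedness, which \<open>cfunspace\<close> also asks for, is automatic on a compact
  interval.\<close>

lemma mspace_path_space:
  "f \<in> mspace (path_space T) \<longleftrightarrow> f \<in> extensional {0..T} \<and> continuous_on {0..T} f"
proof -
  have "compactin (top_of_set {0..T}) {0..T}" by (simp add: compactin_subtopology)
  then show ?thesis unfolding path_space_def
    by (subst compactin_mspace_cfunspace) (auto simp: mtopology_of_euclidean extensional_def)
qed

lemma mdist_path_space_le:
  assumes "f \<in> mspace (path_space T)" "g \<in> mspace (path_space T)" "T > 0"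
  shows "mdist (path_space T) f g \<le> a \<longleftrightarrow> (\<forall>t\<in>{0..T}. dist (f t) (g t) \<le> a)"
  using assms unfolding path_space_def by (subst cfunspace_mdist_le) auto

text \<open>A path is coded by a modulus of continuity and by approximations of its values on the
  corresponding grid; one path is picked for each code in use.\<close>
lemma path_space_separable:
  fixes T :: real
  assumes T: "T > 0"
  shows "\<exists>D :: (real \<Rightarrow> real^'d) set. countable D \<and> D \<subseteq> mspace (path_space T) \<and>
     (\<forall>x\<in>mspace (path_space T). \<forall>e>0. \<exists>c\<in>D. mdist (path_space T) c x < e)"
proof -
  obtain S :: "(real^'d) set" where S: "countable S" "\<And>U. open U \<Longrightarrow> U \<noteq> {} \<Longrightarrow> \<exists>s\<in>S. s \<in> U"
    by (rule countable_dense_setE) blast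
  \<comment> \<open>There are \<open>N + 1\<close> values because the index reaches N at t = T. Two
    paths with the same code are within 2 / (k + 1) of each other.\<close>
  define good where "good = (\<lambda>(k::nat, N::nat, xs::(real^'d) list) f. f \<in> mspace (path_space T) \<and>
     N > 0 \<and> length xs = N + 1 \<and>
     (\<forall>t\<in>{0..T}. dist (f t) (xs ! nat \<lfloor>t * N / T\<rfloor>) < 1 / Suc k))"
  define D where "D = (\<lambda>z. SOME f. good z f) ` {z \<in> UNIV \<times> UNIV \<times> lists S. \<exists>f. good z f}"
  have sel: "good z (SOME f. good z f)" if "\<exists>f. good z f" for z using that by (rule someI_ex)
  have cD: "countable D"
  proof -
    have "countable ((UNIV :: nat set) \<times> (UNIV :: nat set) \<times> lists S)"
      using S(1) by (intro countable_SIGMA countable_lists) auto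
    then have "countable {z \<in> (UNIV :: nat set) \<times> (UNIV :: nat set) \<times> lists S. \<exists>f. good z f}"
      by (rule countable_subset[rotated]) auto
    then show ?thesis unfolding D_def by (rule countable_image)
  qed
  have "D \<subseteq> mspace (path_space T)"
    using sel unfolding D_def good_def by fastforce
  moreover have "\<exists>c\<in>D. mdist (path_space T) c x < e" if x: "x \<in> mspace (path_space T)" and e: "e > 0" for x e
  proof -
    obtain k where k: "2 / Suc k < e"
      using reals_Archimedean[of "e / 2"] e by (auto simp: field_simps)
    have cx: "uniformly_continuous_on {0..T} x"
      using x by (intro compact_uniformly_continuous) (auto simp: mspace_path_space)
    have "0 < 1 / (2 * real (Suc k))" by simp
    from cx[unfolded uniformly_continuous_on_def, rule_format, OF this]
    obtain d where d: "d > 0" "\<And>s t. s \<in> {0..T} \<Longrightarrow> t \<in> {0..T} \<Longrightarrow> dist s t < d \<Longrightarrow> dist (x s) (x t) < 1 / (2 * real (Suc k))"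
      by blast
    \<comment> \<open>With T / N below the modulus d, rounding t down to the grid uses up half of
      the tolerance 1 / (k + 1); the other half is for the approximation of the grid values by
      points of \<open>S\<close>.\<close>
    obtain N :: nat where N: "T / d < N" "N > 0"
      using reals_Archimedean2[of "T / d"] T d by (metis divide_pos_pos of_nat_0_less_iff order_less_trans)
    have "\<exists>s\<in>S. dist (x (i * T / N)) s < 1 / (2 * real (Suc k))" for i :: nat
      using S(2)[of "ball (x (i * T / N)) (1 / (2 * real (Suc k)))"] by auto
    then obtain s where s: "\<And>i::nat. s i \<in> S" "\<And>i. dist (x (i * T / N)) (s i) < 1 / (2 * real (Suc k))" by metis
    define z where "z = (k, N, map s [0..<N+1])"
    have "\<forall>t\<in>{0..T}. dist (x t) (map s [0..<N+1] ! nat \<lfloor>t * N / T\<rfloor>) < 1 / real (Suc k)"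
    proof
      fix t assume t0: "t \<in> {0..T}"
      define i where "i = nat \<lfloor>t * N / T\<rfloor>"
      have i: "real i \<le> t * N / T" "t * N / T < real i + 1"
        using t0 T unfolding i_def by (auto simp: of_nat_nat)
      have "t * N / T \<le> N" using t0 T by (simp add: divide_le_eq mult_right_mono mult.commute)
      then have "i \<le> N" using i by (metis of_nat_le_iff order_trans)
      have it: "i * T / N \<le> t" "t < i * T / N + T / N" using i T N by (simp_all add: field_simps)
      have "T / N < d" using N d T by (simp add: field_simps)
      then have "dist (i * T / N) t < d" using it by (simp add: dist_real_def)
      moreover have "i * T / N \<in> {0..T}" using \<open>i \<le> N\<close> T N by (simp add: field_simps)
      ultimately have "dist (x (i * T / N)) (x t) < 1 / (2 * real (Suc k))" using d t0 by blast
      with s(2)[of i] have "dist (x t) (s i) < 1 / (2 * real (Suc k)) + 1 / (2 * real (Suc k))"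
        using dist_triangle3[of "x t" "s i" "x (i * T / N)"] by linarith
      also have "\<dots> = 1 / Suc k" by (simp add: field_simps)
      finally have "dist (x t) (s i) < 1 / Suc k" .
      then show "dist (x t) (map s [0..<N+1] ! nat \<lfloor>t * N / T\<rfloor>) < 1 / real (Suc k)"
        using \<open>i \<le> N\<close> unfolding i_def[symmetric] by (subst nth_map_upt) auto
    qed
    then have gx: "good z x"
      unfolding good_def z_def prod.case using x N by (intro conjI) auto
    then have zz: "z \<in> {z \<in> UNIV \<times> UNIV \<times> lists S. \<exists>f. good z f}"
      using s by (auto simp: z_def)
    define c where "c = (SOME f. good z f)"
    have "c \<in> D" unfolding D_def c_def using zz by blast
    have gc: "good z c" unfolding c_def using gx by (intro sel) blast
    have "mdist (path_space T) c x \<le> 2 / Suc k"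
    proof (subst mdist_path_space_le[OF _ x T], goal_cases)
      case 1 then show ?case using gc by (simp add: good_def z_def)
    next
      case 2
      show ?case
      proof
        fix t assume "t \<in> {0..T}"
        then have "dist (c t) (map s [0..<N+1] ! nat \<lfloor>t * N / T\<rfloor>) < 1 / Suc k"
          "dist (x t) (map s [0..<N+1] ! nat \<lfloor>t * N / T\<rfloor>) < 1 / Suc k"
          using gc gx unfolding good_def z_def by blast+
        then have "dist (c t) (x t) < 1 / Suc k + 1 / Suc k"
          using dist_triangle2[of "c t" "x t" "map s [0..<N+1] ! nat \<lfloor>t * N / T\<rfloor>"] by linarith
        then show "dist (c t) (x t) \<le> 2 / Suc k" by simp
      qed
    qed
    then show ?thesis using \<open>c \<in> D\<close> k by force
  qed
  ultimately show ?thesis using cD by blast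
qed

lemma path_space_mdist_jointly_measurable:
  "T > 0 \<Longrightarrow> (\<lambda>z. mdist (path_space T :: (real \<Rightarrow> real^'d) metric) (fst z) (snd z))
      \<in> borel_measurable (metric_borel (path_space T) \<Otimes>\<^sub>M metric_borel (path_space T))"
  using path_space_separable[of T, where 'd='d] by (auto intro: mdist_jointly_measurable)

text \<open>By continuity the supremum in the metric may be taken over rational times, so a sublevel
  set of the distance to a fixed path is a countable intersection of events that involve one time
  each.\<close>

lemma measurable_path:
  fixes X :: "real \<Rightarrow> 'w \<Rightarrow> real^'d"
  assumes T: "T > 0" and X[measurable]: "\<And>t. 0 \<le> t \<Longrightarrow> X t \<in> borel_measurable M"
    and c: "\<And>w. w \<in> space M \<Longrightarrow> continuous_on {0..T} (\<lambda>t. X t w)"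
  shows "(\<lambda>w. restrict (\<lambda>t. X t w) {0..T}) \<in> M \<rightarrow>\<^sub>M metric_borel (path_space T)"
proof -
  let ?R = "\<lambda>w. restrict (\<lambda>t. X t w) {0..T}"
  let ?E = "\<lambda>c r. \<Inter>q\<in>\<rat> \<inter> {0..T}. {w \<in> space M. dist (c q) (X q w) \<le> r}"
  let ?F = "\<lambda>c r. {w \<in> space M. mdist (path_space T) c (?R w) \<le> r}"
  obtain D :: "(real \<Rightarrow> real^'d) set" where D: "countable D" "D \<subseteq> mspace (path_space T)"
     "\<And>x e. x \<in> mspace (path_space T) \<Longrightarrow> e > 0 \<Longrightarrow> \<exists>c\<in>D. mdist (path_space T) c x < e"
    using path_space_separable[OF T, where 'd='d] by blast
  have m: "restrict (\<lambda>t. X t w) {0..T} \<in> mspace (path_space T)" if "w \<in> space M" for w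
    using c[OF that] by (auto simp: mspace_path_space cong: continuous_on_cong_simp)
  show ?thesis
  proof (rule measurable_metric_borel_separable[OF D])
    fix c assume "c \<in> D"
    then have cm: "c \<in> mspace (path_space T)" using D by auto
    show "(\<lambda>w. mdist (path_space T) c (?R w)) \<in> borel_measurable M"
    proof (rule borel_measurableI_le)
      fix r
      have "?F c r
         = ?E c r"
      proof (intro set_eqI iffI)
        fix w assume *: "w \<in> ?E c r"
        have "0 \<in> \<rat> \<inter> {0..T}" using T by auto
        with * have w: "w \<in> space M" by blast
        have "dist (c t) (X t w) \<le> r" if t: "t \<in> {0..T}" for t
        proof (rule continuous_le_on_closure[where S="\<rat> \<inter> {0<..<T}" and f="\<lambda>t. dist (c t) (X t w)"])
          \<comment> \<open>The closure is that of the rationals in the open interval, so that T is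
            reached as a limit even if it is irrational.\<close>
          have *: "closure (\<rat> \<inter> {0<..<T}) = {0..T}"
            using T closure_open_Int_superset[of "{0<..<T}" "\<rat>"] Rats_closure_real
            by (metis Int_commute closure_greaterThanLessThan open_greaterThanLessThan UNIV_I subsetI)
          show "continuous_on (closure (\<rat> \<inter> {0<..<T})) (\<lambda>t. dist (c t) (X t w))"
            unfolding * using c[OF w] cm by (intro continuous_on_dist) (auto simp: mspace_path_space)
          show "t \<in> closure (\<rat> \<inter> {0<..<T})" unfolding * by (rule t)
        next
          fix q assume "q \<in> \<rat> \<inter> {0<..<T}"
          then have "q \<in> \<rat> \<inter> {0..T}" by auto
          with \<open>w \<in> ?E c r\<close>
          show "dist (c q) (X q w) \<le> r" by blast
        qed
        then show "w \<in> ?F c r"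
          using w m[OF w] cm T by (simp add: mdist_path_space_le)
      next
        fix w assume "w \<in> ?F c r"
        then show "w \<in> ?E c r"
          using m cm T by (auto simp: mdist_path_space_le)
      qed
      also have "\<dots> \<in> sets M"
      proof (rule sets.countable_INT')
        show "countable (\<rat> \<inter> {0..T})" using countable_rat by (rule countable_Int1)
        show "\<rat> \<inter> {0..T} \<noteq> {}" using T Rats_0 by (metis IntI atLeastAtMost_iff empty_iff less_imp_le order_refl)
        show "(\<lambda>q. {w \<in> space M. dist (c q) (X q w) \<le> r}) ` (\<rat> \<inter> {0..T}) \<subseteq> sets M"
        proof clarify
          fix q assume "q \<in> {0..T}"
          then have [measurable]: "X q \<in> borel_measurable M" using X by auto
          show "{w \<in> space M. dist (c q) (X q w) \<le> r} \<in> sets M" by measurable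
        qed
      qed
      finally show "?F c r \<in> sets M" .
    qed
  qed (use m in auto)
qed

section \<open>An approximate solution of the noiseless equation\<close>

text \<open>\<open>{0..t}\<close> is empty for negative t, so the primitive is constant there and
  the bound persists on the whole line. This matters because a delayed argument s - h can be
  negative.\<close>

lemma integral_from_0_lipschitz:
  fixes F :: "real \<Rightarrow> 'a::euclidean_space"
  assumes F: "continuous_on UNIV F" and m: "\<And>u. norm (F u) \<le> m" and st: "s \<le> t"
  shows "norm (integral {0..t} F - integral {0..s} F) \<le> m * (t - s)"
proof -
  have i: "F integrable_on {a..b}" for a b
    by (intro integrable_continuous_interval continuous_on_subset[OF F]) simp
  have m0: "m \<ge> 0" using m[of 0] norm_ge_zero order_trans by blast
  consider "t \<le> 0" | "s \<le> 0" "0 \<le> t" | "0 \<le> s" using st by linarith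
  then show ?thesis
  proof cases
    case 1
    then have "integral {0..t} F = 0" "integral {0..s} F = 0"
      using st by (cases "t = 0"; cases "s = 0"; simp)+
    then show ?thesis using st m0 by simp
  next
    case 2
    then have "integral {0..s} F = 0" by (cases "s = 0") auto
    moreover have "norm (integral {0..t} F) \<le> m * (t - 0)"
      using 2 m by (intro integral_bound continuous_on_subset[OF F]) auto
    moreover have "m * (t - 0) \<le> m * (t - s)" using 2 m0 by (intro mult_left_mono) auto
    ultimately show ?thesis by simp
  next
    case 3
    then have "integral {0..s} F + integral {s..t} F = integral {0..t} F"
      using st i by (intro Henstock_Kurzweil_Integration.integral_combine) auto
    moreover have "norm (integral {s..t} F) \<le> m * (t - s)"
      using st m by (intro integral_bound continuous_on_subset[OF F]) auto
    ultimately show ?thesis by (metis add_diff_cancel_left')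
  qed
qed

text \<open>For t \<le> 0 the integral is 0, so every iterate continues x backwards as a constant.
  This is the history to which the delay refers.\<close>

primrec delay_iter :: "('a::euclidean_space \<Rightarrow> 'a) \<Rightarrow> real \<Rightarrow> 'a \<Rightarrow> nat \<Rightarrow> real \<Rightarrow> 'a" where
  "delay_iter b h x 0 = (\<lambda>_. x)"
| "delay_iter b h x (Suc n) = (\<lambda>t. x + integral {0..t} (\<lambda>s. b (delay_iter b h x n (s - h))))"

text \<open>The delayed equation \<open>y' (t) = b (y (t - h))\<close> is solved by finitely many Picard iterations:
  the \<open>n\<close>-th iterate is already a solution on \<open>[0, n h]\<close>.\<close>
lemma delay_equation:
  fixes b :: "'a::euclidean_space \<Rightarrow> 'a"
  assumes b: "continuous_on UNIV b" and m: "\<And>u. norm (b u) \<le> m" and h: "h > 0"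
  obtains y where "continuous_on UNIV y" "\<And>s t. norm (y t - y s) \<le> m * \<bar>t - s\<bar>" "\<And>t. t \<le> 0 \<Longrightarrow> y t = x"
    "\<And>t. t \<le> T \<Longrightarrow> y t = x + integral {0..t} (\<lambda>s. b (y (s - h)))"
proof -
  let ?Y = "delay_iter b h x"
  have m0: "m \<ge> 0" using m[of 0] norm_ge_zero order_trans by blast
  have Y0: "?Y n t = x" if "t \<le> 0" for n t using that by (cases n; cases "t = 0") auto
  have L: "continuous_on UNIV (?Y n) \<and> (\<forall>s t. norm (?Y n t - ?Y n s) \<le> m * \<bar>t - s\<bar>)" for n
  proof (induction n)
    case 0 then show ?case using m0 by simp
  next
    case (Suc n)
    have c: "continuous_on UNIV (\<lambda>s. b (?Y n (s - h)))"
      using Suc by (auto intro!: continuous_on_compose2[OF b] continuous_on_compose2[OF conjunct1[OF Suc]] continuous_intros)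
    have 1: "norm (?Y (Suc n) t - ?Y (Suc n) s) \<le> m * \<bar>t - s\<bar>" for s t
    proof (cases "s \<le> t")
      case True
      then show ?thesis using integral_from_0_lipschitz[OF c m, of s t] by simp
    next
      case False
      then show ?thesis using integral_from_0_lipschitz[OF c m, of t s] by (simp add: norm_minus_commute)
    qed
    have "m-lipschitz_on UNIV (?Y (Suc n))"
      using 1 m0 by (intro lipschitz_onI) (auto simp: dist_norm simp del: delay_iter.simps)
    then show ?case using 1 lipschitz_on_continuous_on by blast
  qed
  \<comment> \<open>An iterate looks at its predecessor only at times s - h, so each round of the
    induction gains one delay length of agreement.\<close>
  have st: "?Y (Suc n) t = ?Y n t" if "t \<le> n * h" for n t
    using that
  proof (induction n arbitrary: t)
    case 0 then show ?case using Y0[of t "Suc 0"] by simp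
  next
    case (Suc n)
    have "integral {0..t} (\<lambda>s. b (?Y (Suc n) (s - h))) = integral {0..t} (\<lambda>s. b (?Y n (s - h)))"
    proof (rule Henstock_Kurzweil_Integration.integral_cong)
      fix s assume "s \<in> {0..t}"
      then have "s - h \<le> n * h" using Suc.prems by (simp add: distrib_right)
      from Suc.IH[OF this] show "b (?Y (Suc n) (s - h)) = b (?Y n (s - h))" by simp
    qed
    then show ?case by simp
  qed
  obtain n :: nat where "T / h \<le> n" using real_arch_simple by blast
  then have n: "T \<le> n * h" using h by (simp add: field_simps)
  show ?thesis
  proof (rule that[of "?Y n"])
    show "?Y n t = x + integral {0..t} (\<lambda>s. b (?Y n (s - h)))" if "t \<le> T" for t
      using st[of t n] n that by simp
  qed (use L Y0 in auto)
qed

text \<open>Outside of a large ball the drift is frozen along rays, which keeps the one-sided growth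
  condition and makes the drift bounded.\<close>
lemma approximate_ode_solution:
  fixes b :: "'a::euclidean_space \<Rightarrow> 'a" and B T :: real
  assumes b: "continuous_on UNIV b" and B: "B \<ge> 0"
    and one: "\<And>x y. (y - x) \<bullet> (b y - b x) \<le> B * (1 + (norm (y - x))\<^sup>2)" and T: "T > 0"
  obtains y g where "continuous_on UNIV y" "continuous_on UNIV g"
    "\<And>t. t \<in> {0..T} \<Longrightarrow> y t = x + integral {0..t} g"
    "\<And>t. t \<in> {0..T} \<Longrightarrow> norm (g t - b (y t)) \<le> 1"
proof -
  \<comment> \<open>With q = |y - x|, the derivative of q^2 is at most 4 B (1 + q^2) + 2 q (1 + |b
    x|), and 2 q \<le> 1 + q^2 turns this into c (1 + q^2). The resulting growth factor exp (c T)
    serves as the radius R of a ball that y does not leave.\<close>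
  define c where "c = 4 * B + norm (b x) + 1"
  have c: "c > 0" using B by (simp add: c_def add_nonneg_pos)
  define R where "R = exp (c * T)"
  have R: "R \<ge> 1" unfolding R_def using c T by simp
  \<comment> \<open>Radial projection onto the closed ball of radius R around x.\<close>
  define p where "p = (\<lambda>z. x + (R / max R (norm (z - x))) *\<^sub>R (z - x))"
  have pc: "continuous_on UNIV p" unfolding p_def using R
    by (intro continuous_intros) (auto simp: max_def)
  have pR: "p z \<in> cball x R" for z
  proof -
    define a where "a = R / max R (norm (z - x))"
    have "0 \<le> a" using R by (simp add: a_def)
    then have "norm (p z - x) = a * norm (z - x)" by (simp add: p_def a_def[symmetric])
    also have "\<dots> = R * (norm (z - x) / max R (norm (z - x)))" by (simp add: a_def)
    also have "\<dots> \<le> R * 1" using R by (intro mult_left_mono) (auto simp: divide_le_eq)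
    finally show ?thesis by (simp add: dist_norm norm_minus_commute)
  qed
  have pid: "p z = z" if "norm (z - x) \<le> R" for z using that R by (simp add: p_def max_def)
  define b' where "b' = (\<lambda>z. b (p z))"
  have b'c: "continuous_on UNIV b'" unfolding b'_def by (rule continuous_on_compose2[OF b pc]) auto
  have "bounded (b ` cball x R)"
    by (intro compact_imp_bounded compact_continuous_image continuous_on_subset[OF b]) auto
  then obtain m where m: "m > 0" "\<And>u. u \<in> b ` cball x R \<Longrightarrow> norm u \<le> m"
    unfolding bounded_pos by blast
  have b'm: "norm (b' z) \<le> m" for z unfolding b'_def using m pR by blast
  \<comment> \<open>Only pairs with base point x are needed. Here z - x is k times p z - x with k
    \<ge> 1; multiplying the hypothesis at p z by k costs a factor 2, from k \<le> 1 + |z - x| \<le>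
    2 + |z - x|^2.\<close>
  have b'1: "(z - x) \<bullet> (b' z - b x) \<le> 2 * B * (1 + (norm (z - x))\<^sup>2)" for z
  proof -
    define k where "k = max R (norm (z - x)) / R"
    have k: "k \<ge> 1" using R by (simp add: k_def)
    define M where "M = max R (norm (z - x))"
    have "M > 0" using R by (simp add: M_def)
    then have kM: "k * (R / M) = 1" using R by (simp add: k_def M_def[symmetric])
    have pz: "p z - x = (R / M) *\<^sub>R (z - x)" by (simp add: p_def M_def)
    have zp: "z - x = k *\<^sub>R (p z - x)" unfolding pz scaleR_scaleR kM by simp
    then have nz: "(norm (z - x))\<^sup>2 = k\<^sup>2 * (norm (p z - x))\<^sup>2" by (metis norm_scaleR power_mult_distrib power2_abs)
    have "(z - x) \<bullet> (b' z - b x) = k * ((p z - x) \<bullet> (b (p z) - b x))" by (subst zp) (simp add: b'_def)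
    also have "\<dots> \<le> k * (B * (1 + (norm (p z - x))\<^sup>2))" using k one by (intro mult_left_mono) auto
    also have "\<dots> = B * (k + k * (norm (p z - x))\<^sup>2)" by (simp add: algebra_simps)
    also have "\<dots> \<le> B * (2 * (1 + (norm (z - x))\<^sup>2))"
    proof (rule mult_left_mono[OF _ B])
      have "k * (norm (p z - x))\<^sup>2 \<le> k\<^sup>2 * (norm (p z - x))\<^sup>2"
        using k by (intro mult_right_mono) (auto simp: power2_eq_square)
      moreover have "k \<le> 1 + norm (z - x)"
      proof (cases "R \<le> norm (z - x)")
        case True
        have "norm (z - x) / R \<le> norm (z - x) / 1" using R by (intro divide_left_mono) auto
        then show ?thesis using True by (simp add: k_def)
      qed (use R in \<open>simp add: k_def\<close>)
      moreover have "norm (z - x) \<le> 1 + (norm (z - x))\<^sup>2"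
        using sum_squares_bound[of 1 "norm (z - x)"] by (simp add: power2_norm_eq_inner) (smt (verit) norm_ge_zero)
      ultimately show "k + k * (norm (p z - x))\<^sup>2 \<le> 2 * (1 + (norm (z - x))\<^sup>2)" using nz by simp
    qed
    finally show ?thesis by (simp add: algebra_simps)
  qed
  have "uniformly_continuous_on (cball x (m * T)) b'"
    by (intro compact_uniformly_continuous continuous_on_subset[OF b'c]) auto
  from this[unfolded uniformly_continuous_on_def, rule_format, OF zero_less_one]
  obtain \<eta> where \<eta>: "\<eta> > 0" "\<And>u v. u \<in> cball x (m * T) \<Longrightarrow> v \<in> cball x (m * T) \<Longrightarrow> dist v u < \<eta> \<Longrightarrow> dist (b' v) (b' u) < 1"
    by blast
  \<comment> \<open>During one delay y moves by at most m h = \<eta> / 2, which keeps the drift at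
    the delayed position within 1 of the current drift.\<close>
  define h where "h = \<eta> / (2 * m)"
  have h: "h > 0" "m * h < \<eta>" using \<eta> m by (auto simp: h_def)
  obtain y where y: "continuous_on UNIV y" "\<And>s t. norm (y t - y s) \<le> m * \<bar>t - s\<bar>" "\<And>t. t \<le> 0 \<Longrightarrow> y t = x"
    "\<And>t. t \<le> T \<Longrightarrow> y t = x + integral {0..t} (\<lambda>s. b' (y (s - h)))"
    by (rule delay_equation[OF b'c b'm h(1), where x=x and T=T]) blast
  define g where "g = (\<lambda>s. b' (y (s - h)))"
  have gc: "continuous_on UNIV g" unfolding g_def
    by (intro continuous_on_compose2[OF b'c] continuous_on_compose2[OF y(1)] continuous_intros) auto
  have yg: "y t = x + integral {0..t} g" if "t \<le> T" for t using y(4)[OF that] by (simp add: g_def)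
  have yK: "y t \<in> cball x (m * T)" if "t \<le> T" for t
  proof (cases "t \<le> 0")
    case True then show ?thesis using y(3) m T by simp
  next
    case False
    have "norm (y t - y 0) \<le> m * \<bar>t - 0\<bar>" by (rule y(2))
    also have "\<dots> \<le> m * T" using False that m by (intro mult_left_mono) auto
    finally show ?thesis using y(3)[of 0] by (simp add: dist_norm norm_minus_commute)
  qed
  have gb': "norm (g t - b' (y t)) \<le> 1" if "t \<le> T" for t
  proof -
    have "dist (y (t - h)) (y t) \<le> m * \<bar>t - h - t\<bar>" unfolding dist_norm by (rule y(2))
    then have "dist (y (t - h)) (y t) < \<eta>" using h by simp
    then show ?thesis using \<eta>(2)[of "y t" "y (t - h)"] yK[of t] yK[of "t - h"] that h by (simp add: g_def dist_norm)
  qed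
  have yd: "(y has_vector_derivative g t) (at t)" if t: "0 < t" "t < T" for t
  proof -
    have "((\<lambda>u. integral {0..u} g) has_vector_derivative g t) (at t within {0..T})"
      using t by (intro integral_has_vector_derivative continuous_on_subset[OF gc]) auto
    then have "((\<lambda>u. integral {0..u} g) has_vector_derivative g t) (at t)"
      using t by (simp add: at_within_Icc_at)
    then have "((\<lambda>u. x + integral {0..u} g) has_vector_derivative (0 + g t)) (at t)"
      by (intro derivative_intros)
    then have *: "((\<lambda>u. x + integral {0..u} g) has_vector_derivative g t) (at t)" by simp
    show ?thesis
      by (rule has_vector_derivative_transform_within_open[OF *, of "{0<..<T}"]) (use t yg in auto)
  qed
  \<comment> \<open>Gronwall's argument in differential form: the weight exp (- c t) makes 1 + |y -
    x|^2 nonincreasing.\<close>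
  define u where "u = (\<lambda>t. exp (- c * t) * (1 + (y t - x) \<bullet> (y t - x)))"
  have uu: "u t \<le> u 0" if t: "0 \<le> t" "t \<le> T" for t
  proof (rule DERIV_nonpos_imp_decreasing_open[OF t(1)])
    show "continuous_on {0..t} u" unfolding u_def
      by (intro continuous_intros continuous_on_subset[OF y(1)]) auto
    fix s assume s: "0 < s" "s < t"
    have d: "(y has_derivative (\<lambda>v. v *\<^sub>R g s)) (at s)"
      using yd[of s] s t unfolding has_vector_derivative_def by simp
    have "(u has_derivative (\<lambda>v. v * (exp (- c * s) * (2 * ((y s - x) \<bullet> g s) - c * (1 + (y s - x) \<bullet> (y s - x)))))) (at s)"
      unfolding u_def by (rule derivative_eq_intros d refl)+ (auto simp: fun_eq_iff algebra_simps inner_commute)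
    then have "(u has_real_derivative (exp (- c * s) * (2 * ((y s - x) \<bullet> g s) - c * (1 + (y s - x) \<bullet> (y s - x))))) (at s)"
      unfolding has_field_derivative_def by (rule has_derivative_eq_rhs) (simp add: fun_eq_iff mult.commute)
    moreover have "2 * ((y s - x) \<bullet> g s) \<le> c * (1 + (y s - x) \<bullet> (y s - x))"
    proof -
      define q where "q = norm (y s - x)"
      have qq: "(y s - x) \<bullet> (y s - x) = q\<^sup>2" unfolding q_def by (simp add: power2_norm_eq_inner)
      have "(y s - x) \<bullet> g s = (y s - x) \<bullet> (b' (y s) - b x) + (y s - x) \<bullet> (g s - b' (y s)) + (y s - x) \<bullet> b x"
        by (simp add: inner_diff_right)
      also have "\<dots> \<le> 2 * B * (1 + q\<^sup>2) + q * 1 + q * norm (b x)"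
      proof (intro add_mono)
        show "(y s - x) \<bullet> (b' (y s) - b x) \<le> 2 * B * (1 + q\<^sup>2)" using b'1 by (simp add: q_def)
        have "(y s - x) \<bullet> (g s - b' (y s)) \<le> q * norm (g s - b' (y s))" unfolding q_def by (rule norm_cauchy_schwarz)
        also have "\<dots> \<le> q * 1" using gb'[of s] s t by (intro mult_left_mono) (auto simp: q_def)
        finally show "(y s - x) \<bullet> (g s - b' (y s)) \<le> q * 1" .
        show "(y s - x) \<bullet> b x \<le> q * norm (b x)" unfolding q_def by (rule norm_cauchy_schwarz)
      qed
      finally have "2 * ((y s - x) \<bullet> g s) \<le> 4 * B * (1 + q\<^sup>2) + (2 * q) * (1 + norm (b x))" by (simp add: algebra_simps)
      also have "\<dots> \<le> 4 * B * (1 + q\<^sup>2) + (1 + q\<^sup>2) * (1 + norm (b x))"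
        using sum_squares_bound[of 1 q] by (intro add_left_mono mult_right_mono) (auto simp: add_nonneg_nonneg)
      also have "\<dots> = c * (1 + q\<^sup>2)" by (simp add: c_def algebra_simps)
      finally show ?thesis unfolding qq .
    qed
    ultimately show "\<exists>z. (u has_real_derivative z) (at s) \<and> z \<le> 0"
      by (intro exI conjI) (auto simp: mult_le_0_iff)
  qed
  have yR: "norm (y t - x) \<le> R" if t: "0 \<le> t" "t \<le> T" for t
  proof -
    have "exp (- c * t) * (1 + (norm (y t - x))\<^sup>2) \<le> 1"
      using uu[OF t] y(3)[of 0] by (simp add: u_def power2_norm_eq_inner)
    then have "1 + (norm (y t - x))\<^sup>2 \<le> exp (c * t)" by (simp add: exp_minus field_simps)
    also have "\<dots> \<le> R" unfolding R_def using t c by simp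
    also have "\<dots> \<le> R\<^sup>2" using R by (simp add: power2_eq_square)
    finally have "(norm (y t - x))\<^sup>2 \<le> R\<^sup>2" by simp
    then show ?thesis using R by (simp add: power2_le_iff_abs_le)
  qed
  show ?thesis
  proof (rule that[OF y(1) gc])
    fix t assume t: "t \<in> {0..T}"
    then show "y t = x + integral {0..t} g" using yg by auto
    show "norm (g t - b (y t)) \<le> 1" using gb'[of t] yR[of t] pid[of "y t"] t by (simp add: b'_def)
  qed
qed

section \<open>The pathwise energy estimate\<close>

text \<open>Expanding the square, the drift contributes 2 h (z \<bullet> \<beta>) up to errors of
  order h \<eta>. The decay of the weight from \<alpha> to \<alpha>' pays for it: the share 2 B of
  \<open>lam\<close> cancels the growth in |z|^2, and the share
  \<open>\<kappa>\<^sub>1 * \<delta>\<close> leaves room for the compensator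
  \<open>\<kappa>\<^sub>1 * \<alpha>'\<^sup>2\<close> of the noise, since \<alpha>' \<le>
  \<delta>.\<close>

lemma energy_increment_bound:
  fixes z J :: "'a::real_inner" and \<alpha> \<alpha>' :: real
  assumes \<alpha>: "\<alpha>' > 0" "\<alpha>' \<le> \<delta>" "\<alpha>' * (1 + lam * h) \<le> \<alpha>"
    and h: "h \<ge> 0" "h \<le> \<eta>" and lam: "lam = 2 * B + \<kappa>\<^sub>1 * \<delta>"
    and nn: "B \<ge> 0" "\<kappa>\<^sub>1 \<ge> 0" "\<kappa>\<^sub>2 \<ge> 0" "\<eta> \<ge> 0" "L \<ge> 0"
    and z: "norm z \<le> L" and J: "norm J \<le> \<eta>"
    and I: "norm (I - h *\<^sub>R \<beta>) \<le> h * \<eta>" "norm I \<le> h * L"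
    and one: "z \<bullet> \<beta> \<le> B * (1 + (norm z)\<^sup>2)"
    and \<epsilon>: "\<eta> * (4 * L + L\<^sup>2) \<le> \<epsilon>"
  shows "\<alpha>' * (norm (z + J + I))\<^sup>2 - \<alpha> * (norm z)\<^sup>2 \<le>
    (\<alpha>' * (2 * (z \<bullet> J) + (norm J)\<^sup>2) - h * (\<kappa>\<^sub>1 * \<alpha>'\<^sup>2 * (norm z)\<^sup>2 + \<kappa>\<^sub>2 * \<alpha>'))
     + h * (\<delta> * (\<kappa>\<^sub>2 + 2 * B + \<epsilon>))"
proof -
  have \<epsilon>0: "\<epsilon> \<ge> 0" using \<epsilon> nn by (smt (verit) mult_nonneg_nonneg zero_le_power2)
  have zI: "z \<bullet> I \<le> h * (B * (1 + (norm z)\<^sup>2)) + L * (h * \<eta>)"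
  proof -
    have "z \<bullet> I = h * (z \<bullet> \<beta>) + z \<bullet> (I - h *\<^sub>R \<beta>)" by (simp add: inner_diff_right)
    moreover have "z \<bullet> (I - h *\<^sub>R \<beta>) \<le> norm z * norm (I - h *\<^sub>R \<beta>)" by (rule norm_cauchy_schwarz)
    moreover have "norm z * norm (I - h *\<^sub>R \<beta>) \<le> L * (h * \<eta>)" using z I nn by (intro mult_mono) auto
    moreover have "h * (z \<bullet> \<beta>) \<le> h * (B * (1 + (norm z)\<^sup>2))" using one h by (rule_tac mult_left_mono)
    ultimately show ?thesis by linarith
  qed
  have JI: "J \<bullet> I \<le> \<eta> * (h * L)"
  proof -
    have "J \<bullet> I \<le> norm J * norm I" by (rule norm_cauchy_schwarz)
    also have "\<dots> \<le> \<eta> * (h * L)" using J I nn by (intro mult_mono) auto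
    finally show ?thesis .
  qed
  have II: "(norm I)\<^sup>2 \<le> h * (\<eta> * L\<^sup>2)"
  proof -
    have "(norm I)\<^sup>2 \<le> (h * L)\<^sup>2" using I by (intro power_mono) auto
    also have "\<dots> = h * (h * L\<^sup>2)" by (simp add: power2_eq_square)
    also have "\<dots> \<le> h * (\<eta> * L\<^sup>2)" using h by (intro mult_left_mono mult_right_mono) auto
    finally show ?thesis .
  qed
  define Q where "Q = 2 * (z \<bullet> J) + (norm J)\<^sup>2"
  define n where "n = (norm z)\<^sup>2"
  have n0: "n \<ge> 0" by (simp add: n_def)
  have "(norm (z + J + I))\<^sup>2 = n + Q + 2 * (z \<bullet> I) + 2 * (J \<bullet> I) + (norm I)\<^sup>2"
    unfolding Q_def n_def power2_norm_eq_inner by (simp add: inner_add_left inner_add_right inner_commute)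
  \<comment> \<open>The error collects 2 L \<eta> from z \<bullet> I, another 2 L \<eta> from J
    \<bullet> I, and L^2 \<eta> from |I|^2, each times h.\<close>
  also have "\<dots> \<le> n + Q + 2 * (h * (B * (1 + n))) + h * (\<eta> * (4 * L + L\<^sup>2))"
    using zI JI II unfolding n_def by (simp add: algebra_simps)
  also have "\<dots> \<le> n + Q + 2 * (h * (B * (1 + n))) + h * \<epsilon>"
    using \<epsilon> h by (intro add_left_mono mult_left_mono) auto
  finally have "\<alpha>' * (norm (z + J + I))\<^sup>2 \<le> \<alpha>' * (n + Q + 2 * (h * (B * (1 + n))) + h * \<epsilon>)"
    using \<alpha> by (intro mult_left_mono) auto
  moreover have "\<alpha>' * (1 + lam * h) * n \<le> \<alpha> * n" using \<alpha> n0 by (intro mult_right_mono) auto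
  ultimately have 1: "\<alpha>' * (norm (z + J + I))\<^sup>2 - \<alpha> * n
      \<le> \<alpha>' * Q + \<alpha>' * h * (2 * B + \<epsilon>) - \<alpha>' * h * \<kappa>\<^sub>1 * \<delta> * n"
    unfolding lam by (simp add: algebra_simps)
  have "\<alpha>' * h * (2 * B + \<epsilon> + \<kappa>\<^sub>2) \<le> \<delta> * h * (2 * B + \<epsilon> + \<kappa>\<^sub>2)"
    using \<alpha> h nn \<epsilon>0 by (intro mult_right_mono) auto
  moreover have "(\<alpha>' * h * \<kappa>\<^sub>1 * n) * \<alpha>' \<le> (\<alpha>' * h * \<kappa>\<^sub>1 * n) * \<delta>"
    using \<alpha> h nn n0 by (intro mult_left_mono) auto
  ultimately show ?thesis
    using 1 unfolding Q_def[symmetric] n_def[symmetric] by (simp add: algebra_simps power2_eq_square)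
qed

definition energy_weight :: "real \<Rightarrow> real \<Rightarrow> real \<Rightarrow> nat \<Rightarrow> nat \<Rightarrow> real" where
  "energy_weight \<delta> lam T N j = \<delta> * exp (- lam * (real j * T / N))"

text \<open>The contribution of the noise to the weighted increment of \<open>\<bar>Z\<bar>\<^sup>2\<close>, minus a compensator that will make
  its exponential a supermartingale.\<close>
definition energy_step ::
  "real \<Rightarrow> real \<Rightarrow> real \<Rightarrow> real \<Rightarrow> (real \<Rightarrow> 'a::real_inner) \<Rightarrow> (real \<Rightarrow> 'a) \<Rightarrow> real \<Rightarrow> nat \<Rightarrow> nat \<Rightarrow> real" where
  "energy_step \<delta> lam \<kappa>\<^sub>1 \<kappa>\<^sub>2 Z J T N j =
     (let \<alpha> = energy_weight \<delta> lam T N (Suc j); z = Z (real j * T / real N); d = J (real (Suc j) * T / real N) - J (real j * T / real N)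
      in \<alpha> * (2 * (z \<bullet> d) + (norm d)\<^sup>2) - T / N * (\<kappa>\<^sub>1 * \<alpha>\<^sup>2 * (norm z)\<^sup>2 + \<kappa>\<^sub>2 * \<alpha>))"

text \<open>The one-step bound is summed over the grid. It asks for a mesh that is fine relative to
  the moduli of continuity of this one path, hence a statement about eventually all N, without
  uniformity over paths.\<close>

lemma energy_path_estimate:
  fixes Z J \<beta> :: "real \<Rightarrow> 'a::euclidean_space"
  assumes T: "T > 0" and cZ: "continuous_on {0..T} Z" and cJ: "continuous_on {0..T} J"
    and c\<beta>: "continuous_on {0..T} \<beta>"
    and eq: "\<And>t. t \<in> {0..T} \<Longrightarrow> Z t = J t + integral {0..t} \<beta>" and Z0: "Z 0 = 0"
    and one: "\<And>t. t \<in> {0..T} \<Longrightarrow> Z t \<bullet> \<beta> t \<le> B * (1 + (norm (Z t))\<^sup>2)"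
    and nn: "B \<ge> 0" "\<kappa>\<^sub>1 \<ge> 0" "\<kappa>\<^sub>2 \<ge> 0" "\<delta> > 0" and lam: "lam = 2 * B + \<kappa>\<^sub>1 * \<delta>" and \<epsilon>: "\<epsilon> > 0"
  shows "\<forall>\<^sub>F N in sequentially. \<forall>k\<le>N. energy_weight \<delta> lam T N k * (norm (Z (real k * T / N)))\<^sup>2
     \<le> (\<Sum>j<k. energy_step \<delta> lam \<kappa>\<^sub>1 \<kappa>\<^sub>2 Z J T N j) + T * (\<delta> * (\<kappa>\<^sub>2 + 2 * B + \<epsilon>))"
proof -
  have "bounded (Z ` {0..T})" "bounded (\<beta> ` {0..T})"
    by (intro compact_imp_bounded compact_continuous_image cZ c\<beta> compact_Icc)+
  then obtain L1 L2 where "\<And>t. t \<in> {0..T} \<Longrightarrow> norm (Z t) \<le> L1" "\<And>t. t \<in> {0..T} \<Longrightarrow> norm (\<beta> t) \<le> L2"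
    unfolding bounded_iff by blast
  then obtain L where L: "L \<ge> 0" "\<And>t. t \<in> {0..T} \<Longrightarrow> norm (Z t) \<le> L" "\<And>t. t \<in> {0..T} \<Longrightarrow> norm (\<beta> t) \<le> L"
    using T by (smt (verit, best) atLeastAtMost_iff norm_ge_zero)
  define \<eta> where "\<eta> = \<epsilon> / (4 * L + L\<^sup>2 + 1)"
  have den: "4 * L + L\<^sup>2 + 1 > 0" using L by (smt (verit) zero_le_power2)
  have \<eta>: "\<eta> > 0" using \<epsilon> den by (simp add: \<eta>_def)
  have \<eta>\<epsilon>: "\<eta> * (4 * L + L\<^sup>2) \<le> \<epsilon>"
  proof -
    have "\<eta> * (4 * L + L\<^sup>2) \<le> \<eta> * (4 * L + L\<^sup>2 + 1)" using \<eta> by (intro mult_left_mono) auto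
    also have "\<dots> = \<epsilon>" using den by (simp add: \<eta>_def)
    finally show ?thesis .
  qed
  have "uniformly_continuous_on {0..T} J" "uniformly_continuous_on {0..T} \<beta>"
    by (intro compact_uniformly_continuous cJ c\<beta> compact_Icc)+
  then obtain d1 d2 where d12: "d1 > 0" "d2 > 0"
    "\<And>s t. s \<in> {0..T} \<Longrightarrow> t \<in> {0..T} \<Longrightarrow> dist t s < d1 \<Longrightarrow> dist (J t) (J s) < \<eta>"
    "\<And>s t. s \<in> {0..T} \<Longrightarrow> t \<in> {0..T} \<Longrightarrow> dist t s < d2 \<Longrightarrow> dist (\<beta> t) (\<beta> s) < \<eta>"
    unfolding uniformly_continuous_on_def using \<eta> by metis
  \<comment> \<open>The mesh stays below \<eta> too: the square of the drift increment is of order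
    h^2, and one of its factors h has to be small.\<close>
  define d where "d = min \<eta> (min d1 d2)"
  have d: "d > 0" using d12 \<eta> by (simp add: d_def)
  have "\<forall>\<^sub>F N in sequentially. T / d < real N"
    using filterlim_real_sequentially by (simp add: filterlim_at_top_dense)
  then show ?thesis
  proof eventually_elim
    case (elim N)
    have N: "N > 0" using elim T d by (metis divide_pos_pos of_nat_0_less_iff order_less_trans)
    define h where "h = T / N"
    have h: "h > 0" "h < d" using elim T N d by (auto simp: h_def field_simps)
    have tI: "real k * T / N \<in> {0..T}" if "k \<le> N" for k :: nat
      using that T N by (auto simp: field_simps)
    have step: "energy_weight \<delta> lam T N (Suc j) * (norm (Z (real (Suc j) * T / N)))\<^sup>2
        - energy_weight \<delta> lam T N j * (norm (Z (real j * T / N)))\<^sup>2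
        \<le> energy_step \<delta> lam \<kappa>\<^sub>1 \<kappa>\<^sub>2 Z J T N j + h * (\<delta> * (\<kappa>\<^sub>2 + 2 * B + \<epsilon>))" if j: "j < N" for j
    proof -
      define s where "s = real j * T / N"
      define t where "t = real (Suc j) * T / N"
      have ts: "t = s + h" unfolding s_def t_def h_def by (simp add: distrib_right add_divide_distrib)
      have st: "s \<in> {0..T}" "t \<in> {0..T}"
        using tI[of j] tI[of "Suc j"] j unfolding s_def t_def by simp_all
      define I where "I = integral {s..t} \<beta>"
      have int: "\<beta> integrable_on {a..b}" if "{a..b} \<subseteq> {0..T}" for a b
        by (intro integrable_continuous_interval continuous_on_subset[OF c\<beta>] that)
      have "integral {0..s} \<beta> + I = integral {0..t} \<beta>"
        unfolding I_def using st ts h by (intro Henstock_Kurzweil_Integration.integral_combine int) auto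
      then have Zt: "Z t = Z s + (J t - J s) + I" using eq st by (simp add: algebra_simps)
      have nI: "norm (I - h *\<^sub>R \<beta> s) \<le> h * \<eta>"
      proof -
        have "I - h *\<^sub>R \<beta> s = integral {s..t} (\<lambda>u. \<beta> u - \<beta> s)"
          unfolding I_def using st ts h by (subst Henstock_Kurzweil_Integration.integral_diff) (auto intro!: int)
        also have "norm \<dots> \<le> \<eta> * (t - s)"
        proof (rule integral_bound)
          show "s \<le> t" using ts h by simp
          show "continuous_on {s..t} (\<lambda>u. \<beta> u - \<beta> s)"
            using st by (intro continuous_intros continuous_on_subset[OF c\<beta>]) auto
          fix u assume u: "u \<in> {s..t}"
          then have "dist (\<beta> u) (\<beta> s) < \<eta>" using st ts h by (intro d12) (auto simp: d_def dist_real_def)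
          then show "norm (\<beta> u - \<beta> s) \<le> \<eta>" by (simp add: dist_norm)
        qed
        finally show ?thesis using ts by (simp add: mult.commute)
      qed
      have nI2: "norm I \<le> h * L"
      proof -
        have "norm I \<le> L * (t - s)" unfolding I_def
          using st ts h L by (intro integral_bound continuous_on_subset[OF c\<beta>]) auto
        then show ?thesis using ts by (simp add: mult.commute)
      qed
      have nJ: "norm (J t - J s) \<le> \<eta>"
        using d12(3)[OF st] ts h by (auto simp: d_def dist_norm dist_real_def)
      have w: "energy_weight \<delta> lam T N (Suc j) = \<delta> * exp (- lam * t)" "energy_weight \<delta> lam T N j = \<delta> * exp (- lam * s)"
        by (simp_all add: energy_weight_def s_def t_def)
      have lam0: "lam \<ge> 0" using lam nn by simp
      \<comment> \<open>The weights at neighbouring grid times differ by the factor exp (lam h),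
        which is at least the factor 1 + lam h of the one-step bound.\<close>
      have w1: "\<delta> * exp (- lam * t) * (1 + lam * h) \<le> \<delta> * exp (- lam * s)"
      proof -
        have "exp (- lam * t) * (1 + lam * h) \<le> exp (- lam * t) * exp (lam * h)"
          by (intro mult_left_mono exp_ge_add_one_self) simp
        also have "\<dots> = exp (- lam * s)" by (simp add: ts exp_add[symmetric] algebra_simps)
        finally show ?thesis using nn by (simp add: mult.assoc)
      qed
      have w2: "\<delta> * exp (- lam * t) \<le> \<delta>"
        using nn lam0 st by (intro mult_left_le) auto
      have "\<delta> * exp (- lam * t) * (norm (Z s + (J t - J s) + I))\<^sup>2 - \<delta> * exp (- lam * s) * (norm (Z s))\<^sup>2
        \<le> (\<delta> * exp (- lam * t) * (2 * (Z s \<bullet> (J t - J s)) + (norm (J t - J s))\<^sup>2)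
           - h * (\<kappa>\<^sub>1 * (\<delta> * exp (- lam * t))\<^sup>2 * (norm (Z s))\<^sup>2 + \<kappa>\<^sub>2 * (\<delta> * exp (- lam * t))))
         + h * (\<delta> * (\<kappa>\<^sub>2 + 2 * B + \<epsilon>))"
        by (rule energy_increment_bound[OF _ w2 w1 _ _ lam nn(1-3) _ _ _ nJ nI nI2 _ \<eta>\<epsilon>])
           (use nn h L st one \<eta> in \<open>auto simp: d_def\<close>)
      then show ?thesis
        unfolding energy_step_def Let_def w s_def[symmetric] t_def[symmetric] h_def[symmetric] Zt .
    qed
    have ind: "energy_weight \<delta> lam T N k * (norm (Z (real k * T / N)))\<^sup>2
       \<le> (\<Sum>j<k. energy_step \<delta> lam \<kappa>\<^sub>1 \<kappa>\<^sub>2 Z J T N j) + real k * h * (\<delta> * (\<kappa>\<^sub>2 + 2 * B + \<epsilon>))" if "k \<le> N" for k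
      using that
    proof (induction k)
      case 0 then show ?case by (simp add: Z0)
    next
      case (Suc k)
      then show ?case using step[of k] by (simp add: algebra_simps)
    qed
    show ?case
    proof (intro allI impI)
      fix k assume k: "k \<le> N"
      have "real k * h \<le> T" using tI[OF k] by (simp add: h_def)
      then have "real k * h * (\<delta> * (\<kappa>\<^sub>2 + 2 * B + \<epsilon>)) \<le> T * (\<delta> * (\<kappa>\<^sub>2 + 2 * B + \<epsilon>))"
        using nn \<epsilon> by (intro mult_right_mono) auto
      then show "energy_weight \<delta> lam T N k * (norm (Z (real k * T / N)))\<^sup>2
       \<le> (\<Sum>j<k. energy_step \<delta> lam \<kappa>\<^sub>1 \<kappa>\<^sub>2 Z J T N j) + T * (\<delta> * (\<kappa>\<^sub>2 + 2 * B + \<epsilon>))"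
        using ind[OF k] by linarith
    qed
  qed
qed

section \<open>Exponential moments of step integrals\<close>

text \<open>The norm of a vector of rows is the Frobenius norm, and the trace adds up the squared
  norms of the rows.\<close>

lemma hs_norm_eq_norm: "hs_norm a = norm (a :: real^'n^'d)"
  unfolding hs_norm_def norm_vec_def[of a] L2_set_def
  by (simp add: trace_def matrix_matrix_mult_def transpose_def power2_norm_eq_inner inner_vec_def)

lemma norm_matrix_vector_mult_le: "norm (a *v v) \<le> norm (a :: real^'n^'d) * norm v"
proof -
  have "norm (a *v v) = L2_set (\<lambda>i. norm ((a *v v) $ i)) UNIV" by (rule norm_vec_def)
  also have "\<dots> \<le> L2_set (\<lambda>i. norm (a $ i) * norm v) UNIV"
  proof (rule L2_set_mono)
    fix i
    have "(a *v v) $ i = a $ i \<bullet> v" by (simp add: matrix_vector_mult_def inner_vec_def)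
    then show "norm ((a *v v) $ i) \<le> norm (a $ i) * norm v" by (simp add: Cauchy_Schwarz_ineq2)
  qed simp
  also have "\<dots> = norm a * norm v" by (simp add: norm_vec_def[of a] L2_set_left_distrib)
  finally show ?thesis .
qed

lemma norm_vector_matrix_mult_le: "norm (v v* a) \<le> norm (a :: real^'n^'d) * norm v"
proof -
  define w where "w = v v* a"
  have "norm w * norm w = w \<bullet> w" by (simp add: norm_eq_sqrt_inner)
  also have "\<dots> = v \<bullet> (a *v w)" unfolding w_def by (rule dot_lmul_matrix)
  also have "\<dots> \<le> norm v * norm (a *v w)" by (rule norm_cauchy_schwarz)
  also have "\<dots> \<le> norm v * (norm a * norm w)" by (intro mult_left_mono norm_matrix_vector_mult_le) simp
  finally have "norm w * norm w \<le> (norm a * norm v) * norm w" by (simp add: ac_simps)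
  then have "norm w \<le> norm a * norm v"
    by (cases "norm w = 0") (auto simp: mult_le_cancel_right)
  then show ?thesis by (simp add: w_def)
qed

lemma borel_measurable_matrix_vector_mult [measurable (raw)]:
  fixes a :: "'w \<Rightarrow> real^'n^'d"
  assumes "a \<in> borel_measurable M" "v \<in> borel_measurable M"
  shows "(\<lambda>w. a w *v v w) \<in> borel_measurable M"
  by (rule borel_measurable_continuous_Pair[OF assms])
    (auto simp: matrix_vector_mult_def intro!: continuous_intros continuous_on_vec_lambda)

lemma borel_measurable_vector_matrix_mult [measurable (raw)]:
  fixes a :: "'w \<Rightarrow> real^'n^'d"
  assumes "v \<in> borel_measurable M" "a \<in> borel_measurable M"
  shows "(\<lambda>w. v w v* a w) \<in> borel_measurable M"
  by (rule borel_measurable_continuous_Pair[OF assms])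
    (auto simp: vector_matrix_mult_def intro!: continuous_intros continuous_on_vec_lambda)

text \<open>Completing the square: the tilted density is, up to the constant, the density shifted to
  mean a s^2.\<close>

lemma gaussian_mgf:
  assumes "s > 0"
  shows "(\<integral>\<^sup>+x. ennreal (exp (a * x) * normal_density 0 s x) \<partial>lborel) = ennreal (exp (a\<^sup>2 * s\<^sup>2 / 2))"
proof -
  have "exp (a * x) * normal_density 0 s x = exp (a\<^sup>2 * s\<^sup>2 / 2) * normal_density (a * s\<^sup>2) s x" for x
  proof -
    have "a * x + - (x - 0)\<^sup>2 / (2 * s\<^sup>2) = a\<^sup>2 * s\<^sup>2 / 2 + - (x - a * s\<^sup>2)\<^sup>2 / (2 * s\<^sup>2)"
      using assms by (simp add: field_simps power2_eq_square)
    then show ?thesis unfolding normal_density_def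
      by (simp add: exp_add[symmetric] mult.left_commute)
  qed
  then have "(\<integral>\<^sup>+x. ennreal (exp (a * x) * normal_density 0 s x) \<partial>lborel)
     = (\<integral>\<^sup>+x. ennreal (exp (a\<^sup>2 * s\<^sup>2 / 2)) * ennreal (normal_density (a * s\<^sup>2) s x) \<partial>lborel)"
    by (simp add: ennreal_mult normal_density_nonneg)
  also have "\<dots> = ennreal (exp (a\<^sup>2 * s\<^sup>2 / 2)) * (\<integral>\<^sup>+x. ennreal (normal_density (a * s\<^sup>2) s x) \<partial>lborel)"
    by (rule nn_integral_cmult) simp
  also have "(\<integral>\<^sup>+x. ennreal (normal_density (a * s\<^sup>2) s x) \<partial>lborel) = 1"
    using prob_space.emeasure_space_1[OF prob_space_normal_density[OF assms, of "a * s\<^sup>2"]] assms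
    by (simp add: emeasure_density)
  finally show ?thesis by simp
qed

lemma gaussian_vector_mgf:
  fixes a :: "real^'n"
  assumes s: "s > 0"
  shows "(\<integral>\<^sup>+x. ennreal (exp (a \<bullet> x)) * ennreal (\<Prod>i\<in>UNIV. normal_density 0 s (x $ i)) \<partial>lborel)
    = ennreal (exp (s\<^sup>2 / 2 * (norm a)\<^sup>2))"
proof -
  have B: "(\<Prod>b\<in>Basis. g b) = (\<Prod>i\<in>UNIV. g (axis i 1))" for g :: "real^'n \<Rightarrow> ennreal"
  proof -
    have BE: "Basis = range (\<lambda>i. axis i (1::real) :: real^'n)" by (auto simp: Basis_vec_def)
    have "inj (\<lambda>i. axis i (1::real) :: real^'n)" by (auto simp: inj_def axis_eq_axis)
    then show ?thesis unfolding BE by (subst prod.reindex) (simp_all only: o_def)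
  qed
  define f where "f = (\<lambda>(b::real^'n) (t::real). ennreal (exp ((a \<bullet> b) * t) * normal_density 0 s t))"
  have "(\<integral>\<^sup>+x. ennreal (exp (a \<bullet> x)) * ennreal (\<Prod>i\<in>UNIV. normal_density 0 s (x $ i)) \<partial>lborel)
     = (\<integral>\<^sup>+x. (\<Prod>b\<in>Basis. f b (x \<bullet> b)) \<partial>lborel)"
  proof (rule nn_integral_cong)
    fix x :: "real^'n"
    have "exp (a \<bullet> x) = (\<Prod>i\<in>UNIV. exp (a $ i * x $ i))"
      by (simp add: inner_vec_def exp_sum)
    then have "ennreal (exp (a \<bullet> x)) * ennreal (\<Prod>i\<in>UNIV. normal_density 0 s (x $ i))
      = ennreal (\<Prod>i\<in>UNIV. exp (a $ i * x $ i) * normal_density 0 s (x $ i))"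
      by (simp add: prod.distrib ennreal_mult prod_nonneg normal_density_nonneg)
    also have "\<dots> = (\<Prod>i\<in>UNIV. ennreal (exp (a $ i * x $ i) * normal_density 0 s (x $ i)))"
      by (rule prod_ennreal[symmetric]) (simp add: normal_density_nonneg)
    also have "\<dots> = (\<Prod>b\<in>Basis. f b (x \<bullet> b))" unfolding B f_def by (simp add: inner_axis)
    finally show "ennreal (exp (a \<bullet> x)) * ennreal (\<Prod>i\<in>UNIV. normal_density 0 s (x $ i))
      = (\<Prod>b\<in>Basis. f b (x \<bullet> b))" .
  qed
  also have "\<dots> = (\<Prod>b\<in>Basis. (\<integral>\<^sup>+t. f b t \<partial>lborel))"
    by (rule nn_integral_lborel_prod) (simp_all add: f_def)
  also have "\<dots> = (\<Prod>b\<in>Basis. ennreal (exp ((a \<bullet> b)\<^sup>2 * s\<^sup>2 / 2)))"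
    unfolding f_def by (simp only: gaussian_mgf[OF s])
  also have "\<dots> = ennreal (\<Prod>i\<in>UNIV. exp ((a $ i)\<^sup>2 * s\<^sup>2 / 2))"
    unfolding B by (subst prod_ennreal) (simp_all add: inner_axis)
  also have "(\<Prod>i\<in>UNIV. exp ((a $ i)\<^sup>2 * s\<^sup>2 / 2)) = exp (\<Sum>i\<in>UNIV. (a $ i)\<^sup>2 * s\<^sup>2 / 2)"
    by (simp add: exp_sum)
  also have "(\<Sum>i\<in>UNIV. (a $ i)\<^sup>2 * s\<^sup>2 / 2) = s\<^sup>2 / 2 * (norm a)\<^sup>2"
    unfolding power2_norm_eq_inner inner_vec_def sum_distrib_left
    by (intro sum.cong) (simp_all add: power2_eq_square)
  finally show ?thesis .
qed

lemma brownian_motionD: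
  assumes "brownian_motion M F W"
  shows "prob_space M" "\<And>t. subalgebra M (F t)" "\<And>s t. s \<le> t \<Longrightarrow> subalgebra (F t) (F s)"
    "\<And>t. t \<ge> 0 \<Longrightarrow> W t \<in> borel_measurable (F t)"
proof -
  have f: "filtration (space M) F" and sub: "\<And>t. subalgebra M (F t)"
    using assms unfolding brownian_motion_def by auto
  show "prob_space M" "\<And>t. subalgebra M (F t)" "\<And>t. t \<ge> 0 \<Longrightarrow> W t \<in> borel_measurable (F t)"
    using assms unfolding brownian_motion_def by auto
  show "subalgebra (F t) (F s)" if "s \<le> t" for s t
    using filtration.sets_F_mono[OF f that] filtration.space_F[OF f] by (auto simp: subalgebra_def)
qed

text \<open>Since the increment is independent of \<open>F s\<close>, one integrates over it first, with
  \<open>\<phi>\<close> and \<open>Y\<close> frozen.\<close>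
lemma brownian_increment_exp:
  fixes W :: "real \<Rightarrow> 'w \<Rightarrow> real^'n"
  assumes bm: "brownian_motion M F W" and st: "0 \<le> s" "s < t"
    and Y: "Y \<in> borel_measurable (F s)" and \<phi>: "\<phi> \<in> borel_measurable (F s)"
  shows "(\<integral>\<^sup>+w. ennreal (Y w * exp (\<phi> w \<bullet> (W t w - W s w) - (t - s) / 2 * (norm (\<phi> w))\<^sup>2)) \<partial>M)
     = (\<integral>\<^sup>+w. ennreal (Y w) \<partial>M)"
proof -
  let ?n = "\<lambda>z. \<Prod>i\<in>UNIV. normal_density 0 (sqrt (t - s)) (z $ i)"
  let ?y = "\<lambda>w z. Y w * exp (\<phi> w \<bullet> z - (t - s) / 2 * (norm (\<phi> w))\<^sup>2)"
  let ?Fs = "distr M (F s) (\<lambda>w. w)"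
  interpret prob_space M by (rule brownian_motionD[OF bm])
  note sub = brownian_motionD(2)[OF bm]
  define D where "D = (\<lambda>w. W t w - W s w)"
  have dist: "distributed M lborel D (\<lambda>x. ennreal (?n x))"
    and ind: "indep_set (sets (F s)) (sets (vimage_algebra (space M) D borel))"
    using bm st unfolding brownian_motion_def D_def by auto
  have [measurable]: "D \<in> borel_measurable M"
    using dist by (auto simp: distributed_def)
  have idm: "(\<lambda>w. w) \<in> M \<rightarrow>\<^sub>M F s"
    using sub[of s] by (auto simp: subalgebra_def measurable_def)
  have spF: "space (F s) = space M" using sub[of s] by (simp add: subalgebra_def)
  \<comment> \<open>Independence of \<open>D\<close> from a \<sigma>-algebra becomes a product law
    once the identity is read as a random element with values in F s.\<close>
  have J: "distr M (F s) (\<lambda>w. w) \<Otimes>\<^sub>M distr M borel D = distr M (F s \<Otimes>\<^sub>M borel) (\<lambda>w. (w, D w))"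
  proof (rule pair_measure_eqI)
    show "sigma_finite_measure ?Fs" "sigma_finite_measure (distr M borel D)"
      using idm by (auto intro!: prob_space_imp_sigma_finite prob_space_distr)
    fix A B assume "A \<in> sets ?Fs" "B \<in> sets (distr M borel D)"
    then have A: "A \<in> sets (F s)" and B[measurable]: "B \<in> sets borel" by auto
    have AM: "A \<in> sets M" using A sub[of s] by (auto simp: subalgebra_def)
    have "D -` B \<inter> space M \<in> sets (vimage_algebra (space M) D borel)" using B by (rule in_vimage_algebra)
    from indep_setD[OF ind A this] have p: "prob (A \<inter> (D -` B \<inter> space M)) = prob A * prob (D -` B \<inter> space M)" .
    have "(\<lambda>w. w) -` A \<inter> space M = A" using sets.sets_into_space[OF AM] by auto
    moreover have "(\<lambda>w. (w, D w)) -` (A \<times> B) \<inter> space M = A \<inter> (D -` B \<inter> space M)"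
      using sets.sets_into_space[OF AM] by auto
    ultimately show "emeasure ?Fs A * emeasure (distr M borel D) B
      = emeasure (distr M (F s \<Otimes>\<^sub>M borel) (\<lambda>w. (w, D w))) (A \<times> B)"
      using A p idm by (simp add: emeasure_distr emeasure_eq_measure ennreal_mult)
  qed simp
  define g where "g = (\<lambda>z. ennreal (Y (fst z) * exp (\<phi> (fst z) \<bullet> snd z - (t - s) / 2 * (norm (\<phi> (fst z)))\<^sup>2)))"
  have g[measurable]: "g \<in> borel_measurable (F s \<Otimes>\<^sub>M borel)"
    using Y \<phi> unfolding g_def by measurable
  interpret D: prob_space "distr M borel D" by (rule prob_space_distr) measurable
  have "(\<integral>\<^sup>+w. g (w, D w) \<partial>M) = (\<integral>\<^sup>+z. g z \<partial>distr M (F s \<Otimes>\<^sub>M borel) (\<lambda>w. (w, D w)))"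
    using idm by (subst nn_integral_distr) auto
  also have "\<dots> = (\<integral>\<^sup>+w. \<integral>\<^sup>+z. g (w, z) \<partial>distr M borel D \<partial>distr M (F s) (\<lambda>w. w))"
    unfolding J[symmetric] by (subst D.nn_integral_fst[symmetric]) (simp_all cong: measurable_cong_sets)
  also have "\<dots> = (\<integral>\<^sup>+w. ennreal (Y w) \<partial>distr M (F s) (\<lambda>w. w))"
  proof (rule nn_integral_cong)
    fix w assume "w \<in> space ?Fs"
    then have w: "w \<in> space (F s)" by simp
    \<comment> \<open>\<open>c\<close> is the reciprocal of the Gaussian exponential moment at
      \<phi> w, so the compensated exponential has mean exactly 1.\<close>
    define c where "c = exp (- ((t - s) / 2 * (norm (\<phi> w))\<^sup>2))"
    have DD: "distr M borel D = density lborel (\<lambda>x. ennreal (?n x))"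
      using dist by (simp add: distributed_def cong: distr_cong)
    have "(\<integral>\<^sup>+z. g (w, z) \<partial>distr M borel D)
      = (\<integral>\<^sup>+z. ennreal (?n z) * (ennreal (?y w z)) \<partial>lborel)"
      unfolding DD g_def by (subst nn_integral_density) auto
    also have "\<dots> = (\<integral>\<^sup>+z. (ennreal (Y w) * ennreal c) * (ennreal (exp (\<phi> w \<bullet> z)) * ennreal (?n z)) \<partial>lborel)"
    proof (rule nn_integral_cong)
      fix z
      have "exp (\<phi> w \<bullet> z - (t - s) / 2 * (norm (\<phi> w))\<^sup>2) = c * exp (\<phi> w \<bullet> z)"
        unfolding c_def mult_exp_exp by simp
      then have "ennreal (?y w z)
          = ennreal (Y w) * (ennreal c * ennreal (exp (\<phi> w \<bullet> z)))"
        by (simp add: ennreal_mult'' c_def)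
      then show "ennreal (?n z) * ennreal (?y w z)
        = (ennreal (Y w) * ennreal c) * (ennreal (exp (\<phi> w \<bullet> z)) * ennreal (?n z))"
        by (simp only: ac_simps)
    qed
    also have "\<dots> = (ennreal (Y w) * ennreal c) * ennreal (exp ((sqrt (t - s))\<^sup>2 / 2 * (norm (\<phi> w))\<^sup>2))"
      using st by (subst nn_integral_cmult) (simp_all add: gaussian_vector_mgf)
    also have "\<dots> = ennreal (Y w) * ennreal (c * exp ((t - s) / 2 * (norm (\<phi> w))\<^sup>2))"
      using st by (simp add: c_def ennreal_mult mult.assoc)
    also have "c * exp ((t - s) / 2 * (norm (\<phi> w))\<^sup>2) = 1" by (simp add: c_def exp_minus)
    finally show "(\<integral>\<^sup>+z. g (w, z) \<partial>distr M borel D) = ennreal (Y w)" by simp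
  qed
  also have "\<dots> = (\<integral>\<^sup>+w. ennreal (Y w) \<partial>M)"
    using Y idm by (subst nn_integral_distr) auto
  finally show ?thesis by (simp add: g_def D_def)
qed

text \<open>On a cell (u i, u (i + 1)] the value is read off at the right end but known at the left
  end. The process is a function of time that is separate from the grid, so two elementary processes
  can share a common refinement.\<close>

definition step_process ::
  "(real \<Rightarrow> 'w measure) \<Rightarrow> (nat \<Rightarrow> real) \<Rightarrow> nat \<Rightarrow> (real \<Rightarrow> 'w \<Rightarrow> real^'n^'d) \<Rightarrow> bool" where
  "step_process F u N e \<longleftrightarrow> 0 \<le> u 0 \<and> (\<forall>i<N. u i < u (Suc i)) \<and>
     (\<forall>i<N. e (u (Suc i)) \<in> borel_measurable (F (u i))) \<and>
     (\<forall>i<N. \<forall>r\<in>{u i<..u (Suc i)}. e r = e (u (Suc i)))"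

definition step_integral ::
  "(real \<Rightarrow> 'w \<Rightarrow> real^'n) \<Rightarrow> (nat \<Rightarrow> real) \<Rightarrow> nat \<Rightarrow> (real \<Rightarrow> 'w \<Rightarrow> real^'n^'d) \<Rightarrow> 'w \<Rightarrow> real^'d" where
  "step_integral W u N e w = (\<Sum>i<N. e (u (Suc i)) w *v (W (u (Suc i)) w - W (u i) w))"

definition step_energy :: "(nat \<Rightarrow> real) \<Rightarrow> nat \<Rightarrow> (real \<Rightarrow> 'w \<Rightarrow> real^'n^'d) \<Rightarrow> 'w \<Rightarrow> real" where
  "step_energy u N e w = (\<Sum>i<N. (u (Suc i) - u i) * (norm (e (u (Suc i)) w))\<^sup>2)"

lemma step_process_grid:
  assumes "step_process F u N e" "i \<le> j" "j \<le> N"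
  shows "0 \<le> u i" "u i \<le> u j" "i < j \<Longrightarrow> u i < u j"
proof -
  have *: "u i < u j" if "i < j" "j \<le> N" for i j
    using that
  proof (induction j)
    case (Suc j)
    have "u j < u (Suc j)" using assms(1) Suc.prems by (auto simp: step_process_def)
    then show ?case using Suc by (cases "i = j") auto
  qed simp
  show "i < j \<Longrightarrow> u i < u j" using * assms by blast
  show "u i \<le> u j" using *[of i j] assms by (cases "i = j") auto
  have "u 0 \<le> u i" using *[of 0 i] assms by (cases "i = 0") auto
  then show "0 \<le> u i" using assms by (auto simp: step_process_def)
qed

lemma step_process_measurable:
  assumes bm: "brownian_motion M F W" and e: "step_process F u N e" and k: "k \<le> N"
  shows "step_integral W u k e \<in> borel_measurable (F (u k))" "step_energy u k e \<in> borel_measurable (F (u k))"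
proof -
  have 1: "e (u (Suc i)) \<in> borel_measurable (F (u k))" if "i < k" for i
  proof -
    have "e (u (Suc i)) \<in> borel_measurable (F (u i))" using e that k by (auto simp: step_process_def)
    moreover have "u i \<le> u k" using that k by (intro step_process_grid[OF e]) auto
    ultimately show ?thesis using measurable_from_subalg brownian_motionD(3)[OF bm] by blast
  qed
  have 2: "W (u i) \<in> borel_measurable (F (u k))" if "i \<le> k" for i
  proof -
    have "u i \<le> u k" "0 \<le> u i" using that k by (auto intro: step_process_grid[OF e])
    then show ?thesis using measurable_from_subalg brownian_motionD(3,4)[OF bm] by blast
  qed
  show "step_integral W u k e \<in> borel_measurable (F (u k))" unfolding step_integral_def[abs_def]
    using 1 2 by (intro borel_measurable_sum borel_measurable_matrix_vector_mult borel_measurable_diff) auto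
  show "step_energy u k e \<in> borel_measurable (F (u k))" unfolding step_energy_def[abs_def]
    using 1 by (intro borel_measurable_sum borel_measurable_times borel_measurable_power borel_measurable_norm) auto
qed

text \<open>An exponential supermartingale: the induction peels off the last increment, and all that
  precedes it is the weight in \<open>brownian_increment_exp\<close>. Equality is lost because the
  row vector formed from \<theta> and e is estimated by the product of their norms. The weight Y
  makes the bound conditional on F (u 0).\<close>

lemma step_integral_exp:
  fixes W :: "real \<Rightarrow> 'w \<Rightarrow> real^'n" and e :: "real \<Rightarrow> 'w \<Rightarrow> real^'n^'d"
  assumes bm: "brownian_motion M F W" and e: "step_process F u N e"
    and Y: "Y \<in> borel_measurable (F (u 0))" and Y0: "\<And>w. 0 \<le> Y w" and \<theta>: "\<theta> \<in> borel_measurable (F (u 0))"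
  shows "(\<integral>\<^sup>+w. ennreal (Y w * exp (\<theta> w \<bullet> step_integral W u N e w - (norm (\<theta> w))\<^sup>2 / 2 * step_energy u N e w)) \<partial>M)
     \<le> (\<integral>\<^sup>+w. ennreal (Y w) \<partial>M)"
proof -
  let ?X = "\<lambda>k w. \<theta> w \<bullet> step_integral W u k e w - (norm (\<theta> w))\<^sup>2 / 2 * step_energy u k e w"
  let ?d = "\<lambda>k w. W (u (Suc k)) w - W (u k) w"
  let ?I = "\<integral>\<^sup>+w. ennreal (Y w) \<partial>M"
  have "(\<integral>\<^sup>+w. ennreal (Y w * exp (?X k w)) \<partial>M)
     \<le> ?I" if "k \<le> N" for k
    using that
  proof (induction k)
    case 0
    then show ?case by (simp add: step_integral_def step_energy_def)
  next
    case (Suc k)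
    define d where "d = u (Suc k) - u k"
    have uk: "0 \<le> u k" "u k < u (Suc k)" "u 0 \<le> u k" using Suc.prems by (auto intro!: step_process_grid[OF e])
    define \<phi> where "\<phi> = (\<lambda>w. \<theta> w v* e (u (Suc k)) w)"
    define Z where "Z = (\<lambda>w. Y w * exp (?X k w))"
    have [measurable]: "step_integral W u k e \<in> borel_measurable (F (u k))" "step_energy u k e \<in> borel_measurable (F (u k))"
      using Suc.prems by (auto intro!: step_process_measurable[OF bm e])
    have [measurable]: "\<theta> \<in> borel_measurable (F (u k))" "Y \<in> borel_measurable (F (u k))"
      using \<theta> Y uk measurable_from_subalg brownian_motionD(3)[OF bm] by blast+
    have [measurable]: "e (u (Suc k)) \<in> borel_measurable (F (u k))" using e Suc.prems by (auto simp: step_process_def)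
    have "\<phi> \<in> borel_measurable (F (u k))" "Z \<in> borel_measurable (F (u k))"
      unfolding \<phi>_def Z_def by measurable
    note * = brownian_increment_exp[OF bm uk(1,2) this(2,1)]
    have "(\<integral>\<^sup>+w. ennreal (Y w * exp (?X (Suc k) w)) \<partial>M)
      \<le> (\<integral>\<^sup>+w. ennreal (Z w * exp (\<phi> w \<bullet> ?d k w - d / 2 * (norm (\<phi> w))\<^sup>2)) \<partial>M)"
    proof (intro nn_integral_mono ennreal_leI)
      fix w
      have "(norm (\<phi> w))\<^sup>2 \<le> (norm (e (u (Suc k)) w) * norm (\<theta> w))\<^sup>2"
        unfolding \<phi>_def by (intro power_mono norm_vector_matrix_mult_le) simp
      then have "d / 2 * (norm (\<phi> w))\<^sup>2 \<le> d / 2 * ((norm (e (u (Suc k)) w))\<^sup>2 * (norm (\<theta> w))\<^sup>2)"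
        using uk by (intro mult_left_mono) (auto simp: d_def power_mult_distrib)
      moreover have "\<phi> w \<bullet> ?d k w = \<theta> w \<bullet> (e (u (Suc k)) w *v ?d k w)"
        unfolding \<phi>_def by (rule dot_lmul_matrix)
      moreover have "step_integral W u (Suc k) e w
          = step_integral W u k e w + e (u (Suc k)) w *v ?d k w"
        by (simp add: step_integral_def)
      moreover have "step_energy u (Suc k) e w = step_energy u k e w + d * (norm (e (u (Suc k)) w))\<^sup>2"
        by (simp add: step_energy_def d_def)
      ultimately have "?X (Suc k) w
         \<le> (?X k w)
           + (\<phi> w \<bullet> ?d k w - d / 2 * (norm (\<phi> w))\<^sup>2)"
        by (simp add: inner_add_right distrib_left mult_ac)
      then have "Y w * exp (?X (Suc k) w)
        \<le> Y w * exp ((?X k w)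
           + (\<phi> w \<bullet> ?d k w - d / 2 * (norm (\<phi> w))\<^sup>2))"
        using Y0 by (intro mult_left_mono) auto
      then show "Y w * exp (?X (Suc k) w)
        \<le> Z w * exp (\<phi> w \<bullet> ?d k w - d / 2 * (norm (\<phi> w))\<^sup>2)"
        unfolding Z_def exp_add by (simp add: mult.assoc)
    qed
    also have "\<dots> = (\<integral>\<^sup>+w. ennreal (Z w) \<partial>M)" using * by (simp add: d_def)
    also have "\<dots> \<le> ?I" using Suc by (simp add: Z_def)
    finally show ?case .
  qed
  then show ?thesis by simp
qed

lemma step_process_diff:
  assumes "step_process F u N e" "step_process F u N e'"
  shows "step_process F u N (\<lambda>r w. e r w - e' r w)"
  unfolding step_process_def
proof (intro conjI allI impI ballI)
  fix i assume i: "i < N"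
  then have "e (u (Suc i)) \<in> borel_measurable (F (u i))" "e' (u (Suc i)) \<in> borel_measurable (F (u i))"
    using assms unfolding step_process_def by blast+
  then show "(\<lambda>w. e (u (Suc i)) w - e' (u (Suc i)) w) \<in> borel_measurable (F (u i))"
    by (rule borel_measurable_diff)
  fix r assume "r \<in> {u i<..u (Suc i)}"
  then have "e r = e (u (Suc i))" "e' r = e' (u (Suc i))"
    using assms i unfolding step_process_def by blast+
  then show "(\<lambda>w. e r w - e' r w) = (\<lambda>w. e (u (Suc i)) w - e' (u (Suc i)) w)" by simp
qed (use assms(1) in \<open>simp_all add: step_process_def\<close>)

lemma sum_matrix_vector_mult: "(\<Sum>k\<in>K. A k) *v x = (\<Sum>k\<in>K. A k *v (x :: real^'n))"
  by (induction K rule: infinite_finite_induct) (auto simp: matrix_vector_mult_add_rdistrib)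

lemma step_integral_diff:
  "step_integral W u N (\<lambda>r w. e r w - e' r w) w = step_integral W u N e w - step_integral W u N e' w"
  unfolding step_integral_def by (simp add: matrix_vector_mult_diff_rdistrib sum_subtractf)

text \<open>The integral form is what allows comparison with the energy of other integrands. Outside
  the cells nothing is known about e as a function of time, so the induction carries the
  measurability of the truncated integrand along.\<close>

lemma step_energy_eq_nn_integral:
  assumes e: "step_process F u N e"
  shows "ennreal (step_energy u N e w) = (\<integral>\<^sup>+r\<in>{u 0..u N}. ennreal ((norm (e r w))\<^sup>2) \<partial>lborel)"
proof -
  have "ennreal (step_energy u k e w) = (\<integral>\<^sup>+r\<in>{u 0<..u k}. ennreal ((norm (e r w))\<^sup>2) \<partial>lborel)
      \<and> (\<lambda>r. ennreal ((norm (e r w))\<^sup>2) * indicator {u 0<..u k} r) \<in> borel_measurable lborel" if "k \<le> N" for k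
    using that
  proof (induction k)
    case 0 then show ?case by (simp add: step_energy_def)
  next
    case (Suc k)
    have uk: "u 0 \<le> u k" "u k < u (Suc k)" using Suc.prems by (auto intro!: step_process_grid[OF e])
    define c where "c = ennreal ((norm (e (u (Suc k)) w))\<^sup>2)"
    have eq: "ennreal ((norm (e r w))\<^sup>2) * indicator {u k<..u (Suc k)} r = c * indicator {u k<..u (Suc k)} r" for r
    proof (cases "r \<in> {u k<..u (Suc k)}")
      case True
      then have "e r = e (u (Suc k))" using e Suc.prems unfolding step_process_def by auto
      then show ?thesis by (simp add: c_def)
    qed simp
    have split: "ennreal ((norm (e r w))\<^sup>2) * indicator {u 0<..u (Suc k)} r
      = ennreal ((norm (e r w))\<^sup>2) * indicator {u 0<..u k} r + c * indicator {u k<..u (Suc k)} r" for r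
      unfolding eq[symmetric] using uk by (auto simp: indicator_def)
    have "(\<integral>\<^sup>+r\<in>{u 0<..u (Suc k)}. ennreal ((norm (e r w))\<^sup>2) \<partial>lborel)
      = (\<integral>\<^sup>+r\<in>{u 0<..u k}. ennreal ((norm (e r w))\<^sup>2) \<partial>lborel) + (\<integral>\<^sup>+r. c * indicator {u k<..u (Suc k)} r \<partial>lborel)"
      unfolding split using Suc by (intro nn_integral_add) auto
    also have "(\<integral>\<^sup>+r. c * indicator {u k<..u (Suc k)} r \<partial>lborel) = ennreal ((u (Suc k) - u k) * (norm (e (u (Suc k)) w))\<^sup>2)"
    proof -
      have "(\<integral>\<^sup>+r. c * indicator {u k<..u (Suc k)} r \<partial>lborel) = c * emeasure lborel {u k<..u (Suc k)}"
        by (rule nn_integral_cmult_indicator) simp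
      also have "emeasure lborel {u k<..u (Suc k)} = ennreal (u (Suc k) - u k)" using uk by simp
      finally show ?thesis using uk unfolding c_def by (simp add: ennreal_mult mult.commute)
    qed
    also have "(\<integral>\<^sup>+r\<in>{u 0<..u k}. ennreal ((norm (e r w))\<^sup>2) \<partial>lborel) = ennreal (step_energy u k e w)"
      using Suc by simp
    also have "\<dots> + ennreal ((u (Suc k) - u k) * (norm (e (u (Suc k)) w))\<^sup>2) = ennreal (step_energy u (Suc k) e w)"
    proof -
      have "0 \<le> step_energy u k e w" unfolding step_energy_def
        using e Suc.prems by (intro sum_nonneg mult_nonneg_nonneg) (auto simp: step_process_def less_imp_le)
      then show ?thesis using uk by (simp add: step_energy_def ennreal_plus)
    qed
    finally show ?case using Suc unfolding split by auto
  qed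
  from this[of N] have "ennreal (step_energy u N e w) = (\<integral>\<^sup>+r\<in>{u 0<..u N}. ennreal ((norm (e r w))\<^sup>2) \<partial>lborel)"
    by simp
  also have "\<dots> = (\<integral>\<^sup>+r\<in>{u 0..u N}. ennreal ((norm (e r w))\<^sup>2) \<partial>lborel)"
    by (rule nn_integral_cong_AE, rule AE_I[where N="{u 0}"]) (auto simp: indicator_def less_le)
  finally show ?thesis .
qed

section \<open>Elementary integrals on refined grids\<close>

abbreviation clamp_real :: "real \<Rightarrow> real \<Rightarrow> real \<Rightarrow> real" where
  "clamp_real s t x \<equiv> max s (min t x)"

lemma grid_mono:
  fixes u :: "nat \<Rightarrow> real"
  assumes "\<And>i. i < N \<Longrightarrow> u i < u (Suc i)" "i \<le> j" "j \<le> N"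
  shows "u i \<le> u j"
  using assms(2,3)
proof (induction j)
  case (Suc j)
  then show ?case using assms(1)[of j] by (cases "i = Suc j") auto
qed simp

lemma finite_set_grid:
  fixes P :: "real set"
  assumes "finite P" "P \<noteq> {}"
  obtains u N where "u ` {..N} = P" "\<And>i. i < N \<Longrightarrow> u i < u (Suc i)"
proof -
  define l where "l = sorted_list_of_set P"
  have l: "set l = P" "sorted_wrt (<) l" "l \<noteq> []"
    using assms unfolding l_def by auto
  show ?thesis
  proof (rule that[of "\<lambda>i. l ! i" "length l - 1"])
    show "(!) l ` {..length l - 1} = P"
      using l by (auto simp: set_conv_nth image_iff) (metis Suc_pred atMost_iff length_greater_0_conv less_Suc_eq_le nth_mem)+
    show "l ! i < l ! Suc i" if "i < length l - 1" for i
      using sorted_wrt_nth_less[OF l(2), of i "Suc i"] that by simp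
  qed
qed

text \<open>Since the grid contains all clamped partition points, each indicator of (\<tau> k,
  \<tau> (k + 1)] is constant on every cell. The increment of the elementary integral is then a
  double sum over k and cells, to be summed in the other order.\<close>

lemma elementary_on_grid:
  fixes W :: "real \<Rightarrow> 'w \<Rightarrow> real^'n" and \<xi> :: "nat \<Rightarrow> 'w \<Rightarrow> real^'n^'d"
  assumes bm: "brownian_motion M F W" and el: "elementary F m \<tau> \<xi>"
    and st: "0 \<le> s" "s \<le> t" and u: "\<And>i. i < N \<Longrightarrow> u i < u (Suc i)" "u 0 = s" "u N = t"
    and P: "\<And>k. k \<le> m \<Longrightarrow> clamp_real s t (\<tau> k) \<in> u ` {..N}"
  shows "step_process F u N (elementary_process m \<tau> \<xi>)" (is ?thesis1)
    and "elementary_integral W m \<tau> \<xi> t w - elementary_integral W m \<tau> \<xi> s w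
       = step_integral W u N (elementary_process m \<tau> \<xi>) w" (is ?thesis2)
proof -
  let ?c = "clamp_real s t"
  note ui = grid_mono[of N u, OF u(1)]
  have us: "s \<le> u i" "u i \<le> t" if "i \<le> N" for i
    using ui[of 0 i] ui[of i N] that u by auto
  have gap: "v \<le> u i" if "i < N" "v \<in> u ` {..N}" "v < u (Suc i)" for i v
  proof -
    obtain j where j: "j \<le> N" "v = u j" using \<open>v \<in> u ` {..N}\<close> by auto
    then have "\<not> Suc i \<le> j" using ui[of "Suc i" j] that by auto
    then show ?thesis using ui[of j i] j that by auto
  qed
  \<comment> \<open>Clamping to [s, t] does not change on which side of a point of a cell \<tau> k
    lies, and no cell has a clamped point in its interior.\<close>
  have lt: "\<tau> k < r \<longleftrightarrow> ?c (\<tau> k) \<le> u i" if "k \<le> m" "i < N" "r \<in> {u i<..u (Suc i)}" for k i r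
  proof
    assume "\<tau> k < r"
    then have "?c (\<tau> k) < u (Suc i)" using that us[of i] us[of "Suc i"] u(1)[of i] by auto
    then show "?c (\<tau> k) \<le> u i" using gap P that by blast
  next
    assume "?c (\<tau> k) \<le> u i"
    then show "\<tau> k < r" using that us[of i] us[of "Suc i"] u(1)[of i] by (auto simp: min_def max_def split: if_splits)
  qed
  have le: "r \<le> \<tau> k \<longleftrightarrow> u (Suc i) \<le> ?c (\<tau> k)" if "k \<le> m" "i < N" "r \<in> {u i<..u (Suc i)}" for k i r
  proof
    assume "r \<le> \<tau> k"
    then have "u i < ?c (\<tau> k)" using that us[of i] us[of "Suc i"] by auto
    then show "u (Suc i) \<le> ?c (\<tau> k)" using gap[of i "?c (\<tau> k)"] P that by force
  next
    assume "u (Suc i) \<le> ?c (\<tau> k)"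
    then show "r \<le> \<tau> k" using that us[of i] us[of "Suc i"] u(1)[of i] by (auto simp: min_def max_def split: if_splits)
  qed
  have ind: "indicator {\<tau> k<..\<tau> (Suc k)} r = (if ?c (\<tau> k) \<le> u i \<and> u (Suc i) \<le> ?c (\<tau> (Suc k)) then 1 else 0 :: real)"
    if "k < m" "i < N" "r \<in> {u i<..u (Suc i)}" for k i r
    using lt[of k i r] le[of "Suc k" i r] that by (auto simp: indicator_def)
  have in_cell: "u (Suc i) \<in> {u i<..u (Suc i)}" if "i < N" for i using u(1) that by auto
  show ?thesis1
    unfolding step_process_def
  proof (intro conjI allI impI ballI)
    show "0 \<le> u 0" using u st by simp
    show "u i < u (Suc i)" if "i < N" for i using u that by simp
    show "elementary_process m \<tau> \<xi> r = elementary_process m \<tau> \<xi> (u (Suc i))" if "i < N" "r \<in> {u i<..u (Suc i)}" for i r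
      unfolding elementary_process_def fun_eq_iff
      using ind[OF _ that] ind[OF _ that(1) in_cell[OF that(1)]] by (auto intro!: sum.cong)
    show "elementary_process m \<tau> \<xi> (u (Suc i)) \<in> borel_measurable (F (u i))" if i: "i < N" for i
      unfolding elementary_process_def[abs_def]
    proof (rule borel_measurable_sum)
      fix k assume "k \<in> {..<m}"
      then have k: "k < m" by simp
      show "(\<lambda>w. indicator {\<tau> k<..\<tau> (Suc k)} (u (Suc i)) *\<^sub>R \<xi> k w) \<in> borel_measurable (F (u i))"
      proof (cases "\<tau> k < u (Suc i)")
        case True
        then have "?c (\<tau> k) \<le> u i" using lt[of k i "u (Suc i)"] k i in_cell by auto
        moreover have "\<tau> k \<le> ?c (\<tau> k)" using True us[of "Suc i"] i by auto
        ultimately have "\<tau> k \<le> u i" using order_trans by blast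
        moreover have "\<xi> k \<in> borel_measurable (F (\<tau> k))" using el k by (auto simp: elementary_def)
        ultimately have "\<xi> k \<in> borel_measurable (F (u i))"
          using measurable_from_subalg brownian_motionD(3)[OF bm] by blast
        then show ?thesis by simp
      qed simp
    qed
  qed
  have tel: "(\<Sum>i<N. (if p \<le> u i \<and> u (Suc i) \<le> q then 1 else 0 :: real) *\<^sub>R (G (u (Suc i)) - G (u i))) = G q - G p"
    if pq: "p \<in> u ` {..N}" "q \<in> u ` {..N}" "p \<le> q" for p q and G :: "real \<Rightarrow> real^'n"
  proof -
    \<comment> \<open>Clamping the grid to [p, q] leaves the selected increments alone and
      annihilates the others, which makes the sum telescope.\<close>
    let ?d = "\<lambda>x. max p (min q x)"
    have "(if p \<le> u i \<and> u (Suc i) \<le> q then 1 else 0 :: real) *\<^sub>R (G (u (Suc i)) - G (u i))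
        = G (?d (u (Suc i))) - G (?d (u i))" if i: "i < N" for i
    proof -
      consider "p \<le> u i" "u (Suc i) \<le> q" | "u (Suc i) \<le> p" | "q \<le> u i"
        using gap[OF i pq(1)] gap[OF i pq(2)] by linarith
      then show ?thesis
      proof cases
        case 1
        then have "?d (u (Suc i)) = u (Suc i)" "?d (u i) = u i" using u(1)[OF i] by auto
        then show ?thesis using 1 by simp
      next
        case 2
        then have "?d (u (Suc i)) = p" "?d (u i) = p" using u(1)[OF i] by auto
        then show ?thesis using 2 u(1)[OF i] by simp
      next
        case 3
        then have "?d (u (Suc i)) = q" "?d (u i) = q" using u(1)[OF i] pq(3) by auto
        then show ?thesis using 3 u(1)[OF i] by simp
      qed
    qed
    then have "(\<Sum>i<N. (if p \<le> u i \<and> u (Suc i) \<le> q then 1 else 0 :: real) *\<^sub>R (G (u (Suc i)) - G (u i)))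
       = (\<Sum>i<N. G (?d (u (Suc i))) - G (?d (u i)))" by simp
    also have "\<dots> = G (?d (u N)) - G (?d (u 0))" by (rule sum_lessThan_telescope)
    also have "\<dots> = G q - G p"
    proof -
      have "q \<le> u N" "u 0 \<le> p" "p \<le> u N" "u 0 \<le> q" using pq(1,2) us u by auto
      then have "?d (u N) = q" "?d (u 0) = p" using pq(3) by auto
      then show ?thesis by simp
    qed
    finally show ?thesis .
  qed
  show ?thesis2
  proof -
    \<comment> \<open>Replacing the stopped values by clamped ones leaves an extra W s, which
      cancels between consecutive partition points.\<close>
    have W: "W (min t a) w - W (min s a) w = W (?c a) w - W s w" for a
      using st by (auto simp: min_def max_def)
    have "elementary_integral W m \<tau> \<xi> t w - elementary_integral W m \<tau> \<xi> s w
      = (\<Sum>k<m. \<xi> k w *v (W (?c (\<tau> (Suc k))) w - W (?c (\<tau> k)) w))"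
    proof -
      have "\<xi> k w *v (W (min t (\<tau> (Suc k))) w - W (min t (\<tau> k)) w) - \<xi> k w *v (W (min s (\<tau> (Suc k))) w - W (min s (\<tau> k)) w)
        = \<xi> k w *v ((W (min t (\<tau> (Suc k))) w - W (min s (\<tau> (Suc k))) w) - (W (min t (\<tau> k)) w - W (min s (\<tau> k)) w))" for k
        by (simp add: matrix_vector_mult_diff_distrib)
      then show ?thesis unfolding elementary_integral_def W by (simp add: sum_subtractf[symmetric])
    qed
    also have "\<dots> = (\<Sum>k<m. \<Sum>i<N. (indicator {\<tau> k<..\<tau> (Suc k)} (u (Suc i)) *\<^sub>R \<xi> k w) *v (W (u (Suc i)) w - W (u i) w))"
    proof (rule sum.cong[OF refl])
      fix k assume "k \<in> {..<m}"
      then have k: "k < m" by simp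
      have "?c (\<tau> k) \<le> ?c (\<tau> (Suc k))" using el k by (auto simp: elementary_def)
      then have "W (?c (\<tau> (Suc k))) w - W (?c (\<tau> k)) w = (\<Sum>i<N. indicator {\<tau> k<..\<tau> (Suc k)} (u (Suc i)) *\<^sub>R (W (u (Suc i)) w - W (u i) w))"
        using tel[of "?c (\<tau> k)" "?c (\<tau> (Suc k))" "\<lambda>r. W r w"] P[of k] P[of "Suc k"] k ind[OF k _ in_cell] by simp
      then show "\<xi> k w *v (W (?c (\<tau> (Suc k))) w - W (?c (\<tau> k)) w)
        = (\<Sum>i<N. (indicator {\<tau> k<..\<tau> (Suc k)} (u (Suc i)) *\<^sub>R \<xi> k w) *v (W (u (Suc i)) w - W (u i) w))"
        by (simp only: linear_sum[OF matrix_vector_mul_linear] matrix_vector_mult_scaleR scaleR_matrix_vector_assoc)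
    qed
    also have "\<dots> = (\<Sum>i<N. (\<Sum>k<m. indicator {\<tau> k<..\<tau> (Suc k)} (u (Suc i)) *\<^sub>R \<xi> k w) *v (W (u (Suc i)) w - W (u i) w))"
      by (subst sum.swap) (simp only: sum_matrix_vector_mult)
    finally show ?thesis unfolding step_integral_def elementary_process_def .
  qed
qed

section \<open>Exponential moments of the Ito integral\<close>

lemma null_in_probability_measurable: "null_in_probability M Z \<Longrightarrow> Z k \<in> borel_measurable M"
  by (simp add: null_in_probability_def)

lemma (in finite_measure) null_in_probability_le:
  assumes Z: "null_in_probability M Z" and Z': "\<And>k. Z' k \<in> borel_measurable M"
    and le: "\<And>k w. w \<in> space M \<Longrightarrow> Z' k w \<le> Z k w"
  shows "null_in_probability M Z'"
  unfolding null_in_probability_def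
proof (intro conjI allI impI Z')
  fix \<epsilon> :: real assume \<epsilon>: "\<epsilon> > 0"
  note [measurable] = Z' null_in_probability_measurable[OF Z]
  show "(\<lambda>k. measure M {w \<in> space M. ennreal \<epsilon> < Z' k w}) \<longlonglongrightarrow> 0"
  proof (rule tendsto_sandwich[OF _ _ tendsto_const])
    show "(\<lambda>k. measure M {w \<in> space M. ennreal \<epsilon> < Z k w}) \<longlonglongrightarrow> 0"
      using Z \<epsilon> by (simp add: null_in_probability_def)
    show "\<forall>\<^sub>F k in sequentially. measure M {w \<in> space M. ennreal \<epsilon> < Z' k w} \<le> measure M {w \<in> space M. ennreal \<epsilon> < Z k w}"
      using le by (intro always_eventually allI finite_measure_mono) (auto intro: less_le_trans)
  qed simp
qed

lemma (in finite_measure) null_in_probability_add: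
  assumes Z: "null_in_probability M Z" and Z': "null_in_probability M Z'"
  shows "null_in_probability M (\<lambda>k w. Z k w + Z' k w)"
  unfolding null_in_probability_def
proof (intro conjI allI impI)
  note [measurable] = null_in_probability_measurable[OF Z] null_in_probability_measurable[OF Z']
  show "(\<lambda>w. Z k w + Z' k w) \<in> borel_measurable M" for k by measurable
  fix \<epsilon> :: real assume \<epsilon>: "\<epsilon> > 0"
  let ?A = "\<lambda>Z k. {w \<in> space M. ennreal (\<epsilon> / 2) < Z k w}"
  let ?B = "\<lambda>k. {w \<in> space M. ennreal \<epsilon> < Z k w + Z' k w}"
  show "(\<lambda>k. measure M (?B k)) \<longlonglongrightarrow> 0"
  proof (rule tendsto_sandwich[OF _ _ tendsto_const])
    have "(\<lambda>k. measure M (?A Z k) + measure M (?A Z' k)) \<longlonglongrightarrow> 0 + 0"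
      using Z Z' \<epsilon> unfolding null_in_probability_def by (intro tendsto_add) auto
    then show "(\<lambda>k. measure M (?A Z k) + measure M (?A Z' k)) \<longlonglongrightarrow> 0" by simp
    have "measure M (?B k) \<le> measure M (?A Z k) + measure M (?A Z' k)" for k
    proof -
      have "?B k \<subseteq> ?A Z k \<union> ?A Z' k"
      proof (rule subsetI, rule ccontr)
        fix w assume "w \<in> ?B k" "w \<notin> ?A Z k \<union> ?A Z' k"
        then have w: "ennreal \<epsilon> < Z k w + Z' k w" "Z k w \<le> ennreal (\<epsilon> / 2)" "Z' k w \<le> ennreal (\<epsilon> / 2)"
          by (auto simp: not_less)
        have "Z k w + Z' k w \<le> ennreal (\<epsilon> / 2) + ennreal (\<epsilon> / 2)" using w(2,3) by (rule add_mono)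
        also have "\<dots> = ennreal \<epsilon>" using \<epsilon> by (simp flip: ennreal_plus)
        finally show False using w(1) by simp
      qed
      then have "measure M (?B k) \<le> measure M (?A Z k \<union> ?A Z' k)"
        by (intro finite_measure_mono) auto
      also have "\<dots> \<le> measure M (?A Z k) + measure M (?A Z' k)" by (rule measure_Un_le) auto
      finally show ?thesis .
    qed
    then show "\<forall>\<^sub>F k in sequentially. measure M (?B k) \<le> measure M (?A Z k) + measure M (?A Z' k)"
      by (intro always_eventually allI)
  qed simp
qed

text \<open>The truncations at 1 tend to 0 in L1, and an L1 null sequence has an almost surely
  convergent subsequence. A truncated value below 1 is the value itself, so the truncation can be
  undone in the limit.\<close>

lemma (in prob_space) null_in_probability_AE_subseq:
  assumes Z: "null_in_probability M Z"
  obtains r where "strict_mono r" "AE w in M. (\<lambda>k. Z (r k) w) \<longlonglongrightarrow> 0"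
proof -
  note [measurable] = null_in_probability_measurable[OF Z]
  define u where "u = (\<lambda>k w. enn2real (min 1 (Z k w)))"
  have [measurable]: "u k \<in> borel_measurable M" for k unfolding u_def by measurable
  have u01: "0 \<le> u k w" "u k w \<le> 1" for k w
  proof -
    have "enn2real (min 1 (Z k w)) \<le> enn2real 1" by (intro enn2real_mono) auto
    then show "u k w \<le> 1" by (simp add: u_def)
  qed (simp add: u_def)
  have iu: "integrable M (u k)" for k
    using u01 by (intro integrable_const_bound[where B=1]) auto
  have "(\<lambda>k. \<integral>w. norm (u k w) \<partial>M) \<longlonglongrightarrow> 0"
  proof (rule LIMSEQ_I)
    fix \<epsilon> :: real assume \<epsilon>: "\<epsilon> > 0"
    have "(\<lambda>k. prob {w \<in> space M. ennreal (\<epsilon> / 3) < Z k w}) \<longlonglongrightarrow> 0"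
      using Z \<epsilon> by (simp add: null_in_probability_def)
    from LIMSEQ_D[OF this, of "\<epsilon> / 3"] \<epsilon> obtain K where
      K: "\<And>k. k \<ge> K \<Longrightarrow> prob {w \<in> space M. ennreal (\<epsilon> / 3) < Z k w} < \<epsilon> / 3" by auto
    have "norm ((\<integral>w. norm (u k w) \<partial>M) - 0) < \<epsilon>" if "k \<ge> K" for k
    proof -
      let ?B = "{w \<in> space M. ennreal (\<epsilon> / 3) < Z k w}"
      have "(\<integral>w. norm (u k w) \<partial>M) \<le> (\<integral>w. \<epsilon> / 3 + indicator ?B w \<partial>M)"
      proof (rule integral_mono)
        show "integrable M (\<lambda>w. norm (u k w))" using iu by simp
        show "integrable M (\<lambda>w. \<epsilon> / 3 + indicator ?B w)" by (intro Bochner_Integration.integrable_add) (auto simp: less_top[symmetric])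
        fix w assume w: "w \<in> space M"
        show "norm (u k w) \<le> \<epsilon> / 3 + indicator ?B w"
        proof (cases "w \<in> ?B")
          case True then show ?thesis using u01[of k w] \<epsilon> by simp
        next
          case False
          then have "min 1 (Z k w) \<le> ennreal (\<epsilon> / 3)" using w by (auto simp: not_less min_le_iff_disj)
          then have "u k w \<le> enn2real (ennreal (\<epsilon> / 3))" unfolding u_def by (intro enn2real_mono) auto
          then show ?thesis using \<epsilon> u01[of k w] False by simp
        qed
      qed
      also have "\<dots> = \<epsilon> / 3 + prob ?B" by (subst Bochner_Integration.integral_add) (auto simp: prob_space less_top[symmetric])
      also have "\<dots> < \<epsilon>" using K[OF that] \<epsilon> by simp
      finally show ?thesis using u01 by (simp add: integral_nonneg_AE)
    qed
    then show "\<exists>K. \<forall>k\<ge>K. norm ((\<integral>w. norm (u k w) \<partial>M) - 0) < \<epsilon>" by blast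
  qed
  from tendsto_L1_AE_subseq[OF iu this] obtain r where r: "strict_mono r" "AE w in M. (\<lambda>k. u (r k) w) \<longlonglongrightarrow> 0"
    by blast
  have "AE w in M. (\<lambda>k. Z (r k) w) \<longlonglongrightarrow> 0"
    using r(2)
  proof eventually_elim
    case (elim w)
    then have "(\<lambda>k. ennreal (u (r k) w)) \<longlonglongrightarrow> 0" using tendsto_ennrealI by fastforce
    moreover have "\<forall>\<^sub>F k in sequentially. ennreal (u (r k) w) = Z (r k) w"
    proof -
      have "\<forall>\<^sub>F k in sequentially. u (r k) w < 1" using elim by (rule order_tendstoD) simp
      then show ?thesis
      proof eventually_elim
        case (elim k)
        have e: "ennreal (u (r k) w) = min 1 (Z (r k) w)" unfolding u_def
          by (rule ennreal_enn2real) (simp add: min_less_iff_disj)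
        then have "min 1 (Z (r k) w) < 1" using elim by (metis ennreal_1 ennreal_less_iff u01(1))
        then show ?case using e by (auto simp: min_def split: if_splits)
      qed
    qed
    ultimately show ?case using tendsto_cong by fast
  qed
  with r(1) show ?thesis by (rule that)
qed

text \<open>Exponential Chebyshev: where the energy is at most \<eta>, exceeding \<epsilon> makes
  the compensated exponential with parameter c v at least exp (c \<epsilon> - c^2 \<eta> / 2), and
  that exponential has mean at most 1.\<close>

lemma step_integral_tail:
  fixes W :: "real \<Rightarrow> 'w \<Rightarrow> real^'n" and e :: "real \<Rightarrow> 'w \<Rightarrow> real^'n^'d"
  assumes bm: "brownian_motion M F W" and e: "step_process F u N e" and v: "norm v \<le> 1"
    and c: "c > 0" and \<eta>: "\<eta> > 0"
  shows "measure M {w \<in> space M. \<epsilon> < v \<bullet> step_integral W u N e w}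
    \<le> measure M {w \<in> space M. ennreal \<eta> < ennreal (step_energy u N e w)} + exp (c\<^sup>2 * \<eta> / 2 - c * \<epsilon>)"
proof -
  interpret prob_space M by (rule brownian_motionD[OF bm])
  note sub = brownian_motionD(2)[OF bm]
  let ?I = "step_integral W u N e" and ?E = "step_energy u N e"
  let ?x = "\<lambda>w. (c *\<^sub>R v) \<bullet> ?I w - (norm (c *\<^sub>R v))\<^sup>2 / 2 * ?E w"
  let ?A = "{w \<in> space M. ennreal \<eta> < ennreal (?E w)}"
  have [measurable]: "?I \<in> borel_measurable M" "?E \<in> borel_measurable M"
    using step_process_measurable[OF bm e order_refl] measurable_from_subalg[OF sub] by blast+
  have E0: "0 \<le> ?E w" for w
  proof -
    have "u i < u (Suc i)" if "i < N" for i using e that unfolding step_process_def by blast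
    then show ?thesis unfolding step_energy_def by (intro sum_nonneg mult_nonneg_nonneg) (auto simp: less_imp_le)
  qed
  define f where "f = (\<lambda>w. ennreal (exp (?x w)))"
  define K where "K = exp (c\<^sup>2 * \<eta> / 2 - c * \<epsilon>)"
  have "(\<integral>\<^sup>+w. f w \<partial>M) \<le> 1"
    using step_integral_exp[OF bm e, of "\<lambda>_. 1" "\<lambda>_. c *\<^sub>R v"] by (simp add: f_def emeasure_space_1)
  have "{w \<in> space M. \<epsilon> < v \<bullet> ?I w} \<subseteq>
     ?A \<union> {w \<in> space M. 1 \<le> ennreal K * f w}"
  proof (rule subsetI, rule ccontr)
    fix w assume "w \<in> {w \<in> space M. \<epsilon> < v \<bullet> ?I w}"
      "w \<notin> ?A \<union> {w \<in> space M. 1 \<le> ennreal K * f w}"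
    then have *: "\<epsilon> < v \<bullet> ?I w" "\<not> ennreal \<eta> < ennreal (?E w)" "\<not> 1 \<le> ennreal K * f w" by auto
    have "(norm (c *\<^sub>R v))\<^sup>2 \<le> c\<^sup>2"
      using v c by (simp add: power_mult_distrib mult_left_le power_le_one)
    have "\<not> \<eta> < ?E w" using *(2) \<eta> by (meson ennreal_lessI less_trans)
    then have "(norm (c *\<^sub>R v))\<^sup>2 / 2 * ?E w \<le> c\<^sup>2 / 2 * \<eta>"
      using \<open>(norm (c *\<^sub>R v))\<^sup>2 \<le> c\<^sup>2\<close> E0[of w] by (intro mult_mono) auto
    moreover have "c * \<epsilon> \<le> (c *\<^sub>R v) \<bullet> ?I w" using * c by simp
    ultimately have "0 \<le> (c\<^sup>2 * \<eta> / 2 - c * \<epsilon>) + (?x w)" by simp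
    then have "1 \<le> K * exp (?x w)"
      unfolding K_def mult_exp_exp by (subst one_le_exp_iff)
    then have "ennreal 1 \<le> ennreal (K * exp (?x w))" by (rule ennreal_leI)
    also have "\<dots> = ennreal K * f w" unfolding f_def by (rule ennreal_mult) (auto simp: K_def)
    finally show False using *(3) by simp
  qed
  then have "measure M {w \<in> space M. \<epsilon> < v \<bullet> ?I w} \<le>
     measure M (?A \<union> {w \<in> space M. 1 \<le> ennreal K * f w})"
    by (intro finite_measure_mono) (auto simp: f_def)
  also have "\<dots> \<le> measure M ?A + measure M {w \<in> space M. 1 \<le> ennreal K * f w}"
    by (rule measure_Un_le) (auto simp: f_def)
  also have "measure M {w \<in> space M. 1 \<le> ennreal K * f w} \<le> K"
  proof -
    have "emeasure M {w \<in> space M. 1 \<le> ennreal K * f w} \<le> ennreal K * (\<integral>\<^sup>+w. f w * indicator (space M) w \<partial>M)"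
      by (rule nn_integral_Markov_inequality) (auto simp: f_def)
    also have "(\<integral>\<^sup>+w. f w * indicator (space M) w \<partial>M) = (\<integral>\<^sup>+w. f w \<partial>M)"
      by (intro nn_integral_cong) simp
    also have "ennreal K * \<dots> \<le> ennreal K * 1" using \<open>(\<integral>\<^sup>+w. f w \<partial>M) \<le> 1\<close> by (rule mult_left_mono) simp
    finally show ?thesis by (simp add: emeasure_eq_measure K_def)
  qed
  finally show ?thesis by (simp add: K_def)
qed

lemma step_integrals_null:
  fixes W :: "real \<Rightarrow> 'w \<Rightarrow> real^'n" and e :: "nat \<Rightarrow> real \<Rightarrow> 'w \<Rightarrow> real^'n^'d"
  assumes bm: "brownian_motion M F W" and e: "\<And>k. step_process F (u k) (N k) (e k)"
    and E: "null_in_probability M (\<lambda>k w. ennreal (step_energy (u k) (N k) (e k) w))"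
  shows "null_in_probability M (\<lambda>k w. ennreal (norm (step_integral W (u k) (N k) (e k) w)))"
proof -
  interpret prob_space M by (rule brownian_motionD[OF bm])
  note sub = brownian_motionD(2)[OF bm]
  let ?I = "\<lambda>k. step_integral W (u k) (N k) (e k)"
  let ?P = "\<lambda>\<epsilon> v k. {w \<in> space M. \<epsilon> < v \<bullet> ?I k w}"
  let ?S = "\<lambda>\<epsilon> k. \<Sum>i\<in>(UNIV::'d set). prob (?P \<epsilon> (axis i 1) k) + prob (?P \<epsilon> (- axis i 1) k)"
  let ?Q = "\<lambda>\<epsilon> k. {w \<in> space M. ennreal \<epsilon> < ennreal (norm (?I k w))}"
  have [measurable]: "?I k \<in> borel_measurable M" for k
    using step_process_measurable(1)[OF bm e order_refl] measurable_from_subalg[OF sub] by blast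
  have one: "(\<lambda>k. prob (?P \<epsilon> v k)) \<longlonglongrightarrow> 0" if v: "norm v \<le> 1" and \<epsilon>: "\<epsilon> > 0" for v \<epsilon>
  proof (rule LIMSEQ_I)
    fix \<rho> :: real assume \<rho>: "\<rho> > 0"
    \<comment> \<open>\<open>c\<close> is so large that exp (1 - c \<epsilon>) is below \<rho> / 2;
      afterwards \<eta> = 2 / c^2 makes c^2 \<eta> / 2 equal to 1.\<close>
    define c where "c = (\<bar>1 - ln (\<rho> / 2)\<bar> + 1) / \<epsilon>"
    have c: "c > 0" using \<epsilon> by (simp add: c_def add_nonneg_pos)
    have "c * \<epsilon> = \<bar>1 - ln (\<rho> / 2)\<bar> + 1" using \<epsilon> by (simp add: c_def)
    then have "1 - c * \<epsilon> < ln (\<rho> / 2)" by linarith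
    then have "exp (1 - c * \<epsilon>) < exp (ln (\<rho> / 2))" by (subst exp_less_cancel_iff)
    then have ex: "exp (1 - c * \<epsilon>) < \<rho> / 2" using \<rho> by simp
    define \<eta> where "\<eta> = 2 / c\<^sup>2"
    have \<eta>: "\<eta> > 0" using c by (simp add: \<eta>_def)
    with E have "(\<lambda>k. prob {w \<in> space M. ennreal \<eta> < ennreal (step_energy (u k) (N k) (e k) w)}) \<longlonglongrightarrow> 0"
      by (simp add: null_in_probability_def)
    from LIMSEQ_D[OF this, of "\<rho> / 2"] \<rho> obtain K where
      K: "\<And>k. k \<ge> K \<Longrightarrow> prob {w \<in> space M. ennreal \<eta> < ennreal (step_energy (u k) (N k) (e k) w)} < \<rho> / 2" by auto
    have "norm (prob (?P \<epsilon> v k) - 0) < \<rho>" if "k \<ge> K" for k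
      using step_integral_tail[OF bm e v c \<eta>, of \<epsilon> k] K[OF that] ex c by (simp add: \<eta>_def)
    then show "\<exists>K. \<forall>k\<ge>K. norm (prob (?P \<epsilon> v k) - 0) < \<rho>" by blast
  qed
  show ?thesis
    unfolding null_in_probability_def
  proof (intro conjI allI impI)
    show "(\<lambda>w. ennreal (norm (?I k w))) \<in> borel_measurable M" for k by measurable
    fix \<epsilon> :: real assume \<epsilon>: "\<epsilon> > 0"
    \<comment> \<open>The tail bound is for one direction at a time. As the norm is at most the sum
      of the absolute coordinates, a norm above \<epsilon> makes some coordinate exceed \<epsilon> /
      \<open>CARD('d)\<close> up to sign.\<close>
    define \<epsilon>' where "\<epsilon>' = \<epsilon> / CARD('d)"
    have \<epsilon>': "\<epsilon>' > 0" using \<epsilon> by (simp add: \<epsilon>'_def)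
    let ?A = "\<lambda>k i. ?P \<epsilon>' (axis i 1) k \<union> ?P \<epsilon>' (- axis i 1) k"
    have "(\<lambda>k. ?S \<epsilon>' k) \<longlonglongrightarrow> (\<Sum>i\<in>(UNIV::'d set). 0 + 0)"
      by (intro tendsto_sum tendsto_add one \<epsilon>') (simp_all add: norm_axis_1)
    also have "(\<Sum>i\<in>(UNIV::'d set). 0 + 0 :: real) = 0" by simp
    finally have lim: "(\<lambda>k. ?S \<epsilon>' k) \<longlonglongrightarrow> 0" .
    have le: "prob (?Q \<epsilon> k)
       \<le> ?S \<epsilon>' k" for k
    proof -
      have "?Q \<epsilon> k \<subseteq> (\<Union>i\<in>UNIV. ?A k i)"
      proof (rule subsetI, rule ccontr)
        fix w assume w: "w \<in> ?Q \<epsilon> k" "w \<notin> (\<Union>i\<in>UNIV. ?A k i)"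
        then have "\<bar>?I k w $ i\<bar> \<le> \<epsilon>'" for i
          by (auto simp: inner_axis' not_less abs_le_iff)
        then have "(\<Sum>i\<in>UNIV. \<bar>?I k w $ i\<bar>) \<le> (\<Sum>i\<in>(UNIV::'d set). \<epsilon>')" by (intro sum_mono)
        then have "norm (?I k w) \<le> \<epsilon>" using norm_le_l1_cart[of "?I k w"] by (simp add: \<epsilon>'_def)
        then show False using w(1) \<epsilon> by (simp add: ennreal_less_iff)
      qed
      then have "prob (?Q \<epsilon> k) \<le> prob (\<Union>i\<in>UNIV. ?A k i)"
        by (intro finite_measure_mono) auto
      also have "\<dots> \<le> (\<Sum>i\<in>UNIV. prob (?A k i))"
        by (rule measure_UNION_le) auto
      also have "\<dots> \<le> ?S \<epsilon>' k"
        by (intro sum_mono measure_Un_le) auto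
      finally show ?thesis .
    qed
    show "(\<lambda>k. prob (?Q \<epsilon> k)) \<longlonglongrightarrow> 0"
    proof (rule tendsto_sandwich[OF _ _ tendsto_const lim])
      show "\<forall>\<^sub>F k in sequentially. prob (?Q \<epsilon> k)
        \<le> ?S \<epsilon>' k"
        by (rule always_eventually, rule allI, rule le)
    qed simp
  qed
qed

section \<open>Passage from elementary integrals to the Ito integral\<close>

lemma grid_from_to:
  fixes s t :: real
  assumes "finite P" "s \<in> P" "t \<in> P" "P \<subseteq> {s..t}"
  obtains u N where "u ` {..N} = P" "\<And>i. i < N \<Longrightarrow> u i < u (Suc i)" "u 0 = s" "u N = t"
proof -
  obtain u N where u: "u ` {..N} = P" "\<And>i. i < N \<Longrightarrow> u i < u (Suc i)"
    using finite_set_grid[of P] assms by blast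
  note mono = grid_mono[of N u, OF u(2)]
  obtain i j where "i \<le> N" "u i = s" "j \<le> N" "u j = t" using assms u(1) by (metis atMost_iff imageE)
  moreover have "u 0 \<in> P" "u N \<in> P" using u(1) by auto
  ultimately have "u 0 = s" "u N = t" using mono[of 0 i] mono[of j N] assms by auto
  with u show ?thesis using that by blast
qed

lemma elementary_integral_0:
  assumes "elementary F m \<tau> \<xi>"
  shows "elementary_integral W m \<tau> \<xi> 0 w = 0"
proof -
  have "0 \<le> \<tau> k" if "k \<le> m" for k
    using that
  proof (induction k)
    case (Suc k)
    then have "\<tau> k \<le> \<tau> (Suc k)" using assms by (auto simp: elementary_def)
    then show ?case using Suc by auto
  qed (use assms in \<open>auto simp: elementary_def\<close>)
  then show ?thesis unfolding elementary_integral_def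
    by (intro sum.neutral) (auto simp: min_absorb1)
qed

lemma elementary_process_section_measurable:
  "(\<lambda>r. elementary_process m \<tau> \<xi> r w) \<in> borel_measurable lborel"
  unfolding elementary_process_def by measurable

lemma progressively_measurable_section:
  assumes "progressively_measurable F H" "0 \<le> t" "w \<in> space (F t)"
  shows "(\<lambda>r. H r w) \<in> borel_measurable (restrict_space lborel {0..t})"
proof -
  have "(\<lambda>(r, w). H r w) \<in> borel_measurable (restrict_space borel {0..t} \<Otimes>\<^sub>M F t)"
    using assms by (simp add: progressively_measurable_def)
  from measurable_compose[OF measurable_Pair2'[OF assms(3)] this]
  have "(\<lambda>r. H r w) \<in> borel_measurable (restrict_space borel {0..t})" by simp
  then show ?thesis by (simp cong: measurable_cong_sets add: sets_restrict_space)
qed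

lemma sq_dist_le_double:
  fixes x y z :: "'a::real_inner"
  shows "(norm (x - y))\<^sup>2 \<le> 2 * (norm (x - z))\<^sup>2 + 2 * (norm (y - z))\<^sup>2"
proof -
  have "norm (x - y) \<le> norm (x - z) + norm (y - z)"
    using norm_triangle_ineq4[of "x - z" "y - z"] by simp
  then have "(norm (x - y))\<^sup>2 \<le> (norm (x - z) + norm (y - z))\<^sup>2" by (intro power_mono) auto
  also have "\<dots> \<le> 2 * (norm (x - z))\<^sup>2 + 2 * (norm (y - z))\<^sup>2"
    using sum_squares_bound[of "norm (x - z)" "norm (y - z)"] by (simp add: power2_sum)
  finally show ?thesis .
qed

text \<open>The elementary sequence at hand is compared with the one that defines \<open>J\<close>: on a common refinement
  of the two partitions the difference is an integral of small energy.\<close>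
lemma elementary_integral_tendsto_earlier:
  fixes W :: "real \<Rightarrow> 'w \<Rightarrow> real^'n" and H :: "real \<Rightarrow> 'w \<Rightarrow> real^'n^'d"
  assumes bm: "brownian_motion M F W" and st: "0 \<le> s" "s \<le> t"
    and prog: "progressively_measurable F H"
    and el: "\<And>k. elementary F (m k) (\<tau> k) (\<xi> k)"
    and app: "null_in_probability M (\<lambda>k w. \<integral>\<^sup>+ r\<in>{0..t}.
          ennreal ((hs_norm (elementary_process (m k) (\<tau> k) (\<xi> k) r w - H r w))\<^sup>2) \<partial>lborel)"
    and J: "has_ito_integral M F W H s J"
  shows "null_in_probability M (\<lambda>k w. ennreal (norm (elementary_integral W (m k) (\<tau> k) (\<xi> k) s w - J w)))"
proof -
  interpret prob_space M by (rule brownian_motionD[OF bm])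
  note sub = brownian_motionD(2)[OF bm]
  obtain m' \<tau>' \<xi>' where el': "\<And>k. elementary F (m' k) (\<tau>' k) (\<xi>' k)"
    and app': "null_in_probability M (\<lambda>k w. \<integral>\<^sup>+ r\<in>{0..s}.
          ennreal ((hs_norm (elementary_process (m' k) (\<tau>' k) (\<xi>' k) r w - H r w))\<^sup>2) \<partial>lborel)"
    and lim': "null_in_probability M (\<lambda>k w.
          ennreal (norm (elementary_integral W (m' k) (\<tau>' k) (\<xi>' k) s w - J w)))"
    using J unfolding has_ito_integral_def by blast
  have Jm[measurable]: "J \<in> borel_measurable M" using J by (simp add: has_ito_integral_def)
  let ?E = "\<lambda>k. elementary_process (m k) (\<tau> k) (\<xi> k)"
  let ?E' = "\<lambda>k. elementary_process (m' k) (\<tau>' k) (\<xi>' k)"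
  have "\<exists>u N. step_process F u N (?E k) \<and> step_process F u N (?E' k) \<and> u 0 = 0 \<and> u N = s \<and>
     (\<forall>w. elementary_integral W (m k) (\<tau> k) (\<xi> k) s w = step_integral W u N (?E k) w) \<and>
     (\<forall>w. elementary_integral W (m' k) (\<tau>' k) (\<xi>' k) s w = step_integral W u N (?E' k) w)" for k
  proof -
    define P where "P = {0, s} \<union> (\<lambda>i. clamp_real 0 s (\<tau> k i)) ` {..m k} \<union> (\<lambda>i. clamp_real 0 s (\<tau>' k i)) ` {..m' k}"
    have "finite P" "0 \<in> P" "s \<in> P" "P \<subseteq> {0..s}" using st by (auto simp: P_def)
    then obtain u N where u: "u ` {..N} = P" "\<And>i. i < N \<Longrightarrow> u i < u (Suc i)" "u 0 = 0" "u N = s"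
      using grid_from_to[of P 0 s] by metis
    have P1: "clamp_real 0 s (\<tau> k i) \<in> u ` {..N}" if "i \<le> m k" for i using that unfolding u(1) P_def by blast
    have P2: "clamp_real 0 s (\<tau>' k i) \<in> u ` {..N}" if "i \<le> m' k" for i using that unfolding u(1) P_def by blast
    show ?thesis
      using elementary_on_grid[OF bm el order_refl st(1) u(2-4) P1]
        elementary_on_grid[OF bm el' order_refl st(1) u(2-4) P2] u(3,4)
        elementary_integral_0[OF el] elementary_integral_0[OF el']
      by (intro exI[of _ u] exI[of _ N]) simp
  qed
  then obtain u N where u: "\<And>k. step_process F (u k) (N k) (?E k)" "\<And>k. step_process F (u k) (N k) (?E' k)"
     "\<And>k. u k 0 = 0" "\<And>k. u k (N k) = s"
     "\<And>k w. elementary_integral W (m k) (\<tau> k) (\<xi> k) s w = step_integral W (u k) (N k) (?E k) w"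
     "\<And>k w. elementary_integral W (m' k) (\<tau>' k) (\<xi>' k) s w = step_integral W (u k) (N k) (?E' k) w"
    by metis
  let ?D = "\<lambda>k r w. ?E k r w - ?E' k r w"
  have D: "step_process F (u k) (N k) (?D k)" for k by (rule step_process_diff[OF u(1,2)])
  have meas: "step_energy (u k) (N k) (?D k) \<in> borel_measurable M"
     "step_integral W (u k) (N k) (?D k) \<in> borel_measurable M"
     "step_integral W (u k) (N k) (?E k) \<in> borel_measurable M" for k
    using step_process_measurable[OF bm D order_refl] step_process_measurable[OF bm u(1) order_refl]
      measurable_from_subalg[OF sub] by blast+
  let ?q = "\<lambda>k w. \<integral>\<^sup>+ r\<in>{0..t}. ennreal ((hs_norm (?E k r w - H r w))\<^sup>2) \<partial>lborel"
  let ?q' = "\<lambda>k w. \<integral>\<^sup>+ r\<in>{0..s}. ennreal ((hs_norm (?E' k r w - H r w))\<^sup>2) \<partial>lborel"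
  have "null_in_probability M (\<lambda>k w. ennreal (step_energy (u k) (N k) (?D k) w))"
  proof (rule null_in_probability_le)
    \<comment> \<open>Each error counts twice, by the squared triangle inequality; the repeated sum
      is the form to which \<open>null_in_probability_add\<close> applies.\<close>
    show "null_in_probability M (\<lambda>k w. (?q k w + ?q' k w) + (?q k w + ?q' k w))"
      by (intro null_in_probability_add app app')
    show "(\<lambda>w. ennreal (step_energy (u k) (N k) (?D k) w)) \<in> borel_measurable M" for k
      using meas(1)[of k] by measurable
    fix k w assume w: "w \<in> space M"
    then have "w \<in> space (F s)" using sub[of s] by (simp add: subalgebra_def)
    from progressively_measurable_section[OF prog st(1) this]
    have Hm: "(\<lambda>r. H r w) \<in> borel_measurable (restrict_space lborel {0..s})" .
    have Em: "(\<lambda>r. ?E k r w) \<in> borel_measurable (restrict_space lborel {0..s})"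
      "(\<lambda>r. ?E' k r w) \<in> borel_measurable (restrict_space lborel {0..s})"
      by (intro measurable_restrict_space1 elementary_process_section_measurable)+
    have m1: "(\<lambda>r. ennreal ((norm (?E k r w - H r w))\<^sup>2) * indicator {0..s} r) \<in> borel_measurable lborel"
      using Hm Em by (subst borel_measurable_restrict_space_iff_ennreal[symmetric]) auto
    have m2: "(\<lambda>r. ennreal ((norm (?E' k r w - H r w))\<^sup>2) * indicator {0..s} r) \<in> borel_measurable lborel"
      using Hm Em by (subst borel_measurable_restrict_space_iff_ennreal[symmetric]) auto
    let ?f = "\<lambda>r. ennreal ((norm (?E k r w - H r w))\<^sup>2) * indicator {0..s} r"
    let ?g = "\<lambda>r. ennreal ((norm (?E' k r w - H r w))\<^sup>2) * indicator {0..s} r"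
    have "ennreal (step_energy (u k) (N k) (?D k) w)
       = (\<integral>\<^sup>+r\<in>{0..s}. ennreal ((norm (?D k r w))\<^sup>2) \<partial>lborel)"
      using step_energy_eq_nn_integral[OF D, of k w] by (simp add: u)
    also have "\<dots> \<le> (\<integral>\<^sup>+r. (?f r + ?g r) + (?f r + ?g r) \<partial>lborel)"
    proof (rule nn_integral_mono)
      fix r
      have "ennreal ((norm (?D k r w))\<^sup>2) \<le> ennreal (2 * (norm (?E k r w - H r w))\<^sup>2 + 2 * (norm (?E' k r w - H r w))\<^sup>2)"
        by (intro ennreal_leI sq_dist_le_double)
      also have "\<dots> = (ennreal ((norm (?E k r w - H r w))\<^sup>2) + ennreal ((norm (?E' k r w - H r w))\<^sup>2))
         + (ennreal ((norm (?E k r w - H r w))\<^sup>2) + ennreal ((norm (?E' k r w - H r w))\<^sup>2))"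
        by (simp flip: ennreal_plus)
      finally show "ennreal ((norm (?D k r w))\<^sup>2) * indicator {0..s} r \<le> (?f r + ?g r) + (?f r + ?g r)"
        by (simp add: indicator_def)
    qed
    also have "\<dots> = (integral\<^sup>N lborel ?f + integral\<^sup>N lborel ?g) + (integral\<^sup>N lborel ?f + integral\<^sup>N lborel ?g)"
      using m1 m2 by (simp add: nn_integral_add)
    also have "\<dots> \<le> (?q k w + ?q' k w) + (?q k w + ?q' k w)"
      using st unfolding hs_norm_eq_norm
      by (intro add_mono nn_integral_mono) (auto simp: indicator_def)
    finally show "ennreal (step_energy (u k) (N k) (?D k) w) \<le> (?q k w + ?q' k w) + (?q k w + ?q' k w)" .
  qed
  from step_integrals_null[OF bm D this]
  have "null_in_probability M (\<lambda>k w. ennreal (norm (step_integral W (u k) (N k) (?D k) w)))" .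
  from null_in_probability_add[OF this lim']
  show ?thesis
  proof (rule null_in_probability_le)
    show "(\<lambda>w. ennreal (norm (elementary_integral W (m k) (\<tau> k) (\<xi> k) s w - J w))) \<in> borel_measurable M" for k
      unfolding u(5) using meas(3)[of k] by measurable
    fix k w
    have *: "elementary_integral W (m k) (\<tau> k) (\<xi> k) s w - J w
       = step_integral W (u k) (N k) (?D k) w + (elementary_integral W (m' k) (\<tau>' k) (\<xi>' k) s w - J w)"
      unfolding u(5,6) step_integral_diff by simp
    have "norm (elementary_integral W (m k) (\<tau> k) (\<xi> k) s w - J w)
       \<le> norm (step_integral W (u k) (N k) (?D k) w) + norm (elementary_integral W (m' k) (\<tau>' k) (\<xi>' k) s w - J w)"
      by (rule ord_eq_le_trans[OF arg_cong[OF *, of norm] norm_triangle_ineq])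
    then show "ennreal (norm (elementary_integral W (m k) (\<tau> k) (\<xi> k) s w - J w))
       \<le> ennreal (norm (step_integral W (u k) (N k) (?D k) w)) + ennreal (norm (elementary_integral W (m' k) (\<tau>' k) (\<xi>' k) s w - J w))"
      by (simp flip: ennreal_plus add: ennreal_leI)
  qed
qed

text \<open>Fatou along an almost surely convergent subsequence of elementary integrals. One
  approximating sequence has to serve both times, which
  \<open>elementary_integral_tendsto_earlier\<close> makes possible. The approximants need not
  respect the bound A: the squared triangle inequality bounds their energy by 2 A^2 (t - s) plus a
  vanishing error, and this doubling uses up the factor 1 / 2 that usually stands before
  |\<theta>|^2.\<close>

lemma ito_increment_exp:
  fixes W :: "real \<Rightarrow> 'w \<Rightarrow> real^'n" and H :: "real \<Rightarrow> 'w \<Rightarrow> real^'n^'d"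
  assumes bm: "brownian_motion M F W" and st: "0 \<le> s" "s < t"
    and Js: "has_ito_integral M F W H s Js" and Jt: "has_ito_integral M F W H t Jt"
    and A: "\<And>r w. norm (H r w) \<le> A"
    and Y: "Y \<in> borel_measurable (F s)" and Y0: "\<And>w. 0 \<le> Y w" and \<theta>: "\<theta> \<in> borel_measurable (F s)"
  shows "(\<integral>\<^sup>+w. ennreal (Y w * exp (\<theta> w \<bullet> (Jt w - Js w) - (norm (\<theta> w))\<^sup>2 * (A\<^sup>2 * (t - s)))) \<partial>M)
     \<le> (\<integral>\<^sup>+w. ennreal (Y w) \<partial>M)"
proof -
  let ?G = "\<lambda>w. Y w * exp (\<theta> w \<bullet> (Jt w - Js w) - (norm (\<theta> w))\<^sup>2 * (A\<^sup>2 * (t - s)))"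
  interpret prob_space M by (rule brownian_motionD[OF bm])
  note sub = brownian_motionD(2)[OF bm]
  have prog: "progressively_measurable F H" using Jt by (simp add: has_ito_integral_def)
  obtain m \<tau> \<xi> where el: "\<And>k. elementary F (m k) (\<tau> k) (\<xi> k)"
    and app: "null_in_probability M (\<lambda>k w. \<integral>\<^sup>+ r\<in>{0..t}.
          ennreal ((hs_norm (elementary_process (m k) (\<tau> k) (\<xi> k) r w - H r w))\<^sup>2) \<partial>lborel)"
    and lim: "null_in_probability M (\<lambda>k w.
          ennreal (norm (elementary_integral W (m k) (\<tau> k) (\<xi> k) t w - Jt w)))"
    using Jt unfolding has_ito_integral_def by blast
  let ?E = "\<lambda>k. elementary_process (m k) (\<tau> k) (\<xi> k)"
  let ?I = "\<lambda>k. elementary_integral W (m k) (\<tau> k) (\<xi> k)"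
  let ?q = "\<lambda>k w. \<integral>\<^sup>+ r\<in>{0..t}. ennreal ((hs_norm (?E k r w - H r w))\<^sup>2) \<partial>lborel"
  have lims: "null_in_probability M (\<lambda>k w. ennreal (norm (?I k s w - Js w)))"
    using st by (intro elementary_integral_tendsto_earlier[OF bm _ _ prog el app Js]) auto
  obtain r where r: "strict_mono r"
    "AE w in M. (\<lambda>k. ?q (r k) w + ennreal (norm (?I (r k) t w - Jt w)) + ennreal (norm (?I (r k) s w - Js w))) \<longlonglongrightarrow> 0"
    using null_in_probability_AE_subseq[OF null_in_probability_add[OF null_in_probability_add[OF app lim] lims]] by blast
  \<comment> \<open>The grid begins at s, because Y and \<theta> are known there.\<close>
  have "\<exists>u N. step_process F u N (?E k) \<and> u 0 = s \<and> u N = t \<and>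
     (\<forall>w. ?I k t w - ?I k s w = step_integral W u N (?E k) w)" for k
  proof -
    define P where "P = {s, t} \<union> (\<lambda>i. clamp_real s t (\<tau> k i)) ` {..m k}"
    have "finite P" "s \<in> P" "t \<in> P" "P \<subseteq> {s..t}" using st by (auto simp: P_def)
    then obtain u N where u: "u ` {..N} = P" "\<And>i. i < N \<Longrightarrow> u i < u (Suc i)" "u 0 = s" "u N = t"
      using grid_from_to[of P s t] by metis
    have P1: "clamp_real s t (\<tau> k i) \<in> u ` {..N}" if "i \<le> m k" for i using that unfolding u(1) P_def by blast
    show ?thesis
      using elementary_on_grid[OF bm el st(1) less_imp_le[OF st(2)] u(2-4) P1] u(3,4)
      by (intro exI[of _ u] exI[of _ N]) simp
  qed
  then obtain u N where u: "\<And>k. step_process F (u k) (N k) (?E k)" "\<And>k. u k 0 = s" "\<And>k. u k (N k) = t"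
     "\<And>k w. ?I k t w - ?I k s w = step_integral W (u k) (N k) (?E k) w" by metis
  define f where "f = (\<lambda>k w. ennreal (Y w * exp (\<theta> w \<bullet> step_integral W (u k) (N k) (?E k) w
      - (norm (\<theta> w))\<^sup>2 / 2 * step_energy (u k) (N k) (?E k) w)))"
  have fm: "f k \<in> borel_measurable M" for k
  proof -
    have [measurable]: "step_integral W (u k) (N k) (?E k) \<in> borel_measurable M" "step_energy (u k) (N k) (?E k) \<in> borel_measurable M"
      using step_process_measurable[OF bm u(1) order_refl] measurable_from_subalg[OF sub] by blast+
    have [measurable]: "Y \<in> borel_measurable M" "\<theta> \<in> borel_measurable M"
      using Y \<theta> measurable_from_subalg[OF sub] by blast+
    show ?thesis unfolding f_def by measurable
  qed
  have fI: "(\<integral>\<^sup>+w. f k w \<partial>M) \<le> (\<integral>\<^sup>+w. ennreal (Y w) \<partial>M)" for k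
    unfolding f_def using u(2)[of k] Y \<theta> by (intro step_integral_exp[OF bm u(1) _ Y0]) auto
  have energy: "ennreal (step_energy (u k) (N k) (?E k) w) \<le> ennreal (2 * A\<^sup>2 * (t - s)) + (?q k w + ?q k w)"
    if w: "w \<in> space M" for k w
  proof -
    have "w \<in> space (F t)" using sub[of t] w by (simp add: subalgebra_def)
    then have Hm: "(\<lambda>r. H r w) \<in> borel_measurable (restrict_space lborel {0..t})"
      using st by (intro progressively_measurable_section[OF prog]) auto
    have Em: "(\<lambda>r. ?E k r w) \<in> borel_measurable (restrict_space lborel {0..t})"
      by (intro measurable_restrict_space1 elementary_process_section_measurable)
    let ?g = "\<lambda>r. ennreal ((norm (?E k r w - H r w))\<^sup>2) * indicator {0..t} r"
    have m1: "?g \<in> borel_measurable lborel"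
      using Hm Em by (subst borel_measurable_restrict_space_iff_ennreal[symmetric]) auto
    have "ennreal (step_energy (u k) (N k) (?E k) w) = (\<integral>\<^sup>+r\<in>{s..t}. ennreal ((norm (?E k r w))\<^sup>2) \<partial>lborel)"
      using step_energy_eq_nn_integral[OF u(1), of k w] by (simp add: u)
    also have "\<dots> \<le> (\<integral>\<^sup>+r. ennreal (2 * A\<^sup>2) * indicator {s..t} r + (?g r + ?g r) \<partial>lborel)"
    proof (rule nn_integral_mono)
      fix r
      have "(norm (?E k r w - 0))\<^sup>2 \<le> 2 * (norm (?E k r w - H r w))\<^sup>2 + 2 * (norm (0 - H r w))\<^sup>2"
        by (rule sq_dist_le_double)
      moreover have "(norm (0 - H r w))\<^sup>2 \<le> A\<^sup>2" using A[of r w] by (intro power_mono) auto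
      ultimately have "(norm (?E k r w))\<^sup>2 \<le> 2 * A\<^sup>2 + ((norm (?E k r w - H r w))\<^sup>2 + (norm (?E k r w - H r w))\<^sup>2)" by simp
      then have "ennreal ((norm (?E k r w))\<^sup>2) \<le> ennreal (2 * A\<^sup>2 + ((norm (?E k r w - H r w))\<^sup>2 + (norm (?E k r w - H r w))\<^sup>2))"
        by (rule ennreal_leI)
      also have "\<dots> = ennreal (2 * A\<^sup>2) + (ennreal ((norm (?E k r w - H r w))\<^sup>2) + ennreal ((norm (?E k r w - H r w))\<^sup>2))"
        by (simp only: ennreal_plus zero_le_power2 add_nonneg_nonneg mult_nonneg_nonneg zero_le_numeral)
      finally show "ennreal ((norm (?E k r w))\<^sup>2) * indicator {s..t} r \<le> ennreal (2 * A\<^sup>2) * indicator {s..t} r + (?g r + ?g r)"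
        using st by (auto simp: indicator_def)
    qed
    also have "\<dots> = (\<integral>\<^sup>+r. ennreal (2 * A\<^sup>2) * indicator {s..t} r \<partial>lborel) + (integral\<^sup>N lborel ?g + integral\<^sup>N lborel ?g)"
      using m1 by (simp add: nn_integral_add)
    also have "(\<integral>\<^sup>+r. ennreal (2 * A\<^sup>2) * indicator {s..t} r \<partial>lborel) = ennreal (2 * A\<^sup>2 * (t - s))"
    proof -
      have "(\<integral>\<^sup>+r. ennreal (2 * A\<^sup>2) * indicator {s..t} r \<partial>lborel) = ennreal (2 * A\<^sup>2) * emeasure lborel {s..t}"
        by (rule nn_integral_cmult_indicator) simp
      then show ?thesis using st by (simp add: ennreal_mult[symmetric])
    qed
    finally show ?thesis unfolding hs_norm_eq_norm .
  qed
  have "(\<integral>\<^sup>+w. ennreal (?G w) \<partial>M)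
     \<le> (\<integral>\<^sup>+w. liminf (\<lambda>k. f (r k) w) \<partial>M)"
  proof (rule nn_integral_mono_AE)
    show "AE w in M. ennreal (?G w)
       \<le> liminf (\<lambda>k. f (r k) w)"
      using r(2) AE_space
    proof eventually_elim
      case (elim w)
      let ?Z = "\<lambda>k. ?q (r k) w + ennreal (norm (?I (r k) t w - Jt w)) + ennreal (norm (?I (r k) s w - Js w))"
      have dom: "Z \<longlonglongrightarrow> 0" if "\<And>k. Z k \<le> ?Z k" for Z :: "nat \<Rightarrow> ennreal"
        by (rule tendsto_sandwich[OF _ _ tendsto_const elim(1)]) (use that in auto)
      have q0: "(\<lambda>k. ?q (r k) w) \<longlonglongrightarrow> 0" by (rule dom) (simp add: add.assoc)
      have "(\<lambda>k. ennreal (norm (?I (r k) t w - Jt w))) \<longlonglongrightarrow> ennreal 0"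
        unfolding ennreal_0 by (rule dom) (simp add: add_increasing add_increasing2)
      then have "(\<lambda>k. norm (?I (r k) t w - Jt w)) \<longlonglongrightarrow> 0" by (subst (asm) tendsto_ennreal_iff) auto
      then have It: "(\<lambda>k. ?I (r k) t w) \<longlonglongrightarrow> Jt w" by (simp add: LIM_zero_iff tendsto_norm_zero_iff)
      have "(\<lambda>k. ennreal (norm (?I (r k) s w - Js w))) \<longlonglongrightarrow> ennreal 0"
        unfolding ennreal_0 by (rule dom) (simp add: add_increasing)
      then have "(\<lambda>k. norm (?I (r k) s w - Js w)) \<longlonglongrightarrow> 0" by (subst (asm) tendsto_ennreal_iff) auto
      then have Is: "(\<lambda>k. ?I (r k) s w) \<longlonglongrightarrow> Js w" by (simp add: LIM_zero_iff tendsto_norm_zero_iff)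
      have qr: "(\<lambda>k. enn2real (?q (r k) w)) \<longlonglongrightarrow> 0"
        using tendsto_enn2real[OF q0[folded ennreal_0]] by simp
      \<comment> \<open>\<open>?f'\<close> replaces the energy in \<open>f\<close> by its upper
        bound. The bound converges, while the energies are only known to be dominated by it.\<close>
      let ?f' = "\<lambda>k. ennreal (Y w * exp (\<theta> w \<bullet> (?I (r k) t w - ?I (r k) s w)
          - (norm (\<theta> w))\<^sup>2 * (A\<^sup>2 * (t - s) + enn2real (?q (r k) w))))"
      have "?f' \<longlonglongrightarrow> ennreal (Y w * exp (\<theta> w \<bullet> (Jt w - Js w) - (norm (\<theta> w))\<^sup>2 * (A\<^sup>2 * (t - s) + 0)))"
        by (intro tendsto_ennrealI tendsto_intros It Is qr)
      then have "ennreal (?G w) = liminf ?f'"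
        by (intro lim_imp_Liminf[symmetric]) auto
      also have "\<dots> \<le> liminf (\<lambda>k. f (r k) w)"
      proof (rule Liminf_mono)
        have "\<forall>\<^sub>F k in sequentially. ?q (r k) w < 1" using q0 by (rule order_tendstoD) simp
        then show "\<forall>\<^sub>F k in sequentially. ?f' k \<le> f (r k) w"
        proof eventually_elim
          case (elim k)
          define x where "x = enn2real (?q (r k) w)"
          have x: "?q (r k) w = ennreal x" "x \<ge> 0"
            unfolding x_def using elim by (auto intro!: ennreal_enn2real[symmetric] intro: less_trans)
          have "ennreal (step_energy (u (r k)) (N (r k)) (?E (r k)) w) \<le> ennreal (2 * A\<^sup>2 * (t - s)) + (ennreal x + ennreal x)"
            using energy[OF \<open>w \<in> space M\<close>, of "r k"] unfolding x(1) .
          also have "\<dots> = ennreal (2 * A\<^sup>2 * (t - s) + (x + x))"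
            using x st by (simp only: ennreal_plus add_nonneg_nonneg zero_le_power2 mult_nonneg_nonneg zero_le_numeral diff_ge_0_iff_ge less_imp_le)
          finally have le: "step_energy (u (r k)) (N (r k)) (?E (r k)) w \<le> 2 * (A\<^sup>2 * (t - s) + x)"
            using x st by (subst (asm) ennreal_le_iff) (auto intro!: add_nonneg_nonneg mult_nonneg_nonneg)
          have "(norm (\<theta> w))\<^sup>2 / 2 * step_energy (u (r k)) (N (r k)) (?E (r k)) w \<le> (norm (\<theta> w))\<^sup>2 / 2 * (2 * (A\<^sup>2 * (t - s) + x))"
            using le by (rule mult_left_mono) simp
          also have "\<dots> = (norm (\<theta> w))\<^sup>2 * (A\<^sup>2 * (t - s) + x)" by simp
          finally show ?case unfolding f_def u(4) x_def[symmetric]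
            by (intro ennreal_leI mult_left_mono exp_le_cancel_iff[THEN iffD2] diff_left_mono Y0)
        qed
      qed
      finally show ?case .
    qed
  qed
  also have "\<dots> \<le> liminf (\<lambda>k. \<integral>\<^sup>+w. f (r k) w \<partial>M)" by (rule nn_integral_liminf) (rule fm)
  also have "\<dots> \<le> liminf (\<lambda>k. \<integral>\<^sup>+w. ennreal (Y w) \<partial>M)" by (rule Liminf_mono) (simp add: fI)
  finally show ?thesis by (simp add: Liminf_const)
qed

section \<open>Discrete exponential supermartingales\<close>

text \<open>The square is linearised by \<open>exp (\<beta> V\<^sup>2) = E exp (sqrt (2 \<beta>) g V)\<close> with \<open>g\<close> an
  independent standard Gaussian.\<close>
lemma subgaussian_square_exp:
  fixes V Y :: "'w \<Rightarrow> real"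
  assumes "prob_space M" and V[measurable]: "V \<in> borel_measurable M" and Y[measurable]: "Y \<in> borel_measurable M"
    and Y0: "\<And>w. 0 \<le> Y w" and v: "0 \<le> v" and \<beta>: "0 \<le> \<beta>" and small: "4 * \<beta> * v \<le> 1 / 2"
    and sub: "\<And>u. (\<integral>\<^sup>+w. ennreal (Y w * exp (u * V w - u\<^sup>2 * v)) \<partial>M) \<le> (\<integral>\<^sup>+w. ennreal (Y w) \<partial>M)"
  shows "(\<integral>\<^sup>+w. ennreal (Y w * exp (\<beta> * (V w)\<^sup>2 - 4 * \<beta> * v)) \<partial>M) \<le> (\<integral>\<^sup>+w. ennreal (Y w) \<partial>M)"
proof -
  let ?I = "\<integral>\<^sup>+w. ennreal (Y w) \<partial>M"
  let ?a = "\<lambda>w. \<beta> * (V w)\<^sup>2"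
  interpret prob_space M by fact
  interpret pair_sigma_finite lborel M by standard
  \<comment> \<open>Averaging over g meets the factor exp ((r g)^2 v) = exp (x g^2 / 2). It turns
    the standard Gaussian density into s times the centred one of variance s^2 = 1 / (1 -
    x).\<close>
  define x where "x = 4 * \<beta> * v"
  have x: "0 \<le> x" "x \<le> 1 / 2" using v \<beta> small by (auto simp: x_def)
  define s where "s = 1 / sqrt (1 - x)"
  have s: "s > 0" using x by (simp add: s_def)
  have s2: "s\<^sup>2 = 1 / (1 - x)" using x by (simp add: s_def power_divide)
  \<comment> \<open>For 0 \<le> x \<le> 1 / 2 the product (1 - x) (1 + 2 x) is at least 1, so s^2
    \<le> exp (2 x). This is the origin of the compensator 4 \<beta> v.\<close>
  have sx: "s \<le> exp x"
  proof -
    have "1 + 2 * x \<le> exp (2 * x)" by (rule exp_ge_add_one_self)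
    then have "(1 - x) * (1 + 2 * x) \<le> (1 - x) * exp (2 * x)" using x by (intro mult_left_mono) auto
    moreover have "1 \<le> (1 - x) * (1 + 2 * x)"
    proof -
      have "x * x \<le> x * (1 / 2)" using x by (intro mult_left_mono) auto
      then show ?thesis by (simp add: algebra_simps)
    qed
    ultimately have "1 \<le> exp (2 * x) * (1 - x)" by (simp only: mult.commute[of "exp (2 * x)"])
    then have "1 / (1 - x) \<le> exp (2 * x)" using x by (subst divide_le_eq) auto
    then have "s\<^sup>2 \<le> (exp x)\<^sup>2" by (simp add: s2 exp_double)
    then show ?thesis by (rule power2_le_imp_le) simp
  qed
  define r where "r = sqrt (2 * \<beta>)"
  have r2: "r\<^sup>2 = 2 * \<beta>" using \<beta> by (simp add: r_def)
  have "(\<integral>\<^sup>+w. ennreal (Y w * exp (?a w)) \<partial>M)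
    = (\<integral>\<^sup>+w. (\<integral>\<^sup>+g. ennreal (std_normal_density g) * ennreal (Y w * exp (r * g * V w)) \<partial>lborel) \<partial>M)"
  proof (rule nn_integral_cong)
    fix w
    have "(\<integral>\<^sup>+g. ennreal (std_normal_density g) * ennreal (Y w * exp (r * g * V w)) \<partial>lborel)
      = (\<integral>\<^sup>+g. ennreal (Y w) * ennreal (exp ((r * V w) * g) * std_normal_density g) \<partial>lborel)"
      using Y0[of w] by (intro nn_integral_cong) (simp add: ennreal_mult'[symmetric] ennreal_mult''[symmetric] mult_ac)
    also have "\<dots> = ennreal (Y w) * ennreal (exp ((r * V w)\<^sup>2 * 1\<^sup>2 / 2))"
      by (subst nn_integral_cmult) (simp_all only: gaussian_mgf zero_less_one, measurable)
    also have "(r * V w)\<^sup>2 * 1\<^sup>2 / 2 = ?a w" by (simp add: power_mult_distrib r2)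
    finally show "ennreal (Y w * exp (?a w)) = (\<integral>\<^sup>+g. ennreal (std_normal_density g) * ennreal (Y w * exp (r * g * V w)) \<partial>lborel)"
      using Y0[of w] by (simp add: ennreal_mult)
  qed
  also have "\<dots> = (\<integral>\<^sup>+g. (\<integral>\<^sup>+w. ennreal (std_normal_density g) * ennreal (Y w * exp (r * g * V w)) \<partial>M) \<partial>lborel)"
    by (rule Fubini') measurable
  also have "\<dots> \<le> (\<integral>\<^sup>+g. ennreal (s * normal_density 0 s g) * ?I \<partial>lborel)"
  proof (rule nn_integral_mono)
    fix g :: real
    define c where "c = (r * g)\<^sup>2 * v"
    have "(\<integral>\<^sup>+w. ennreal (std_normal_density g) * ennreal (Y w * exp (r * g * V w)) \<partial>M)
      = (\<integral>\<^sup>+w. ennreal (std_normal_density g * exp c) * ennreal (Y w * exp (r * g * V w - (r * g)\<^sup>2 * v)) \<partial>M)"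
    proof (rule nn_integral_cong)
      fix w
      have "exp (r * g * V w) = exp c * exp (r * g * V w - (r * g)\<^sup>2 * v)"
        unfolding mult_exp_exp by (simp add: c_def)
      then have "std_normal_density g * (Y w * exp (r * g * V w))
          = (std_normal_density g * exp c) * (Y w * exp (r * g * V w - (r * g)\<^sup>2 * v))" by simp
      then show "ennreal (std_normal_density g) * ennreal (Y w * exp (r * g * V w)) = ennreal (std_normal_density g * exp c) * ennreal (Y w * exp (r * g * V w - (r * g)\<^sup>2 * v))"
        using Y0[of w] by (simp only: ennreal_mult[symmetric] normal_density_nonneg mult_nonneg_nonneg exp_ge_zero)
    qed
    also have "\<dots> = ennreal (std_normal_density g * exp c) * (\<integral>\<^sup>+w. ennreal (Y w * exp (r * g * V w - (r * g)\<^sup>2 * v)) \<partial>M)"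
      by (rule nn_integral_cmult) measurable
    also have "\<dots> \<le> ennreal (std_normal_density g * exp c) * ?I"
      by (intro mult_left_mono sub) simp
    also have "std_normal_density g * exp c = s * normal_density 0 s g"
    proof -
      have "- (g - 0)\<^sup>2 / (2 * 1\<^sup>2) + c = - (g - 0)\<^sup>2 / (2 * s\<^sup>2)"
        using x unfolding c_def s2 power_mult_distrib r2 x_def by (simp add: field_simps)
      moreover have "1 / sqrt (2 * pi * 1\<^sup>2) = s * (1 / sqrt (2 * pi * s\<^sup>2))"
        using s by (simp add: real_sqrt_mult)
      moreover have "std_normal_density g * exp c = 1 / sqrt (2 * pi * 1\<^sup>2) * exp (- (g - 0)\<^sup>2 / (2 * 1\<^sup>2) + c)"
        unfolding normal_density_def by (simp only: mult.assoc mult_exp_exp)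
      ultimately show ?thesis unfolding normal_density_def by (simp only: mult.assoc)
    qed
    finally show "(\<integral>\<^sup>+w. ennreal (std_normal_density g) * ennreal (Y w * exp (r * g * V w)) \<partial>M)
      \<le> ennreal (s * normal_density 0 s g) * ?I" .
  qed
  also have "\<dots> = ennreal s * ?I"
  proof -
    have "(\<integral>\<^sup>+g. ennreal (normal_density 0 s g) \<partial>lborel) = 1"
      using gaussian_mgf[OF s, of 0] by simp
    then have "(\<integral>\<^sup>+g. ennreal (s * normal_density 0 s g) \<partial>lborel) = ennreal s"
      using s by (simp add: ennreal_mult normal_density_nonneg nn_integral_cmult)
    then show ?thesis by (subst nn_integral_multc) simp_all
  qed
  finally have 1: "(\<integral>\<^sup>+w. ennreal (Y w * exp (?a w)) \<partial>M) \<le> ennreal s * ?I" .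
  have "(\<integral>\<^sup>+w. ennreal (Y w * exp (?a w - 4 * \<beta> * v)) \<partial>M)
     = (\<integral>\<^sup>+w. ennreal (exp (- x)) * ennreal (Y w * exp (?a w)) \<partial>M)"
  proof (rule nn_integral_cong)
    fix w
    have "exp (?a w - 4 * \<beta> * v) = exp (- x) * exp (?a w)"
      unfolding mult_exp_exp by (simp add: x_def)
    then have "Y w * exp (?a w - 4 * \<beta> * v) = exp (- x) * (Y w * exp (?a w))" by simp
    then show "ennreal (Y w * exp (?a w - 4 * \<beta> * v)) = ennreal (exp (- x)) * ennreal (Y w * exp (?a w))"
      using Y0[of w] by (simp only: ennreal_mult mult_nonneg_nonneg exp_ge_zero)
  qed
  also have "\<dots> = ennreal (exp (- x)) * (\<integral>\<^sup>+w. ennreal (Y w * exp (?a w)) \<partial>M)"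
    by (rule nn_integral_cmult) measurable
  also have "\<dots> \<le> ennreal (exp (- x)) * (ennreal s * ?I)"
    using 1 by (intro mult_left_mono) auto
  also have "\<dots> = ennreal (exp (- x) * s) * ?I"
    using s by (simp add: ennreal_mult mult.assoc)
  also have "\<dots> \<le> ennreal 1 * ?I"
  proof (intro mult_right_mono ennreal_leI)
    have "exp (- x) * s \<le> exp (- x) * exp x" using sx by (intro mult_left_mono) auto
    then show "exp (- x) * s \<le> 1" by (simp add: mult_exp_exp)
  qed simp
  finally show ?thesis by simp
qed

text \<open>Jensen's inequality, by the tangent of exp at the mean.\<close>

lemma exp_mean_le:
  fixes x :: "'i \<Rightarrow> real"
  assumes "finite I" "I \<noteq> {}"
  shows "exp ((\<Sum>i\<in>I. x i) / card I) \<le> (\<Sum>i\<in>I. exp (x i)) / card I"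
proof -
  define m where "m = (\<Sum>i\<in>I. x i) / card I"
  have c: "real (card I) > 0" using assms by (simp add: card_gt_0_iff)
  have "exp m * (1 + (x i - m)) \<le> exp (x i)" for i
    using mult_left_mono[OF exp_ge_add_one_self[of "x i - m"], of "exp m"] by (simp add: mult_exp_exp)
  then have "(\<Sum>i\<in>I. exp m * (1 + (x i - m))) \<le> (\<Sum>i\<in>I. exp (x i))" by (rule sum_mono)
  moreover have "(\<Sum>i\<in>I. exp m * (1 + (x i - m))) = exp m * card I"
    using c by (simp add: sum_distrib_left[symmetric] sum.distrib sum_subtractf m_def)
  ultimately show ?thesis using c by (simp add: m_def[symmetric] field_simps)
qed

text \<open>The exponent is the average of n terms, one linear in d and one square per coordinate,
  each enlarged n times. By Jensen the exponential is at most the average of n exponentials that are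
  treated separately, so correlations between the coordinates do not matter. The linear term needs
  the compensator (2 n \<alpha>)^2 |z|^2 A^2 h and each square needs 4 n \<alpha> A^2 h, which
  explains the two constants.\<close>

lemma energy_increment_exp:
  fixes d z :: "'w \<Rightarrow> real^'d" and \<alpha> h A :: real
  defines "n \<equiv> real CARD('d) + 1"
  assumes M: "prob_space M" and G: "subalgebra M G"
    and d[measurable]: "d \<in> borel_measurable M" and z: "z \<in> borel_measurable G"
    and Y: "Y \<in> borel_measurable G" and Y0: "\<And>w. 0 \<le> Y w"
    and E: "\<And>Y \<theta>. Y \<in> borel_measurable G \<Longrightarrow> (\<And>w. 0 \<le> Y w) \<Longrightarrow> \<theta> \<in> borel_measurable G \<Longrightarrow>
      (\<integral>\<^sup>+w. ennreal (Y w * exp (\<theta> w \<bullet> d w - (norm (\<theta> w))\<^sup>2 * (A\<^sup>2 * h))) \<partial>M) \<le> (\<integral>\<^sup>+w. ennreal (Y w) \<partial>M)"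
    and h: "0 \<le> h" and \<alpha>: "0 \<le> \<alpha>" and small: "4 * (n * \<alpha>) * (A\<^sup>2 * h) \<le> 1 / 2"
  shows "(\<integral>\<^sup>+w. ennreal (Y w * exp (\<alpha> * (2 * (z w \<bullet> d w) + (norm (d w))\<^sup>2)
      - h * (4 * n\<^sup>2 * A\<^sup>2 * \<alpha>\<^sup>2 * (norm (z w))\<^sup>2 + 4 * n * A\<^sup>2 * \<alpha>))) \<partial>M)
    \<le> (\<integral>\<^sup>+w. ennreal (Y w) \<partial>M)"
proof -
  interpret prob_space M by fact
  have [measurable]: "z \<in> borel_measurable M" "Y \<in> borel_measurable M"
    using z Y measurable_from_subalg[OF G] by blast+
  have n: "n > 0" by (simp add: n_def add_nonneg_pos)
  \<comment> \<open>\<open>None\<close> stands for the linear term and \<open>Some i\<close> for the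
    square of coordinate i; \<open>c\<close> lists the matching compensators.\<close>
  define a where "a = (\<lambda>w (i::'d option). case i of None \<Rightarrow> (2 * n * \<alpha>) * (z w \<bullet> d w) | Some i \<Rightarrow> (n * \<alpha>) * (d w $ i)\<^sup>2)"
  define c where "c = (\<lambda>w (i::'d option). case i of None \<Rightarrow> (norm ((2 * n * \<alpha>) *\<^sub>R z w))\<^sup>2 * (A\<^sup>2 * h) | Some i \<Rightarrow> 4 * (n * \<alpha>) * (A\<^sup>2 * h))"
  let ?I = "\<integral>\<^sup>+w. ennreal (Y w) \<partial>M"
  let ?q = "\<lambda>w. h * (4 * n\<^sup>2 * A\<^sup>2 * \<alpha>\<^sup>2 * (norm (z w))\<^sup>2 + 4 * n * A\<^sup>2 * \<alpha>)"
  let ?s = "\<lambda>w. \<alpha> * (2 * (z w \<bullet> d w) + (norm (d w))\<^sup>2)"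
  have U: "(\<Sum>i\<in>UNIV. g i) = g None + (\<Sum>i\<in>(UNIV::'d set). g (Some i))" for g :: "'d option \<Rightarrow> 'b::comm_monoid_add"
    by (simp add: UNIV_option_conv sum.reindex)
  have card: "real (card (UNIV :: 'd option set)) = n" by (simp add: n_def)
  have dm[measurable]: "(\<lambda>w. d w $ j) \<in> borel_measurable M" for j
    using borel_measurable_inner[OF d borel_measurable_const[of "axis j 1"]] by (simp add: inner_axis)
  have am[measurable]: "(\<lambda>w. a w i) \<in> borel_measurable M" "(\<lambda>w. c w i) \<in> borel_measurable M" for i
    unfolding a_def c_def by (cases i; simp only: option.case; measurable)+
  have sum_a: "(\<Sum>i\<in>UNIV. a w i) / n = ?s w" for w
  proof -
    have "(norm (d w))\<^sup>2 = (\<Sum>i\<in>UNIV. (d w $ i)\<^sup>2)"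
      unfolding power2_norm_eq_inner inner_vec_def by (simp add: power2_eq_square)
    then show ?thesis unfolding U a_def using n by (simp add: sum_distrib_left[symmetric] field_simps)
  qed
  \<comment> \<open>One compensator must serve all terms; the sum of the two kinds dominates each of
    them.\<close>
  have c_le: "c w i \<le> ?q w" for w i
  proof -
    have 1: "0 \<le> h * (4 * n\<^sup>2 * A\<^sup>2 * \<alpha>\<^sup>2 * (norm (z w))\<^sup>2)" "0 \<le> h * (4 * n * A\<^sup>2 * \<alpha>)" using h n \<alpha> by auto
    show ?thesis
    proof (cases i)
      case None
      then have "c w i = h * (4 * n\<^sup>2 * A\<^sup>2 * \<alpha>\<^sup>2 * (norm (z w))\<^sup>2)" by (simp add: c_def power_mult_distrib)
      then show ?thesis using 1 by (simp only: distrib_left)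
    next
      case (Some j)
      then have "c w i = h * (4 * n * A\<^sup>2 * \<alpha>)" by (simp add: c_def)
      then show ?thesis using 1 by (simp only: distrib_left)
    qed
  qed
  have part: "(\<integral>\<^sup>+w. ennreal (Y w * exp (a w i - c w i)) \<partial>M) \<le> ?I" for i
  proof (cases i)
    case None
    have "(\<lambda>w. (2 * n * \<alpha>) *\<^sub>R z w) \<in> borel_measurable G" using z by measurable
    from E[OF Y Y0 this] show ?thesis by (simp add: None a_def c_def)
  next
    case (Some j)
    have "(\<integral>\<^sup>+w. ennreal (Y w * exp ((n * \<alpha>) * (d w $ j)\<^sup>2 - 4 * (n * \<alpha>) * (A\<^sup>2 * h))) \<partial>M) \<le> ?I"
    proof (rule subgaussian_square_exp[OF M _ _ Y0 _ _ small])
      fix u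
      show "(\<integral>\<^sup>+w. ennreal (Y w * exp (u * d w $ j - u\<^sup>2 * (A\<^sup>2 * h))) \<partial>M) \<le> ?I"
        using E[OF Y Y0, of "\<lambda>_. u *\<^sub>R axis j 1"] by (simp add: inner_axis' power_mult_distrib)
    qed (use h n \<alpha> Y measurable_from_subalg[OF G] in auto)
    then show ?thesis by (simp add: Some a_def c_def)
  qed
  have "(\<integral>\<^sup>+w. ennreal (Y w * exp (?s w
      - ?q w)) \<partial>M)
    \<le> (\<integral>\<^sup>+w. (\<Sum>i\<in>UNIV. ennreal (1 / n) * ennreal (Y w * exp (a w i - c w i))) \<partial>M)"
  proof (rule nn_integral_mono)
    fix w
    define q where "q = ?q w"
    have "exp ((\<Sum>i\<in>UNIV. a w i) / n) \<le> (\<Sum>i\<in>UNIV. exp (a w i)) / n"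
      using exp_mean_le[of UNIV "a w"] unfolding card by simp
    then have "exp (- q) * exp ((\<Sum>i\<in>UNIV. a w i) / n) \<le> exp (- q) * ((\<Sum>i\<in>UNIV. exp (a w i)) / n)"
      by (intro mult_left_mono) auto
    then have "exp (?s w - q) \<le> (\<Sum>i\<in>UNIV. exp (a w i - q)) / n"
      unfolding sum_a mult_exp_exp by (simp add: sum_distrib_left mult_exp_exp)
    also have "\<dots> \<le> (\<Sum>i\<in>UNIV. exp (a w i - c w i)) / n"
      using n c_le[of w] by (intro divide_right_mono sum_mono) (auto simp: q_def)
    finally have "Y w * exp (?s w - q) \<le> Y w * ((\<Sum>i\<in>UNIV. exp (a w i - c w i)) / n)"
      using Y0 by (intro mult_left_mono) auto
    also have "\<dots> = (\<Sum>i\<in>UNIV. 1 / n * (Y w * exp (a w i - c w i)))"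
      by (simp add: sum_distrib_left sum_divide_distrib)
    finally have "ennreal (Y w * exp (?s w - q))
       \<le> ennreal (\<Sum>i\<in>UNIV. 1 / n * (Y w * exp (a w i - c w i)))" by (rule ennreal_leI)
    also have "\<dots> = (\<Sum>i\<in>UNIV. ennreal (1 / n * (Y w * exp (a w i - c w i))))"
      using n Y0 by (intro sum_ennreal[symmetric]) auto
    also have "\<dots> = (\<Sum>i\<in>UNIV. ennreal (1 / n) * ennreal (Y w * exp (a w i - c w i)))"
      using n Y0 by (intro sum.cong refl ennreal_mult) auto
    finally show "ennreal (Y w * exp (?s w
      - ?q w))
      \<le> (\<Sum>i\<in>UNIV. ennreal (1 / n) * ennreal (Y w * exp (a w i - c w i)))" unfolding q_def .
  qed
  also have "\<dots> = (\<Sum>i\<in>UNIV. ennreal (1 / n) * (\<integral>\<^sup>+w. ennreal (Y w * exp (a w i - c w i)) \<partial>M))"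
    by (subst nn_integral_sum, measurable) (intro sum.cong refl nn_integral_cmult, measurable)
  also have "\<dots> \<le> (\<Sum>i\<in>(UNIV :: 'd option set). ennreal (1 / n) * ?I)"
    by (intro sum_mono mult_left_mono part) simp
  also have "\<dots> = (of_nat (card (UNIV :: 'd option set)) * ennreal (1 / n)) * ?I"
    by (simp add: mult.assoc)
  also have "of_nat (card (UNIV :: 'd option set)) * ennreal (1 / n) = 1"
    unfolding ennreal_of_nat_eq_real_of_nat card using n ennreal_mult[of n "1 / n"] by simp
  finally show ?thesis by simp
qed

text \<open>With \<open>R\<close> the running maximum of \<open>exp (S\<^sub>k / 2)\<close>, the process \<open>R + exp S / R\<close> is a
  supermartingale: when the maximum moves to \<open>r\<close>, its new value is \<open>2 r \<le> R + r\<^sup>2 / R\<close>.\<close>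
lemma exp_half_maximal_inequality:
  fixes D :: "nat \<Rightarrow> 'w \<Rightarrow> real"
  assumes M: "prob_space M" and G: "\<And>j. j \<le> N \<Longrightarrow> subalgebra M (G j)"
    and mono: "\<And>j. j < N \<Longrightarrow> subalgebra (G (Suc j)) (G j)"
    and D: "\<And>j. j < N \<Longrightarrow> D j \<in> borel_measurable (G (Suc j))"
    and E: "\<And>j Y. j < N \<Longrightarrow> Y \<in> borel_measurable (G j) \<Longrightarrow> (\<And>w. 0 \<le> Y w) \<Longrightarrow>
      (\<integral>\<^sup>+w. ennreal (Y w * exp (D j w)) \<partial>M) \<le> (\<integral>\<^sup>+w. ennreal (Y w) \<partial>M)"
  obtains R where "R \<in> borel_measurable M" "\<And>w k. k \<le> N \<Longrightarrow> exp ((\<Sum>j<k. D j w) / 2) \<le> R w"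
    "(\<integral>\<^sup>+w. ennreal (R w) \<partial>M) \<le> 2"
proof -
  interpret prob_space M by fact
  define S where "S = (\<lambda>k w. \<Sum>j<k. D j w)"
  define R where "R = rec_nat (\<lambda>_. 1) (\<lambda>k R w. max (R w) (exp (S (Suc k) w / 2)))"
  have R0: "R 0 = (\<lambda>_. 1)" and RS: "R (Suc k) = (\<lambda>w. max (R k w) (exp (S (Suc k) w / 2)))" for k
    by (simp_all add: R_def)
  have R1: "1 \<le> R k w" for k w by (induction k) (auto simp: R0 RS)
  have ge: "exp (S k w / 2) \<le> R l w" if "k \<le> l" for k l w
    using that
  proof (induction l)
    case 0 then show ?case by (simp add: R0 S_def)
  next
    case (Suc l) then show ?case by (cases "k = Suc l") (auto simp: RS intro: max.coboundedI1)
  qed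
  have meas: "S k \<in> borel_measurable (G k) \<and> R k \<in> borel_measurable (G k)" if "k \<le> N" for k
    using that
  proof (induction k)
    case 0 then show ?case by (simp add: S_def R0)
  next
    case (Suc k)
    have "S k \<in> borel_measurable (G (Suc k))" "R k \<in> borel_measurable (G (Suc k))"
      using Suc measurable_from_subalg[OF mono[of k]] by auto
    note [measurable] = this D[of k]
    have "S (Suc k) = (\<lambda>w. S k w + D k w)" by (simp add: S_def)
    then have [measurable]: "S (Suc k) \<in> borel_measurable (G (Suc k))" using Suc.prems by simp
    show ?case unfolding RS by measurable
  qed
  have I: "(\<integral>\<^sup>+w. ennreal (R k w + exp (S k w) / R k w) \<partial>M) \<le> 2" if "k \<le> N" for k
    using that
  proof (induction k)
    \<comment> \<open>Initially the maximum and the quotient are both 1, whence the bound 2.\<close>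
    case 0
    then show ?case by (simp add: R0 S_def emeasure_space_1)
  next
    case (Suc k)
    have k: "k < N" using Suc.prems by simp
    note [measurable] = meas[THEN conjunct1, of k] meas[THEN conjunct2, of k]
    \<comment> \<open>While the maximum is frozen, the quotient evolves by the factor exp (D k), so
      \<open>E\<close> applies with this quotient as the weight.\<close>
    define Y where "Y = (\<lambda>w. exp (S k w) / R k w)"
    have Y0: "0 \<le> Y w" for w unfolding Y_def using R1[of k w] by simp
    have YG: "Y \<in> borel_measurable (G k)" "R k \<in> borel_measurable (G k)" unfolding Y_def using k by auto
    note [measurable] = measurable_from_subalg[OF G[OF less_imp_le[OF k]] YG(1)]
      measurable_from_subalg[OF G[OF less_imp_le[OF k]] YG(2)] measurable_from_subalg[OF G[OF Suc_leI[OF k]] D[OF k]]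
    have "(\<integral>\<^sup>+w. ennreal (R (Suc k) w + exp (S (Suc k) w) / R (Suc k) w) \<partial>M)
       \<le> (\<integral>\<^sup>+w. ennreal (R k w) + ennreal (Y w * exp (D k w)) \<partial>M)"
    proof (rule nn_integral_mono)
      fix w
      define r where "r = exp (S (Suc k) w / 2)"
      have r2: "exp (S (Suc k) w) = r\<^sup>2" unfolding r_def by (simp add: exp_double[symmetric])
      have Rk: "R k w \<ge> 1" by (rule R1)
      have YD: "Y w * exp (D k w) = r\<^sup>2 / R k w"
        unfolding r2[symmetric] Y_def by (simp add: S_def exp_add)
      have "R (Suc k) w + r\<^sup>2 / R (Suc k) w \<le> R k w + r\<^sup>2 / R k w"
      proof (cases "r \<le> R k w")
        case True then show ?thesis by (simp add: RS r_def[symmetric])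
      next
        case False
        have "0 \<le> (R k w - r)\<^sup>2" by simp
        then have "2 * r * R k w \<le> R k w * R k w + r\<^sup>2" by (simp add: power2_diff power2_eq_square algebra_simps)
        then have "2 * r \<le> R k w + r\<^sup>2 / R k w" using Rk by (simp add: field_simps)
        then show ?thesis using False Rk by (simp add: RS r_def[symmetric] power2_eq_square)
      qed
      then have "ennreal (R (Suc k) w + exp (S (Suc k) w) / R (Suc k) w) \<le> ennreal (R k w + Y w * exp (D k w))"
        unfolding r2 YD by (rule ennreal_leI)
      also have "\<dots> = ennreal (R k w) + ennreal (Y w * exp (D k w))" using Rk Y0[of w] by (intro ennreal_plus) auto
      finally show "ennreal (R (Suc k) w + exp (S (Suc k) w) / R (Suc k) w) \<le> ennreal (R k w) + ennreal (Y w * exp (D k w))" .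
    qed
    also have "\<dots> = (\<integral>\<^sup>+w. ennreal (R k w) \<partial>M) + (\<integral>\<^sup>+w. ennreal (Y w * exp (D k w)) \<partial>M)"
      by (rule nn_integral_add) measurable
    also have "\<dots> \<le> (\<integral>\<^sup>+w. ennreal (R k w) \<partial>M) + (\<integral>\<^sup>+w. ennreal (Y w) \<partial>M)"
      by (intro add_left_mono E[OF k YG(1) Y0])
    also have "\<dots> = (\<integral>\<^sup>+w. ennreal (R k w) + ennreal (Y w) \<partial>M)"
      by (rule nn_integral_add[symmetric]) measurable
    also have "\<dots> = (\<integral>\<^sup>+w. ennreal (R k w + exp (S k w) / R k w) \<partial>M)"
      using Y0 R1 unfolding Y_def by (intro nn_integral_cong ennreal_plus[symmetric]) (auto intro: order_trans[OF zero_le_one])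
    also have "\<dots> \<le> 2" using Suc by simp
    finally show ?case .
  qed
  show ?thesis
  proof (rule that[of "R N"])
    show "R N \<in> borel_measurable M"
      by (rule measurable_from_subalg[OF G[OF order_refl] conjunct2[OF meas[OF order_refl]]])
    show "exp ((\<Sum>j<k. D j w) / 2) \<le> R N w" if "k \<le> N" for w k using ge[OF that] by (simp add: S_def)
    have "(\<integral>\<^sup>+w. ennreal (R N w) \<partial>M) \<le> (\<integral>\<^sup>+w. ennreal (R N w + exp (S N w) / R N w) \<partial>M)"
      using R1[of N] by (intro nn_integral_mono ennreal_leI) (auto intro!: divide_nonneg_nonneg intro: order_trans[OF zero_le_one])
    also have "\<dots> \<le> 2" by (rule I) simp
    finally show "(\<integral>\<^sup>+w. ennreal (R N w) \<partial>M) \<le> 2" .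
  qed
qed

section \<open>The Gaussian moment of the solution\<close>

text \<open>The sampling times stay in [0, t], so the drift integral becomes a limit of F t
  measurable sums in \<open>sde_noise_adapted\<close>.\<close>

lemma riemann_left_sums_tendsto:
  fixes f :: "real \<Rightarrow> 'a::euclidean_space"
  assumes t: "0 \<le> t" and f: "continuous_on {0..t} f"
  shows "(\<lambda>N. \<Sum>j<N. (t / N) *\<^sub>R f (real j * t / N)) \<longlonglongrightarrow> integral {0..t} f"
proof (rule LIMSEQ_I)
  fix e :: real assume e: "e > 0"
  define \<eta> where "\<eta> = e / (t + 1)"
  have \<eta>: "\<eta> > 0" using e t by (simp add: \<eta>_def)
  have \<eta>t: "t * \<eta> < e" using e t by (simp add: \<eta>_def field_simps)
  have "uniformly_continuous_on {0..t} f" by (intro compact_uniformly_continuous f compact_Icc)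
  from this[unfolded uniformly_continuous_on_def, rule_format, OF \<eta>]
  obtain d where d: "d > 0" "\<And>x y. x \<in> {0..t} \<Longrightarrow> y \<in> {0..t} \<Longrightarrow> dist y x < d \<Longrightarrow> dist (f y) (f x) < \<eta>" by blast
  obtain K :: nat where K: "t / d < K" using reals_Archimedean2 by blast
  have "norm ((\<Sum>j<N. (t / N) *\<^sub>R f (real j * t / N)) - integral {0..t} f) < e" if N: "N \<ge> Suc K" for N
  proof -
    have N0: "N > 0" using N by simp
    define h where "h = t / N"
    have h: "h \<ge> 0" "h < d"
    proof -
      have "t / d < N" using K N by linarith
      then show "h < d" using d N0 by (simp add: h_def field_simps)
    qed (use t in \<open>simp add: h_def\<close>)
    have tI: "real k * t / N \<in> {0..t}" if "k \<le> N" for k :: nat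
      using mult_right_mono[of "real k" N t] that t N0 by (auto simp: divide_le_eq mult.commute)
    have "norm ((\<Sum>j<k. h *\<^sub>R f (real j * t / N)) - integral {0..real k * t / N} f) \<le> real k * h * \<eta>" if "k \<le> N" for k
      using that
    proof (induction k)
      case (Suc k)
      define a where "a = real k * t / N"
      define b where "b = real (Suc k) * t / N"
      have ab: "b = a + h" unfolding a_def b_def h_def by (simp add: distrib_right add_divide_distrib)
      have aI: "a \<in> {0..t}" "b \<in> {0..t}" using tI[of k] tI[of "Suc k"] Suc.prems unfolding a_def b_def by simp_all
      have int: "f integrable_on {p..q}" if "{p..q} \<subseteq> {0..t}" for p q
        by (intro integrable_continuous_interval continuous_on_subset[OF f] that)
      have comb: "integral {0..a} f + integral {a..b} f = integral {0..b} f"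
        using aI ab h by (intro Henstock_Kurzweil_Integration.integral_combine int) auto
      have "integral {a..b} f - h *\<^sub>R f a = integral {a..b} (\<lambda>u. f u - f a)"
        using aI ab h by (subst Henstock_Kurzweil_Integration.integral_diff) (auto intro!: int)
      also have "norm \<dots> \<le> \<eta> * (b - a)"
      proof (rule integral_bound)
        show "a \<le> b" using ab h by simp
        show "continuous_on {a..b} (\<lambda>u. f u - f a)"
          using aI by (intro continuous_intros continuous_on_subset[OF f]) auto
        fix u assume u: "u \<in> {a..b}"
        then have "dist (f u) (f a) < \<eta>" using aI ab h by (intro d) (auto simp: dist_real_def)
        then show "norm (f u - f a) \<le> \<eta>" by (simp add: dist_norm)
      qed
      finally have 1: "norm (h *\<^sub>R f a - integral {a..b} f) \<le> h * \<eta>" using ab by (simp add: norm_minus_commute mult.commute)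
      define S where "S = (\<Sum>j<k. h *\<^sub>R f (real j * t / N))"
      have "norm ((S - integral {0..a} f) + (h *\<^sub>R f a - integral {a..b} f)) \<le> real k * h * \<eta> + h * \<eta>"
        using Suc 1 unfolding a_def S_def by (intro norm_triangle_mono) auto
      also have "(S - integral {0..a} f) + (h *\<^sub>R f a - integral {a..b} f) = (S + h *\<^sub>R f a) - integral {0..b} f"
        by (simp add: comb[symmetric])
      also have "S + h *\<^sub>R f a = (\<Sum>j<Suc k. h *\<^sub>R f (real j * t / N))" by (simp add: S_def a_def)
      finally show ?case unfolding b_def by (simp add: algebra_simps)
    qed simp
    from this[of N] have "norm ((\<Sum>j<N. h *\<^sub>R f (real j * t / N)) - integral {0..t} f) \<le> t * \<eta>"
      using N0 by (simp add: h_def)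
    then show ?thesis using \<eta>t unfolding h_def by linarith
  qed
  then show "\<exists>K. \<forall>N\<ge>K. norm ((\<Sum>j<N. (t / N) *\<^sub>R f (real j * t / N)) - integral {0..t} f) < e" by blast
qed

text \<open>The noise part \<open>X\<^sub>t - x - \<integral>\<^sub>0\<^sup>t b (X) ds\<close> is used in place of the Ito integral, which is only
  given up to null sets and so need not be adapted.\<close>
lemma sde_noise_adapted:
  fixes X :: "real \<Rightarrow> 'w \<Rightarrow> real^'d" and b :: "real^'d \<Rightarrow> real^'d"
  assumes bm: "brownian_motion M F W" and X: "\<And>t. t \<ge> 0 \<Longrightarrow> X t \<in> borel_measurable (F t)"
    and c: "\<And>w. w \<in> space M \<Longrightarrow> continuous_on {0..} (\<lambda>t. X t w)" and b: "continuous_on UNIV b" and t: "t \<ge> 0"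
  shows "(\<lambda>w. X t w - x - integral {0..t} (\<lambda>s. b (X s w))) \<in> borel_measurable (F t)"
proof -
  have sp: "space (F t) = space M" using brownian_motionD(2)[OF bm, of t] by (simp add: subalgebra_def)
  have [measurable]: "b \<in> borel_measurable borel" using b by (rule borel_measurable_continuous_onI)
  have Xs[measurable]: "X s \<in> borel_measurable (F t)" if "0 \<le> s" "s \<le> t" for s
    using measurable_from_subalg[OF brownian_motionD(3)[OF bm that(2)] X[OF that(1)]] .
  have "(\<lambda>w. integral {0..t} (\<lambda>s. b (X s w))) \<in> borel_measurable (F t)"
  proof (rule borel_measurable_LIMSEQ_metric)
    fix N :: nat
    have "(\<lambda>w. b (X (real j * t / N) w)) \<in> borel_measurable (F t)" if "j < N" for j
    proof (rule measurable_compose[OF Xs])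
      show "0 \<le> real j * t / N" "real j * t / N \<le> t" using that t by (auto simp: field_simps mult_left_mono)
    qed measurable
    then show "(\<lambda>w. \<Sum>j<N. (t / N) *\<^sub>R b (X (real j * t / N) w)) \<in> borel_measurable (F t)"
      by (intro borel_measurable_sum borel_measurable_scaleR) auto
  next
    fix w assume "w \<in> space (F t)"
    then have "continuous_on {0..t} (\<lambda>s. X s w)" using c sp by (intro continuous_on_subset[OF c]) auto
    then show "(\<lambda>N. \<Sum>j<N. (t / N) *\<^sub>R b (X (real j * t / N) w)) \<longlonglongrightarrow> integral {0..t} (\<lambda>s. b (X s w))"
      by (intro riemann_left_sums_tendsto[OF t] continuous_on_compose2[OF b]) auto
  qed
  then show ?thesis using X[OF t] by measurable
qed

text \<open>At each fixed time \<open>L\<close> agrees almost surely with a version of the Ito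
  integral, and only the two times s and t occur, so the exceptional null sets do no harm.\<close>

lemma sde_noise_increment_exp:
  fixes X :: "real \<Rightarrow> 'w \<Rightarrow> real^'d" and b :: "real^'d \<Rightarrow> real^'d" and \<sigma> :: "real^'d \<Rightarrow> real^'n^'d"
  assumes sol: "sde_solution M F W \<sigma> b x X" and b: "continuous_on UNIV b" and A: "\<And>x. hs_norm (\<sigma> x) \<le> A"
    and st: "0 \<le> s" "s < t"
    and Y: "Y \<in> borel_measurable (F s)" and Y0: "\<And>w. 0 \<le> Y w" and \<theta>: "\<theta> \<in> borel_measurable (F s)"
  defines "L \<equiv> \<lambda>t w. X t w - x - integral {0..t} (\<lambda>s. b (X s w))"
  shows "(\<integral>\<^sup>+w. ennreal (Y w * exp (\<theta> w \<bullet> (L t w - L s w) - (norm (\<theta> w))\<^sup>2 * (A\<^sup>2 * (t - s)))) \<partial>M)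
     \<le> (\<integral>\<^sup>+w. ennreal (Y w) \<partial>M)"
proof -
  have bm: "brownian_motion M F W" and c: "\<And>w. w \<in> space M \<Longrightarrow> continuous_on {0..} (\<lambda>t. X t w)"
    using sol by (auto simp: sde_solution_def)
  have LJ: "\<exists>J. has_ito_integral M F W (\<lambda>s w. \<sigma> (X s w)) r J \<and> (AE w in M. L r w = J w)" if r: "0 \<le> r" for r
  proof -
    obtain J where J: "has_ito_integral M F W (\<lambda>s w. \<sigma> (X s w)) r J"
      and XJ: "AE w in M. X r w = x + J w + (LBINT s:{0..r}. b (X s w))"
      using sol r unfolding sde_solution_def by blast
    have "AE w in M. L r w = J w"
      using XJ AE_space
    proof eventually_elim
      case (elim w)
      have "continuous_on {0..r} (\<lambda>s. b (X s w))"
        by (intro continuous_on_compose2[OF b] continuous_on_subset[OF c[OF elim(2)]]) auto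
      then have "set_integrable lborel {0..r} (\<lambda>s. b (X s w))" by (rule borel_integrable_atLeastAtMost')
      then have "(LBINT s:{0..r}. b (X s w)) = integral {0..r} (\<lambda>s. b (X s w))" by (rule set_borel_integral_eq_integral)
      then show ?case using elim(1) by (simp add: L_def)
    qed
    with J show ?thesis by blast
  qed
  obtain Js where Js: "has_ito_integral M F W (\<lambda>s w. \<sigma> (X s w)) s Js" "AE w in M. L s w = Js w"
    using LJ[OF st(1)] by blast
  obtain Jt where Jt: "has_ito_integral M F W (\<lambda>s w. \<sigma> (X s w)) t Jt" "AE w in M. L t w = Jt w"
    using LJ[of t] st by auto
  have "(\<integral>\<^sup>+w. ennreal (Y w * exp (\<theta> w \<bullet> (L t w - L s w) - (norm (\<theta> w))\<^sup>2 * (A\<^sup>2 * (t - s)))) \<partial>M)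
    = (\<integral>\<^sup>+w. ennreal (Y w * exp (\<theta> w \<bullet> (Jt w - Js w) - (norm (\<theta> w))\<^sup>2 * (A\<^sup>2 * (t - s)))) \<partial>M)"
    using Js(2) Jt(2) by (intro nn_integral_cong_AE) auto
  also have "\<dots> \<le> (\<integral>\<^sup>+w. ennreal (Y w) \<partial>M)"
    using A by (intro ito_increment_exp[OF bm st Js(1) Jt(1) _ Y Y0 \<theta>]) (simp add: hs_norm_eq_norm)
  finally show ?thesis .
qed

text \<open>The drift along \<open>X - y\<close> is controlled because \<open>y\<close> almost solves \<open>y' = b (y)\<close>, so \<open>y\<close> replaces
  the independent copy of \<open>X\<close> with which the Gaussian moment is usually stated.\<close>
lemma sde_gaussian_moment:
  fixes X :: "real \<Rightarrow> 'w \<Rightarrow> real^'d" and b :: "real^'d \<Rightarrow> real^'d" and \<sigma> :: "real^'d \<Rightarrow> real^'n^'d"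
    and T A B :: real
  defines "n \<equiv> real CARD('d) + 1"
  defines "\<delta> \<equiv> 1 / (8 * n * (A\<^sup>2 + 1) * T)"
  defines "lam \<equiv> 2 * (B + 1) + 4 * n\<^sup>2 * A\<^sup>2 * \<delta>"
  assumes sol: "sde_solution M F W \<sigma> b x X" and b: "continuous_on UNIV b" and A: "\<And>x. hs_norm (\<sigma> x) \<le> A"
    and T: "T > 0" and B: "B \<ge> 0"
    and one: "\<And>x y. (y - x) \<bullet> (b y - b x) \<le> B * (1 + (norm (y - x))\<^sup>2)"
  obtains y where "continuous_on UNIV y"
    "(\<integral>\<^sup>+w. ennreal (exp (\<delta> * exp (- lam * T) / 2 * (mdist (path_space T) (restrict y {0..T}) (restrict (\<lambda>t. X t w) {0..T}))\<^sup>2)) \<partial>M)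
      \<le> ennreal (2 * exp (T * (\<delta> * (4 * n * A\<^sup>2 + 2 * (B + 1) + 1)) / 2))"
proof -
  have bm: "brownian_motion M F W" and c: "\<And>w. w \<in> space M \<Longrightarrow> continuous_on {0..} (\<lambda>t. X t w)"
    and X: "\<And>t. t \<ge> 0 \<Longrightarrow> X t \<in> borel_measurable (F t)" and X0: "AE w in M. X 0 w = x"
    using sol by (auto simp: sde_solution_def)
  interpret prob_space M by (rule brownian_motionD[OF bm])
  note sub = brownian_motionD(2)[OF bm]
  obtain y g where y: "continuous_on UNIV y" and g: "continuous_on UNIV g"
    and yg: "\<And>t. t \<in> {0..T} \<Longrightarrow> y t = x + integral {0..t} g"
    and gb: "\<And>t. t \<in> {0..T} \<Longrightarrow> norm (g t - b (y t)) \<le> 1"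
    by (rule approximate_ode_solution[OF b B one T, where x=x]) blast
  define L where "L = (\<lambda>t w. X t w - x - integral {0..t} (\<lambda>s. b (X s w)))"
  define Z where "Z = (\<lambda>t w. X t w - y t)"
  define \<kappa>\<^sub>1 where "\<kappa>\<^sub>1 = 4 * n\<^sup>2 * A\<^sup>2"
  define \<kappa>\<^sub>2 where "\<kappa>\<^sub>2 = 4 * n * A\<^sup>2"
  \<comment> \<open>B + 1 instead of B absorbs the error |g - b (y)| \<le> 1; the last 1 is the
    error \<open>\<epsilon>\<close> allowed in the pathwise estimate.\<close>
  define Q where "Q = T * (\<delta> * (\<kappa>\<^sub>2 + 2 * (B + 1) + 1))"
  have n: "n > 0" by (simp add: n_def add_nonneg_pos)
  have A1: "A\<^sup>2 + 1 > 0" by (rule add_nonneg_pos) auto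
  have \<delta>: "\<delta> > 0" unfolding \<delta>_def using n T A1 by (intro divide_pos_pos mult_pos_pos) auto
  have \<kappa>: "\<kappa>\<^sub>1 \<ge> 0" "\<kappa>\<^sub>2 \<ge> 0" using n by (auto simp: \<kappa>\<^sub>1_def \<kappa>\<^sub>2_def)
  have lam: "lam = 2 * (B + 1) + \<kappa>\<^sub>1 * \<delta>" by (simp add: lam_def \<kappa>\<^sub>1_def)
  have lam0: "lam \<ge> 0" unfolding lam using B \<kappa> \<delta> by simp
  \<comment> \<open>The smallness that \<open>energy_increment_exp\<close> asks for, secured for the
    coarsest mesh h = T and the largest weight \<delta>. The 1 in A^2 + 1 keeps \<delta> positive
    even for A = 0, where division by 0 would make it 0.\<close>
  have \<delta>A: "4 * (n * \<delta>) * (A\<^sup>2 * T) \<le> 1 / 2"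
  proof -
    define q where "q = A\<^sup>2 + 1"
    have "q > 0" using A1 by (simp add: q_def)
    then have "4 * (n * \<delta>) * (A\<^sup>2 * T) = A\<^sup>2 / (2 * q)" unfolding \<delta>_def q_def[symmetric] using n T by (simp add: field_simps)
    then have "4 * (n * \<delta>) * (A\<^sup>2 * T) = A\<^sup>2 / (2 * (A\<^sup>2 + 1))" by (simp add: q_def)
    also have "\<dots> \<le> 1 / 2" using A1 by (simp add: field_simps)
    finally show ?thesis .
  qed
  let ?w = "energy_weight \<delta> lam T"
  let ?D = "\<lambda>N j w. energy_step \<delta> lam \<kappa>\<^sub>1 \<kappa>\<^sub>2 (\<lambda>t. Z t w) (\<lambda>t. L t w) T N j"
  have w: "0 \<le> ?w N j" "?w N j \<le> \<delta>" for N j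
    unfolding energy_weight_def using \<delta> lam0 T by (auto intro!: mult_left_le simp: mult_nonneg_nonneg)
  have Lm: "L t \<in> borel_measurable (F t)" if "t \<ge> 0" for t
    unfolding L_def by (rule sde_noise_adapted[OF bm X c b that])
  have Zm: "Z t \<in> borel_measurable (F t)" if "t \<ge> 0" for t
    unfolding Z_def using X[OF that] by measurable
  \<comment> \<open>The bound 2 is the same for all grids, which is all that Fatou's lemma will
    need.\<close>
  have "\<exists>R. R \<in> borel_measurable M \<and> (\<forall>w. \<forall>k\<le>N. exp ((\<Sum>j<k. ?D N j w) / 2) \<le> R w) \<and>
    (\<integral>\<^sup>+w. ennreal (R w) \<partial>M) \<le> 2" for N
  proof -
    define u where "u = (\<lambda>j. real j * T / real N)"
    have u0: "0 \<le> u j" for j using T by (simp add: u_def)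
    have u: "real j * T / real N = u j" for j by (simp add: u_def)
    have us: "u j < u (Suc j)" "u (Suc j) - u j = T / N" if "j < N" for j
      using that T unfolding u_def by (simp_all add: divide_strict_right_mono diff_divide_distrib[symmetric] algebra_simps)
    have Dm: "?D N j \<in> borel_measurable (F (u (Suc j)))" if j: "j < N" for j
    proof -
      have s: "subalgebra (F (u (Suc j))) (F (u j))" using us[OF j] by (intro brownian_motionD(3)[OF bm]) simp
      note [measurable] = measurable_from_subalg[OF s Lm[OF u0]] measurable_from_subalg[OF s Zm[OF u0]] Lm[OF u0[of "Suc j"]]
      show ?thesis unfolding energy_step_def Let_def u by measurable
    qed
    have E: "(\<integral>\<^sup>+w. ennreal (Y w * exp (?D N j w)) \<partial>M) \<le> (\<integral>\<^sup>+w. ennreal (Y w) \<partial>M)"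
      if j: "j < N" and Y: "Y \<in> borel_measurable (F (u j))" and Y0: "\<And>w. 0 \<le> Y w" for j Y
    proof -
      have small: "4 * ((real CARD('d) + 1) * ?w N (Suc j)) * (A\<^sup>2 * (T / N)) \<le> 1 / 2"
      proof -
        have "T / N \<le> T / 1" using T j by (intro divide_left_mono) auto
        then have "4 * (n * ?w N (Suc j)) * (A\<^sup>2 * (T / N)) \<le> 4 * (n * \<delta>) * (A\<^sup>2 * T)"
          using w n T \<delta> by (intro mult_mono mult_nonneg_nonneg) auto
        with \<delta>A show ?thesis by (simp add: n_def)
      qed
      have "L (u (Suc j)) \<in> borel_measurable M" "L (u j) \<in> borel_measurable M"
        using measurable_from_subalg[OF sub Lm[OF u0]] by blast+
      then have dm: "(\<lambda>w. L (u (Suc j)) w - L (u j) w) \<in> borel_measurable M" by (rule borel_measurable_diff)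
      have inc: "(\<integral>\<^sup>+w. ennreal (Y w * exp (\<theta> w \<bullet> (L (u (Suc j)) w - L (u j) w) - (norm (\<theta> w))\<^sup>2 * (A\<^sup>2 * (T / N)))) \<partial>M)
        \<le> (\<integral>\<^sup>+w. ennreal (Y w) \<partial>M)"
        if "Y \<in> borel_measurable (F (u j))" "\<And>w. 0 \<le> Y w" "\<theta> \<in> borel_measurable (F (u j))" for Y \<theta>
        using sde_noise_increment_exp[OF sol b A u0[of j] us(1)[OF j] that] unfolding us(2)[OF j] L_def by blast
      show ?thesis
        unfolding energy_step_def Let_def u \<kappa>\<^sub>1_def \<kappa>\<^sub>2_def n_def
        by (rule energy_increment_exp[OF prob_space_axioms sub dm Zm[OF u0] Y Y0 inc _ w(1) small]) (use T in auto)
    qed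
    have s: "subalgebra (F (u (Suc j))) (F (u j))" if "j < N" for j
      using us[OF that] by (intro brownian_motionD(3)[OF bm]) simp
    show ?thesis
    proof (rule exp_half_maximal_inequality[where M=M and N=N and G="\<lambda>j. F (u j)" and D="\<lambda>j w. ?D N j w"])
      show "(\<integral>\<^sup>+w. ennreal (Y w * exp (?D N j w)) \<partial>M) \<le> (\<integral>\<^sup>+w. ennreal (Y w) \<partial>M)"
        if "j < N" "Y \<in> borel_measurable (F (u j))" "\<And>w. 0 \<le> Y w" for j Y
        using that by (rule E)
    next
      fix R assume "R \<in> borel_measurable M" "\<And>w k. k \<le> N \<Longrightarrow> exp ((\<Sum>j<k. ?D N j w) / 2) \<le> R w"
        "(\<integral>\<^sup>+w. ennreal (R w) \<partial>M) \<le> 2"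
      then show ?thesis by blast
    qed (use prob_space_axioms sub s Dm in blast)+
  qed
  then obtain R where R[measurable]: "\<And>N. R N \<in> borel_measurable M"
    and RD: "\<And>N w k. k \<le> N \<Longrightarrow> exp ((\<Sum>j<k. ?D N j w) / 2) \<le> R N w"
    and R2: "\<And>N. (\<integral>\<^sup>+w. ennreal (R N w) \<partial>M) \<le> 2" by metis
  let ?\<phi> = "\<lambda>w. mdist (path_space T) (restrict y {0..T}) (restrict (\<lambda>t. X t w) {0..T})"
  \<comment> \<open>exp (- lam T) is the smallest weight on [0, T], and 1 / 2 is the half exponent
    of the maximal inequality.\<close>
  define \<delta>' where "\<delta>' = \<delta> * exp (- lam * T) / 2"
  have \<delta>': "\<delta>' > 0" using \<delta> by (simp add: \<delta>'_def)
  \<comment> \<open>From which N on the energy estimate holds depends on w; the liminf hides this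
    dependence.\<close>
  have key: "AE w in M. ennreal (exp (\<delta>' * (?\<phi> w)\<^sup>2)) \<le> liminf (\<lambda>N. ennreal (exp (Q / 2) * R N w))"
    using X0 AE_space
  proof eventually_elim
    case (elim w)
    have cX: "continuous_on {0..T} (\<lambda>t. X t w)" by (rule continuous_on_subset[OF c[OF elim(2)]]) auto
    have cy: "continuous_on {0..T} y" "continuous_on {0..T} g" by (rule continuous_on_subset[OF y] continuous_on_subset[OF g], simp)+
    have cZ: "continuous_on {0..T} (\<lambda>t. Z t w)" unfolding Z_def by (intro continuous_intros cX cy)
    have cbX: "continuous_on {0..T} (\<lambda>s. b (X s w))" by (intro continuous_on_compose2[OF b cX]) auto
    have cL: "continuous_on {0..T} (\<lambda>t. L t w)" unfolding L_def
      by (intro continuous_intros cX indefinite_integral_continuous_1 integrable_continuous_interval cbX)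
    define \<beta> where "\<beta> = (\<lambda>s. b (X s w) - g s)"
    have c\<beta>: "continuous_on {0..T} \<beta>" unfolding \<beta>_def by (intro continuous_intros cbX cy)
    have eq: "Z t w = L t w + integral {0..t} \<beta>" if t: "t \<in> {0..T}" for t
    proof -
      have "integral {0..t} \<beta> = integral {0..t} (\<lambda>s. b (X s w)) - integral {0..t} g" unfolding \<beta>_def
        using t by (intro Henstock_Kurzweil_Integration.integral_diff integrable_continuous_interval continuous_on_subset[OF cbX] continuous_on_subset[OF g]) auto
      then show ?thesis using yg[OF t] by (simp add: Z_def L_def)
    qed
    have Z0: "Z 0 w = 0" using yg[of 0] T elim(1) by (simp add: Z_def)
    have dr: "Z t w \<bullet> \<beta> t \<le> (B + 1) * (1 + (norm (Z t w))\<^sup>2)" if t: "t \<in> {0..T}" for t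
    proof -
      have "Z t w \<bullet> \<beta> t = (X t w - y t) \<bullet> (b (X t w) - b (y t)) + Z t w \<bullet> (b (y t) - g t)"
        by (simp add: Z_def \<beta>_def inner_diff_right)
      also have "(X t w - y t) \<bullet> (b (X t w) - b (y t)) \<le> B * (1 + (norm (Z t w))\<^sup>2)"
        using one[of "X t w" "y t"] by (simp add: Z_def)
      also have "Z t w \<bullet> (b (y t) - g t) \<le> 1 + (norm (Z t w))\<^sup>2"
      proof -
        have "Z t w \<bullet> (b (y t) - g t) \<le> norm (Z t w) * norm (b (y t) - g t)" by (rule norm_cauchy_schwarz)
        also have "\<dots> \<le> norm (Z t w) * 1" using gb[OF t] by (intro mult_left_mono) (auto simp: norm_minus_commute)
        also have "\<dots> \<le> 1 + (norm (Z t w))\<^sup>2"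
        proof -
          have "(norm (Z t w) - 1)\<^sup>2 = (norm (Z t w))\<^sup>2 - 2 * norm (Z t w) + 1" by (simp add: power2_diff)
          then show ?thesis using zero_le_power2[of "norm (Z t w) - 1"] norm_ge_zero[of "Z t w"] by linarith
        qed
        finally show ?thesis .
      qed
      finally show ?thesis by (simp add: algebra_simps)
    qed
    have B1: "B + 1 \<ge> 0" using B by simp
    have ev: "\<forall>\<^sub>F N in sequentially. \<forall>k\<le>N. ?w N k * (norm (Z (real k * T / N) w))\<^sup>2 \<le> (\<Sum>j<k. ?D N j w) + Q"
      using energy_path_estimate[OF T cZ cL c\<beta> eq Z0 dr B1 \<kappa> \<delta> lam zero_less_one] unfolding Q_def .
    have "continuous_on {0..T} (\<lambda>t. norm (Z t w))" by (intro continuous_intros cZ)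
    then obtain tm where tm: "tm \<in> {0..T}" "\<And>t. t \<in> {0..T} \<Longrightarrow> norm (Z t w) \<le> norm (Z tm w)"
      using continuous_attains_sup[of "{0..T}" "\<lambda>t. norm (Z t w)"] T by auto
    \<comment> \<open>The index of the last grid point up to \<open>tm\<close>, a time of largest
      distance. These grid points tend to \<open>tm\<close>, so that control on the grid reaches the
      supremum.\<close>
    define k where "k = (\<lambda>N. nat \<lfloor>tm * real N / T\<rfloor>)"
    have kb: "real (k N) \<le> tm * real N / T" "tm * real N / T < real (k N) + 1" for N
      using tm(1) T unfolding k_def by (auto simp: of_nat_nat)
    have kN: "k N \<le> N" for N
    proof -
      have "tm * real N / T \<le> real N" using tm(1) T by (simp add: divide_le_eq mult_right_mono mult.commute)
      then show ?thesis using kb(1)[of N] by linarith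
    qed
    have kI: "real (k N) * T / N \<in> {0..T}" for N
    proof (cases "N = 0")
      case False then show ?thesis using kN[of N] T by (simp add: divide_le_eq mult_right_mono mult.commute)
    qed (use T in simp)
    have klim: "(\<lambda>N. real (k N) * T / N) \<longlonglongrightarrow> tm"
    proof (rule tendsto_sandwich)
      show "\<forall>\<^sub>F N in sequentially. tm - T / real N \<le> real (k N) * T / N"
        using eventually_gt_at_top[of 0]
      proof eventually_elim
        case (elim N)
        have "tm * real N < (real (k N) + 1) * T" using kb(2)[of N] T by (simp only: pos_divide_less_eq)
        then have "tm < (real (k N) + 1) * T / N" using elim by (subst pos_less_divide_eq) auto
        then show ?case by (simp add: distrib_right add_divide_distrib)
      qed
      show "\<forall>\<^sub>F N in sequentially. real (k N) * T / N \<le> tm"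
        using eventually_gt_at_top[of 0]
      proof eventually_elim
        case (elim N)
        then show ?case using kb(1)[of N] T by (simp add: field_simps)
      qed
      have "(\<lambda>N. tm - T / real N) \<longlonglongrightarrow> tm - 0" by (intro tendsto_diff tendsto_const lim_const_over_n)
      then show "(\<lambda>N. tm - T / real N) \<longlonglongrightarrow> tm" by simp
    qed (rule tendsto_const)
    have Zlim: "(\<lambda>N. Z (real (k N) * T / N) w) \<longlonglongrightarrow> Z tm w"
      by (rule continuous_on_tendsto_compose[OF cZ klim tm(1)]) (use kI in auto)
    have lim: "(\<lambda>N. ennreal (exp (\<delta>' * (norm (Z (real (k N) * T / N) w))\<^sup>2))) \<longlonglongrightarrow> ennreal (exp (\<delta>' * (norm (Z tm w))\<^sup>2))"
      by (intro tendsto_ennrealI tendsto_intros Zlim)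
    have "?\<phi> w \<le> norm (Z tm w)"
    proof (subst mdist_path_space_le[OF _ _ T])
      show "restrict y {0..T} \<in> mspace (path_space T)" "restrict (\<lambda>t. X t w) {0..T} \<in> mspace (path_space T)"
        using cy(1) cX by (auto simp: mspace_path_space cong: continuous_on_cong_simp)
      show "\<forall>t\<in>{0..T}. dist (restrict y {0..T} t) (restrict (\<lambda>t. X t w) {0..T} t) \<le> norm (Z tm w)"
        using tm(2) by (auto simp: dist_norm Z_def norm_minus_commute)
    qed
    moreover have "0 \<le> ?\<phi> w" by simp
    ultimately have "(?\<phi> w)\<^sup>2 \<le> (norm (Z tm w))\<^sup>2" by (rule power_mono)
    then have "ennreal (exp (\<delta>' * (?\<phi> w)\<^sup>2)) \<le> ennreal (exp (\<delta>' * (norm (Z tm w))\<^sup>2))"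
      using \<delta>' by (intro ennreal_leI) simp
    also have "\<dots> = liminf (\<lambda>N. ennreal (exp (\<delta>' * (norm (Z (real (k N) * T / N) w))\<^sup>2)))"
      using lim by (intro lim_imp_Liminf[symmetric]) auto
    also have "\<dots> \<le> liminf (\<lambda>N. ennreal (exp (Q / 2) * R N w))"
    proof (rule Liminf_mono, use ev in eventually_elim)
      case (elim N)
      define q where "q = (norm (Z (real (k N) * T / N) w))\<^sup>2"
      have "lam * (real (k N) * T / N) \<le> lam * T" using kI[of N] lam0 by (intro mult_left_mono) auto
      then have "\<delta> * exp (- lam * T) \<le> ?w N (k N)" unfolding energy_weight_def using \<delta> by (intro mult_left_mono) auto
      then have "\<delta> * exp (- lam * T) * q \<le> ?w N (k N) * q" by (intro mult_right_mono) (auto simp: q_def)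
      also have "\<dots> \<le> (\<Sum>j<k N. ?D N j w) + Q" using elim kN[of N] by (simp add: q_def)
      finally have "\<delta>' * q \<le> Q / 2 + (\<Sum>j<k N. ?D N j w) / 2" by (simp add: \<delta>'_def field_simps)
      then have "exp (\<delta>' * q) \<le> exp (Q / 2) * exp ((\<Sum>j<k N. ?D N j w) / 2)" unfolding mult_exp_exp by simp
      also have "\<dots> \<le> exp (Q / 2) * R N w" by (intro mult_left_mono RD kN) simp
      finally show ?case unfolding q_def by (rule ennreal_leI)
    qed
    finally show ?case .
  qed
  have "(\<integral>\<^sup>+w. ennreal (exp (\<delta>' * (?\<phi> w)\<^sup>2)) \<partial>M) \<le> (\<integral>\<^sup>+w. liminf (\<lambda>N. ennreal (exp (Q / 2) * R N w)) \<partial>M)"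
    by (rule nn_integral_mono_AE[OF key])
  also have "\<dots> \<le> liminf (\<lambda>N. \<integral>\<^sup>+w. ennreal (exp (Q / 2) * R N w) \<partial>M)" by (rule nn_integral_liminf) measurable
  also have "\<dots> \<le> liminf (\<lambda>N. ennreal (2 * exp (Q / 2)))"
  proof (rule Liminf_mono, rule always_eventually, rule allI)
    fix N
    have "(\<integral>\<^sup>+w. ennreal (exp (Q / 2) * R N w) \<partial>M) = ennreal (exp (Q / 2)) * (\<integral>\<^sup>+w. ennreal (R N w) \<partial>M)"
      by (simp add: ennreal_mult' nn_integral_cmult)
    also have "\<dots> \<le> ennreal (exp (Q / 2)) * 2" by (intro mult_left_mono R2) simp
    also have "\<dots> = ennreal (2 * exp (Q / 2))" using ennreal_mult'[of "exp (Q / 2)" 2] by (simp add: mult.commute)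
    finally show "(\<integral>\<^sup>+w. ennreal (exp (Q / 2) * R N w) \<partial>M) \<le> ennreal (2 * exp (Q / 2))" .
  qed
  also have "\<dots> = ennreal (2 * exp (Q / 2))" by (simp add: Liminf_const)
  finally show ?thesis
    by (intro that[OF y]) (simp add: \<delta>'_def Q_def \<kappa>\<^sub>2_def)
qed

theorem corollary4p1:
  fixes T A B :: real
  assumes "T > 0"
  shows "\<exists>C>0. \<forall>(\<sigma> :: real^'d \<Rightarrow> real^'n^'d) (b :: real^'d \<Rightarrow> real^'d).
    local_lipschitz (UNIV :: real set) UNIV (\<lambda>_. \<sigma>) \<and>
    local_lipschitz (UNIV :: real set) UNIV (\<lambda>_. b) \<and>
    (\<forall>x. hs_norm (\<sigma> x) \<le> A) \<and>
    (\<forall>x y. (y - x) \<bullet> (b y - b x) \<le> B * (1 + (norm (y - x))\<^sup>2)) \<longrightarrow>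
    (\<forall>x (M :: 'w measure) F W X.
       sde_solution M F W \<sigma> b x X \<longrightarrow>
       T1_inequality C (path_space T) (path_law M T X))"
proof -
  define n where "n = real CARD('d) + 1"
  \<comment> \<open>The constants are fixed before b is given. A negative B admits no b at all (take
    y = x), and the maximum provides a nonnegative constant in every case.\<close>
  define B' where "B' = max B 0"
  define \<delta> where "\<delta> = 1 / (8 * n * (A\<^sup>2 + 1) * T)"
  define lam where "lam = 2 * (B' + 1) + 4 * n\<^sup>2 * A\<^sup>2 * \<delta>"
  define \<delta>' where "\<delta>' = \<delta> * exp (- lam * T) / 2"
  define K where "K = 2 * exp (T * (\<delta> * (4 * n * A\<^sup>2 + 2 * (B' + 1) + 1)) / 2)"
  \<comment> \<open>The value from the Gaussian moment criterion; it depends on T, A, B and the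
    dimension of the state space only.\<close>
  define C where "C = ((1 + 2 * K) / \<delta>' + 1)\<^sup>2 / 2"
  have n: "n > 0" by (simp add: n_def add_nonneg_pos)
  have "A\<^sup>2 + 1 > 0" by (rule add_nonneg_pos) auto
  then have "\<delta> > 0" unfolding \<delta>_def using n assms by (intro divide_pos_pos mult_pos_pos) auto
  then have \<delta>': "\<delta>' > 0" by (simp add: \<delta>'_def)
  have K: "K \<ge> 0" by (simp add: K_def)
  have "(1 + 2 * K) / \<delta>' + 1 > 0" using K \<delta>' by (simp add: add_nonneg_pos)
  then have "C > 0" by (simp add: C_def)
  moreover have "T1_inequality C (path_space T) (path_law M T X)"
    if lip: "local_lipschitz (UNIV :: real set) UNIV (\<lambda>_. b)" and \<sigma>: "\<forall>x. hs_norm (\<sigma> x) \<le> A"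
      and one: "\<forall>x y. (y - x) \<bullet> (b y - b x) \<le> B * (1 + (norm (y - x))\<^sup>2)"
      and sol: "sde_solution M F W \<sigma> b x X"
    for \<sigma> :: "real^'d \<Rightarrow> real^'n^'d" and b :: "real^'d \<Rightarrow> real^'d" and x M and F :: "real \<Rightarrow> 'w measure" and W X
  proof -
    have bm: "brownian_motion M F W" and c: "\<And>w. w \<in> space M \<Longrightarrow> continuous_on {0..} (\<lambda>t. X t w)"
      and X: "\<And>t. t \<ge> 0 \<Longrightarrow> X t \<in> borel_measurable (F t)"
      using sol by (auto simp: sde_solution_def)
    have b: "continuous_on UNIV b" using local_lipschitz_continuous_on[OF lip] by simp
    have one': "(y - x) \<bullet> (b y - b x) \<le> B' * (1 + (norm (y - x))\<^sup>2)" for x y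
    proof -
      have "B * (1 + (norm (y - x))\<^sup>2) \<le> B' * (1 + (norm (y - x))\<^sup>2)" by (intro mult_right_mono) (auto simp: B'_def)
      then show ?thesis using one by (meson order_trans)
    qed
    obtain y where y: "continuous_on UNIV y"
      and mom: "(\<integral>\<^sup>+w. ennreal (exp (\<delta>' * (mdist (path_space T) (restrict y {0..T}) (restrict (\<lambda>t. X t w) {0..T}))\<^sup>2)) \<partial>M) \<le> ennreal K"
      using sde_gaussian_moment[OF sol b _ assms _ one'] \<sigma>
      unfolding \<delta>'_def lam_def \<delta>_def K_def n_def B'_def by (metis max.cobounded2)
    have cX: "continuous_on {0..T} (\<lambda>t. X t w)" if "w \<in> space M" for w
      by (rule continuous_on_subset[OF c[OF that]]) auto
    have Xm: "(\<lambda>w. restrict (\<lambda>t. X t w) {0..T}) \<in> M \<rightarrow>\<^sub>M metric_borel (path_space T)"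
      using measurable_from_subalg[OF brownian_motionD(2)[OF bm] X] cX by (intro measurable_path assms) auto
    have ym: "restrict y {0..T} \<in> mspace (path_space T)"
      using continuous_on_subset[OF y] by (auto simp: mspace_path_space cong: continuous_on_cong_simp)
    note [measurable] = mdist_measurable_metric_borel[OF ym]
    show ?thesis
      unfolding C_def
    proof (rule T1_inequality_of_gaussian_moment[OF _ _ path_space_mdist_jointly_measurable[OF assms] ym \<delta>' K])
      show "prob_space (path_law M T X)"
        unfolding path_law_def using brownian_motionD(1)[OF bm] Xm by (rule prob_space.prob_space_distr)
      show "sets (path_law M T X) = sets (metric_borel (path_space T))" by (simp add: path_law_def)
      show "(\<integral>\<^sup>+\<gamma>. ennreal (exp (\<delta>' * (mdist (path_space T) (restrict y {0..T}) \<gamma>)\<^sup>2)) \<partial>path_law M T X) \<le> ennreal K"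
        unfolding path_law_def by (subst nn_integral_distr[OF Xm]) (measurable, rule mom)
    qed
  qed
  ultimately show ?thesis by blast
qed

end
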